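(* Let $g\in H(\mathbb{D})$, let $1\le p\le\infty$, and let $\omega\in\widehat{\mathcal{D}}$ satisfy the condition $$\sup_{0<r<1}\left(\int_0^r\frac{\widehat{\omega}(t)}{(1-t)^2}\,dt\right)^{1/2}\left(\int_r^1\frac{1}{\widehat{\omega}(t)}\,dt\right)^{1/2}<\infty.$$ Then the following conditions are equivalent: (i) $\mathcal{H}_g\in S_p(A^2_\omega)$; (ii) $g\in\mathcal{B}(2,p)$.
   Context: $\mathbb{D}$ is the open unit disc and $H(\mathbb{D})$ the space of analytic functions on $\mathbb{D}$; $dA=\frac{dx\,dy}{\pi}$. A weight is a function $\omega:\mathbb{D}\to(0,\infty)$ integrable over $\mathbb{D}$ with respect to $dA$; it is radial if $\omega(z)=\omega(|z|)$ for all $z$. For a radial weight $\omega$ put $\widehat{\omega}(r)=\int_r^1\omega(s)\,ds$. The class $\widehat{\mathcal{D}}$ consists of the radial weights $\omega$ with $\sup_{0<r<1}\frac{\widehat\omega(r)}{\widehat\omega\left(\frac{1+r}{2}\right)}<\infty$. The weighted Bergman space $A^2_\omega$ is the Hilbert space of $f\in H(\mathbb{D})$ with $\|f\|_{A^2_\omega}^2=\int_{\mathbb{D}}|f(z)|^2\omega(z)\,dA(z)<\infty$. For $g\in H(\mathbb{D})$, the generalized Hilbert operator is $\mathcal{H}_g(f)(z)=\int_0^1 f(t)g'(tz)\,dt$. $S_p(A^2_\omega)$, $1\le p<\infty$, is the Schatten $p$-class of operators on $A^2_\omega$; $S_\infty(A^2_\omega)$ is the space of bounded linear operators on $A^2_\omega$.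 With $M_2(r,f)=\left(\frac{1}{2\pi}\int_{-\pi}^{\pi}|f(re^{i\theta})|^2\,d\theta\right)^{1/2}$, the space $\mathcal{B}(2,p)$, $0<p<\infty$, consists of $g\in H(\mathbb{D})$ with $\|g\|_{\mathcal{B}(2,p)}^p=|g(0)|^p+\int_0^1 M_2^p(r,g')(1-r)^{\frac p2-1}\,dr<\infty$, and $\mathcal{B}(2,\infty)$ consists of $g\in H(\mathbb{D})$ with $\|g\|_{\mathcal{B}(2,\infty)}=|g(0)|+\sup_{0<r<1}M_2(r,g')(1-r)^{1/2}<\infty$. *)

theory Defs
  imports "HOL-Analysis.Analysis"
begin

section \<open>Radial weights\<close>

(* Only the values on ball 0 1 matter, here and below.  Lebesgue rather than Borel
   measurability is required of weights, so integrals are taken over lebesgue.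
   The factor 1/pi of dA is irrelevant for integrability. *)
definition weight :: "(complex \<Rightarrow> real) \<Rightarrow> bool" where
  "weight \<omega> \<longleftrightarrow>
     (\<forall>z\<in>ball 0 1. 0 < \<omega> z) \<and> set_integrable lebesgue (ball 0 1) \<omega>"

definition radial :: "(complex \<Rightarrow> real) \<Rightarrow> bool" where
  "radial \<omega> \<longleftrightarrow> (\<forall>z\<in>ball 0 1. \<omega> z = \<omega> (complex_of_real (cmod z)))"

(* For a radial weight this is finite for 0 < r < 1; at r = 0 it may be infinite,
   since the area element only controls \<omega>(s) * s near s = 0. *)
definition weight_hat :: "(complex \<Rightarrow> real) \<Rightarrow> real \<Rightarrow> ennreal" where
  "weight_hat \<omega> r = (\<integral>\<^sup>+ s\<in>{r<..<1}. ennreal (\<omega> (complex_of_real s)) \<partial>lebesgue)"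

definition Dhat :: "(complex \<Rightarrow> real) set" where
  "Dhat = {\<omega>. weight \<omega> \<and> radial \<omega> \<and>
     (SUP r\<in>{0<..<1}. weight_hat \<omega> r / weight_hat \<omega> ((1 + r) / 2)) < \<infinity>}"

definition ennreal_sqrt :: "ennreal \<Rightarrow> ennreal" where
  "ennreal_sqrt x = (if x = \<infinity> then \<infinity> else ennreal (sqrt (enn2real x)))"


section \<open>The weighted Bergman space and the generalized Hilbert operator\<close>

definition bergman_sq :: "(complex \<Rightarrow> real) \<Rightarrow> (complex \<Rightarrow> complex) \<Rightarrow> ennreal" where
  "bergman_sq \<omega> f =
     (\<integral>\<^sup>+ z\<in>ball 0 1. ennreal ((cmod (f z))\<^sup>2 * \<omega> z) \<partial>lebesgue) / ennreal pi"

(* A function on the disc is represented by its extension by zero, so that equality of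
   elements of the space is equality of HOL functions. *)
definition A2 :: "(complex \<Rightarrow> real) \<Rightarrow> (complex \<Rightarrow> complex) set" where
  "A2 \<omega> = {f. f holomorphic_on ball 0 1 \<and> (\<forall>z. z \<notin> ball 0 1 \<longrightarrow> f z = 0) \<and>
               bergman_sq \<omega> f < \<infinity>}"

definition A2_norm :: "(complex \<Rightarrow> real) \<Rightarrow> (complex \<Rightarrow> complex) \<Rightarrow> real" where
  "A2_norm \<omega> f = sqrt (enn2real (bergman_sq \<omega> f))"

definition hilbert_op ::
    "(complex \<Rightarrow> complex) \<Rightarrow> (complex \<Rightarrow> complex) \<Rightarrow> (complex \<Rightarrow> complex)" where
  "hilbert_op g f = (\<lambda>z. if z \<in> ball 0 1
     then LINT t:{0<..<1}|lebesgue. f (complex_of_real t) * deriv g (complex_of_real t * z)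
     else 0)"


section \<open>Schatten classes\<close>

(* V is a complex linear space of functions with pointwise operations, N a norm on it
   that makes it a Hilbert space.  An operator is a map on all functions of which only
   the restriction to V matters. *)
definition bounded_ops ::
    "('a \<Rightarrow> complex) set \<Rightarrow> (('a \<Rightarrow> complex) \<Rightarrow> real) \<Rightarrow>
     (('a \<Rightarrow> complex) \<Rightarrow> ('a \<Rightarrow> complex)) set" where
  "bounded_ops V N = {T. T ` V \<subseteq> V \<and>
     (\<forall>f\<in>V. \<forall>h\<in>V. T (\<lambda>x. f x + h x) = (\<lambda>x. T f x + T h x)) \<and>
     (\<forall>f\<in>V. \<forall>c. T (\<lambda>x. c * f x) = (\<lambda>x. c * T f x)) \<and>
     (\<exists>C. \<forall>f\<in>V. N (T f) \<le> C * N f)}"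

definition op_norm ::
    "('a \<Rightarrow> complex) set \<Rightarrow> (('a \<Rightarrow> complex) \<Rightarrow> real) \<Rightarrow>
     (('a \<Rightarrow> complex) \<Rightarrow> ('a \<Rightarrow> complex)) \<Rightarrow> real" where
  "op_norm V N T = (SUP f\<in>V. N (T f) / N f)"

definition compact_op ::
    "('a \<Rightarrow> complex) set \<Rightarrow> (('a \<Rightarrow> complex) \<Rightarrow> real) \<Rightarrow>
     (('a \<Rightarrow> complex) \<Rightarrow> ('a \<Rightarrow> complex)) \<Rightarrow> bool" where
  "compact_op V N T \<longleftrightarrow> (\<forall>u. (\<forall>n. u n \<in> V \<and> N (u n) \<le> 1) \<longrightarrow>
     (\<exists>h\<in>V. \<exists>s. strict_mono (s :: nat \<Rightarrow> nat) \<and>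
        (\<lambda>k. N (\<lambda>x. T (u (s k)) x - h x)) \<longlonglongrightarrow> 0))"

definition rank_le ::
    "('a \<Rightarrow> complex) set \<Rightarrow> nat \<Rightarrow> (('a \<Rightarrow> complex) \<Rightarrow> ('a \<Rightarrow> complex)) \<Rightarrow> bool" where
  "rank_le V n R \<longleftrightarrow>
     (\<exists>e. \<forall>f\<in>V. \<exists>c. R f = (\<lambda>x. \<Sum>k<n. c k * e k x))"

(* Distance to the bounded operators of rank at most n, n = 0, 1, 2, ...; on a Hilbert space
   these are the singular numbers of a compact T in decreasing order. *)
definition singular_value ::
    "('a \<Rightarrow> complex) set \<Rightarrow> (('a \<Rightarrow> complex) \<Rightarrow> real) \<Rightarrow>
     (('a \<Rightarrow> complex) \<Rightarrow> ('a \<Rightarrow> complex)) \<Rightarrow> nat \<Rightarrow> real" where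
  "singular_value V N T n =
     (INF R\<in>{R \<in> bounded_ops V N. rank_le V n R}. op_norm V N (\<lambda>f x. T f x - R f x))"

definition schatten ::
    "ennreal \<Rightarrow> ('a \<Rightarrow> complex) set \<Rightarrow> (('a \<Rightarrow> complex) \<Rightarrow> real) \<Rightarrow>
     (('a \<Rightarrow> complex) \<Rightarrow> ('a \<Rightarrow> complex)) set" where
  "schatten p V N = (if p = \<infinity> then bounded_ops V N
     else {T \<in> bounded_ops V N. compact_op V N T \<and>
             summable (\<lambda>n. singular_value V N T n powr enn2real p)})"


section \<open>The spaces B(2,p)\<close>

definition M2 :: "real \<Rightarrow> (complex \<Rightarrow> complex) \<Rightarrow> real" where
  "M2 r f = sqrt (1 / (2 * pi) * integral {-pi..pi} (\<lambda>\<theta>. (cmod (f (complex_of_real r * cis \<theta>)))\<^sup>2))"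

(* For p < \<infinity> this is the p-th power of the norm. *)
definition B2_gauge :: "ennreal \<Rightarrow> (complex \<Rightarrow> complex) \<Rightarrow> ennreal" where
  "B2_gauge p g = (if p = \<infinity>
     then ennreal (cmod (g 0)) +
          (SUP r\<in>{0<..<1}. ennreal (M2 r (deriv g) * (1 - r) powr (1 / 2)))
     else ennreal (cmod (g 0) powr enn2real p) +
          (\<integral>\<^sup>+ r\<in>{0<..<1}. ennreal (M2 r (deriv g) powr enn2real p *
              (1 - r) powr (enn2real p / 2 - 1)) \<partial>lebesgue))"

definition B2 :: "ennreal \<Rightarrow> (complex \<Rightarrow> complex) set" where
  "B2 p = {g. g holomorphic_on ball 0 1 \<and> B2_gauge p g < \<infinity>}"

end

theory Submission
  imports Defs "HOL-Complex_Analysis.Complex_Analysis"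
begin

text \<open>Write \<open>g' = \<Sum> b\<^sub>n z\<^sup>n\<close> and let \<open>w\<^sub>n\<close> be the square of the norm of \<open>z\<^sup>n\<close>. On Taylor
  coefficients the operator is the matrix \<open>b\<^sub>n / (n + k + 1)\<close>, acting on the sequence space with
  weight \<open>w\<close>. Let \<open>\<beta>\<^sub>j\<^sup>2\<close> be the mean of \<open>|b\<^sub>n|\<^sup>2\<close> over the block \<open>2\<^sup>j \<le> n + 1 < 2\<^sup>j\<^sup>+\<^sup>1\<close>.
  Integration over dyadic annuli shows that \<open>g \<in> B(2,p)\<close> iff \<open>(\<beta>\<^sub>j)\<close> is in \<open>l\<^sup>p\<close>, so the
  singular numbers have to be compared with \<open>(\<beta>\<^sub>j)\<close>. By doubling, \<open>w\<close> is almost constant on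
  blocks, and the Muckenhoupt condition bounds the norm of the block \<open>(j, l)\<close> of the matrix by a
  multiple of \<open>\<beta>\<^sub>j\<close> times the \<open>|j - l|\<close>-th power of some \<open>\<rho> < 1\<close>. For the upper bound,
  expanding \<open>1 / (n + k + 1)\<close> about the centre of block \<open>j\<close> approximates the rows of that block
  by rank \<open>r\<close> with an error of order \<open>\<beta>\<^sub>j / 3\<^sup>r\<close>; hence the singular numbers are
  dominated by the rearrangement of the double sequence \<open>\<beta>\<^sub>j / 3\<^sup>i\<close>. For the lower bound,
  on the span of the block sums of \<open>z\<^sup>k\<close> over a sparse set of blocks the operator is almost
  diagonal, hence bounded below by a multiple of the least \<open>\<beta>\<^sub>j\<close>; a subspace of dimension \<open>N + 1\<close>
  meets the kernel of every operator of rank \<open>N\<close>.\<close>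

section \<open>Dyadic blocks and a weighted Hilbert inequality\<close>

text \<open>Decay of the matrix below the diagonal is free, since \<open>w\<close> decreases. Above
  it the squared norm of block \<open>(j, l)\<close> is about \<open>2 ^ j * v j\<close> over
  \<open>2 ^ l * v l\<close>, where \<open>v j\<close> is the value of \<open>w\<close> on block
  \<open>j\<close>, and doubling alone would let this grow with \<open>l - j\<close>. The
  Muckenhoupt condition at the radius \<open>1 - (1 / 2) ^ k\<close> says that the sum over
  \<open>l > k\<close> of \<open>d l = (1 / 2) ^ l / v l\<close> is at most a constant times
  \<open>d k\<close>. A sequence whose tails are bounded by their leading terms decays
  geometrically; this yields the ratio below 1. Singular numbers enter only as distances to
  operators of finite rank, so explicit approximants bound them from above and test vectors from
  below, and no spectral decomposition occurs. The expansion error has the same ratio in every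
  block, so ranks may be distributed freely over the blocks and only their total counts.
  Rearrangements are replaced by an injective choice in one direction and by removing the least term
  in the other. On the side of the weight, the integral over the radius may diverge at 0; masses of
  planar annuli, which stay finite, take its place.\<close>

definition blk :: "nat \<Rightarrow> nat set" where
  "blk j = {2 ^ j - 1..<2 ^ Suc j - 1}"

lemma mem_blk: "n \<in> blk j \<longleftrightarrow> 2 ^ j \<le> Suc n \<and> Suc n < 2 ^ Suc j"
proof -
  have "(1::nat) \<le> 2 ^ j" by simp
  then show ?thesis by (auto simp: blk_def)
qed

lemma finite_blk [simp, intro]: "finite (blk j)"
  by (simp add: blk_def)

lemma card_blk: "card (blk j) = 2 ^ j"
  by (simp add: blk_def)

lemma blk_first: "2 ^ j - 1 \<in> blk j"
  by (simp add: mem_blk)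

lemma blk_unique: "n \<in> blk i \<Longrightarrow> n \<in> blk j \<Longrightarrow> i = j"
proof (induction i j rule: linorder_wlog)
  case (le i j)
  show ?case
  proof (rule ccontr)
    assume "i \<noteq> j"
    then have "Suc i \<le> j" using le by simp
    then have "(2::nat) ^ Suc i \<le> 2 ^ j" by (intro power_increasing) auto
    then show False using le by (simp add: mem_blk)
  qed
qed auto

definition blk_of :: "nat \<Rightarrow> nat" where
  "blk_of n = (THE j. n \<in> blk j)"

lemma ex_blk: "\<exists>j. n \<in> blk j"
  using ex_power_ivl1[of 2 "Suc n"] by (auto simp: mem_blk)

lemma blk_of: "n \<in> blk (blk_of n)"
  unfolding blk_of_def by (rule theI') (use ex_blk blk_unique in blast)

lemma blk_of_eq: "n \<in> blk j \<Longrightarrow> blk_of n = j"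
  using blk_of blk_unique by blast

lemma blk_of_less_iff: "blk_of n < J \<longleftrightarrow> n < 2 ^ J - 1"
proof
  assume "blk_of n < J"
  then have "(2::nat) ^ Suc (blk_of n) \<le> 2 ^ J" by (intro power_increasing) auto
  then show "n < 2 ^ J - 1" using blk_of[of n] unfolding mem_blk by linarith
next
  assume "n < 2 ^ J - 1"
  then have "(2::nat) ^ blk_of n < 2 ^ J" using blk_of[of n] unfolding mem_blk by linarith
  then show "blk_of n < J" by simp
qed

text \<open>The shift by one in \<open>blk\<close> puts index 0 into a block and makes the first
  \<open>J\<close> blocks fill an initial segment exactly; this is the source of the cutoffs
  \<open>2 ^ J - 1\<close>.\<close>

lemma sum_blk: "(\<Sum>n<2 ^ J - 1. f n) = (\<Sum>j<J. \<Sum>n\<in>blk j. f n)" for f :: "nat \<Rightarrow> 'a::comm_monoid_add"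
proof -
  have "{..<2 ^ J - 1} = (\<Union>j\<in>{..<J}. blk j)"
    using blk_of blk_of_eq blk_of_less_iff by blast
  then show ?thesis
    using blk_unique by (simp, subst sum.UNION_disjoint) auto
qed

definition dyad :: "(nat \<Rightarrow> complex) \<Rightarrow> nat \<Rightarrow> real" where
  "dyad b j = sqrt ((\<Sum>n\<in>blk j. (cmod (b n))\<^sup>2) / 2 ^ j)"

lemma dyad_nonneg: "0 \<le> dyad b j"
  by (simp add: dyad_def sum_nonneg)

lemma dyad_sq: "2 ^ j * (dyad b j)\<^sup>2 = (\<Sum>n\<in>blk j. (cmod (b n))\<^sup>2)"
  by (simp add: dyad_def sum_nonneg)

lemma real_mem_blk: "n \<in> blk j \<Longrightarrow> 2 ^ j \<le> real (Suc n) \<and> real (Suc n) < 2 * 2 ^ j"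
  unfolding mem_blk power_Suc[symmetric]
  by (metis of_nat_le_iff of_nat_less_iff of_nat_numeral of_nat_power)

section \<open>Schur test for kernels decaying with the distance of blocks\<close>

definition nd :: "nat \<Rightarrow> nat \<Rightarrow> nat" where
  "nd i j = (i - j) + (j - i)"

lemma nd_commute: "nd i j = nd j i"
  by (simp add: nd_def)

lemma two_power_mult_self: "(2::real) ^ n * 2 ^ n = 4 ^ n"
  by (simp only: power_mult_distrib[symmetric]) simp

lemma sum_geometric_le:
  fixes \<rho> :: real
  assumes "0 \<le> \<rho>" "\<rho> < 1" "finite G" "\<And>i. i \<in> G \<Longrightarrow> m \<le> i"
  shows "(\<Sum>i\<in>G. \<rho> ^ i) \<le> \<rho> ^ m / (1 - \<rho>)"
proof -
  have s: "(\<lambda>i. \<rho> ^ m * \<rho> ^ i) sums (\<rho> ^ m * (1 / (1 - \<rho>)))"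
    using assms by (intro sums_mult geometric_sums) auto
  have "(\<Sum>i\<in>G. \<rho> ^ i) = (\<Sum>i\<in>(\<lambda>i. i - m) ` G. \<rho> ^ m * \<rho> ^ i)"
    using assms(4) by (subst sum.reindex) (auto simp: power_add[symmetric] intro!: inj_onI dest: eq_diff_iff[THEN iffD1, rotated 2])
  also have "\<dots> \<le> suminf (\<lambda>i. \<rho> ^ m * \<rho> ^ i)"
    using s assms by (intro sum_le_suminf) (auto simp: sums_iff)
  finally show ?thesis using s by (simp add: sums_iff)
qed

text \<open>Indices on either side of \<open>l\<close> give one geometric series each. The cutoff
  \<open>m\<close> is 0 in the norm bounds and becomes the separation of the chosen blocks in the
  lower bound.\<close>

lemma sum_nd_le:
  fixes \<rho> :: real
  assumes \<rho>: "0 \<le> \<rho>" "\<rho> < 1" and F: "finite F" "\<And>j. j \<in> F \<Longrightarrow> m \<le> nd j l"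
  shows "(\<Sum>j\<in>F. \<rho> ^ nd j l) \<le> 2 * \<rho> ^ m / (1 - \<rho>)"
proof -
  have "(\<Sum>j\<in>F. \<rho> ^ nd j l) = (\<Sum>j\<in>F \<inter> {..l}. \<rho> ^ nd j l) + (\<Sum>j\<in>F \<inter> {l<..}. \<rho> ^ nd j l)"
    using F by (subst sum.union_disjoint[symmetric]) (auto intro!: sum.cong)
  also have "(\<Sum>j\<in>F \<inter> {..l}. \<rho> ^ nd j l) = (\<Sum>i\<in>(\<lambda>j. l - j) ` (F \<inter> {..l}). \<rho> ^ i)"
    by (subst sum.reindex) (auto simp: inj_on_def nd_def)
  also have "\<dots> \<le> \<rho> ^ m / (1 - \<rho>)"
    using F by (intro sum_geometric_le \<rho>) (force simp: nd_def)+
  also have "(\<Sum>j\<in>F \<inter> {l<..}. \<rho> ^ nd j l) = (\<Sum>i\<in>(\<lambda>j. j - l) ` (F \<inter> {l<..}). \<rho> ^ i)"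
    by (subst sum.reindex) (auto simp: inj_on_def nd_def)
  also have "\<dots> \<le> \<rho> ^ m / (1 - \<rho>)"
    using F by (intro sum_geometric_le \<rho>) (force simp: nd_def)+
  finally show ?thesis by simp
qed

text \<open>Splitting \<open>K\<close> into two square roots, Cauchy-Schwarz produces one row sum,
  and exchanging the order of summation one column sum.\<close>

lemma schur_test:
  fixes K :: "'a \<Rightarrow> 'b \<Rightarrow> real"
  assumes K: "\<And>i j. i \<in> F \<Longrightarrow> j \<in> G \<Longrightarrow> 0 \<le> K i j" and S: "0 \<le> S"
    and row: "\<And>i. i \<in> F \<Longrightarrow> (\<Sum>j\<in>G. K i j) \<le> S"
    and col: "\<And>j. j \<in> G \<Longrightarrow> (\<Sum>i\<in>F. K i j) \<le> S"
  shows "(\<Sum>i\<in>F. (\<Sum>j\<in>G. K i j * x j)\<^sup>2) \<le> S\<^sup>2 * (\<Sum>j\<in>G. (x j)\<^sup>2)"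
proof -
  have "(\<Sum>i\<in>F. (\<Sum>j\<in>G. K i j * x j)\<^sup>2) \<le> (\<Sum>i\<in>F. S * (\<Sum>j\<in>G. K i j * (x j)\<^sup>2))"
  proof (rule sum_mono)
    fix i assume i: "i \<in> F"
    have "(\<Sum>j\<in>G. K i j * x j)\<^sup>2 = (\<Sum>j\<in>G. sqrt (K i j) * (sqrt (K i j) * x j))\<^sup>2"
      using K i by (intro arg_cong[where f = "\<lambda>t. t\<^sup>2"] sum.cong) (auto simp: mult.assoc[symmetric])
    also have "\<dots> \<le> (\<Sum>j\<in>G. (sqrt (K i j))\<^sup>2) * (\<Sum>j\<in>G. (sqrt (K i j) * x j)\<^sup>2)"
      by (rule Cauchy_Schwarz_ineq_sum)
    also have "\<dots> = (\<Sum>j\<in>G. K i j) * (\<Sum>j\<in>G. K i j * (x j)\<^sup>2)"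
      using K i by (simp add: power_mult_distrib)
    also have "\<dots> \<le> S * (\<Sum>j\<in>G. K i j * (x j)\<^sup>2)"
      using K i row by (intro mult_right_mono sum_nonneg) auto
    finally show "(\<Sum>j\<in>G. K i j * x j)\<^sup>2 \<le> S * (\<Sum>j\<in>G. K i j * (x j)\<^sup>2)" .
  qed
  also have "\<dots> = S * (\<Sum>j\<in>G. (\<Sum>i\<in>F. K i j) * (x j)\<^sup>2)"
    by (simp add: sum_distrib_left sum_distrib_right, subst sum.swap) simp
  also have "\<dots> \<le> S * (\<Sum>j\<in>G. S * (x j)\<^sup>2)"
    using S col by (intro mult_left_mono sum_mono mult_right_mono) auto
  finally show ?thesis by (simp add: sum_distrib_left power2_eq_square mult.assoc)
qed

lemma schur_test_nd:
  fixes \<rho> :: real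
  assumes \<rho>: "0 \<le> \<rho>" "\<rho> < 1" and F: "finite F" "finite G"
  shows "(\<Sum>i\<in>F. (\<Sum>j\<in>G. \<rho> ^ nd i j * x j)\<^sup>2) \<le> (2 / (1 - \<rho>))\<^sup>2 * (\<Sum>j\<in>G. (x j)\<^sup>2)"
proof (rule schur_test)
  show "(\<Sum>j\<in>G. \<rho> ^ nd i j) \<le> 2 / (1 - \<rho>)" for i
    using sum_nd_le[OF \<rho> F(2), of 0 i] by (simp add: nd_commute)
  show "(\<Sum>i\<in>F. \<rho> ^ nd i j) \<le> 2 / (1 - \<rho>)" for j
    using sum_nd_le[OF \<rho> F(1), of 0 j] by simp
qed (use \<rho> in auto)

text \<open>\<open>w n\<close> is to be the squared norm of the monomial of degree \<open>n\<close>.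
  The base \<open>2 * \<theta>\<close> in \<open>w_decay\<close> is measured against 2: squared
  block norms contain \<open>2 ^ (l - j)\<close> in the denominator, so \<open>\<theta> < 1\<close>
  is the gain that makes them summable.\<close>

locale dyadic_weight =
  fixes w :: "nat \<Rightarrow> real" and A B \<theta> :: real
  assumes w_pos: "0 < w n"
    and w_antimono: "m \<le> n \<Longrightarrow> w n \<le> w m"
    and w_doubling: "w (2 ^ j - 1) \<le> A * w (2 ^ Suc j - 1)"
    and w_decay: "j \<le> l \<Longrightarrow> w (2 ^ j - 1) \<le> B * (2 * \<theta>) ^ (l - j) * w (2 ^ l - 1)"
    and \<theta>: "0 < \<theta>" "\<theta> < 1"
begin

definition v :: "nat \<Rightarrow> real" where
  "v j = w (2 ^ j - 1)"

text \<open>The root appears because \<open>kernel_le\<close> estimates squares of block norms;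
  \<open>1 / 2\<close> is the ratio that monotonicity provides on the other side of the
  diagonal.\<close>

definition \<rho> :: real where
  "\<rho> = sqrt (max \<theta> (1 / 2))"

definition B1 :: real where "B1 = max B 1"

lemma v_pos: "0 < v j"
  by (simp add: v_def w_pos)

lemma rho: "0 < \<rho>" "\<rho> < 1"
  using \<theta> by (auto simp: \<rho>_def)

lemma A_ge_1: "1 \<le> A"
proof -
  have "v (Suc 0) \<le> v 0" unfolding v_def by (rule w_antimono) simp
  also have "v 0 \<le> A * v (Suc 0)" unfolding v_def by (rule w_doubling)
  finally show ?thesis using v_pos[of "Suc 0"] by simp
qed

lemma w_blk_le: "n \<in> blk j \<Longrightarrow> w n \<le> v j"
  by (auto simp: v_def blk_def intro: w_antimono)

lemma w_blk_ge: "n \<in> blk j \<Longrightarrow> v j / A \<le> w n"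
proof -
  assume "n \<in> blk j"
  then have "w (2 ^ Suc j - 1) \<le> w n" by (auto simp: blk_def intro: w_antimono)
  moreover have "v j \<le> A * w (2 ^ Suc j - 1)" unfolding v_def by (rule w_doubling)
  ultimately show ?thesis using A_ge_1 by (simp add: divide_le_eq mult.commute)
      (meson mult_left_mono order_trans zero_le_one)
qed

text \<open>Off the diagonal the blocks decay by monotonicity of \<open>w\<close> on one side, and by the Muckenhoupt
  condition, in the form of \<open>w_decay\<close>, on the other.\<close>

lemma kernel_le: "2 ^ (j + l) * v j \<le> B1 * (\<rho>\<^sup>2) ^ nd j l * (4 ^ max j l * v l)"
proof (cases "j \<le> l")
  case True
  have "v j \<le> B * (2 * \<theta>) ^ (l - j) * v l" unfolding v_def by (rule w_decay[OF True])
  then have "2 ^ (j + l) * v j \<le> 2 ^ (j + l) * (B * (2 * \<theta>) ^ (l - j) * v l)" by simp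
  also have "\<dots> = B * \<theta> ^ (l - j) * ((2 ^ (j + l) * 2 ^ (l - j)) * v l)"
    by (simp add: power_mult_distrib)
  also have "(2::real) ^ (j + l) * 2 ^ (l - j) = 4 ^ l"
    using True two_power_mult_self[of l] by (simp add: power_add[symmetric])
  also have "B * \<theta> ^ (l - j) * (4 ^ l * v l) \<le> B1 * (\<rho>\<^sup>2) ^ (l - j) * (4 ^ l * v l)"
    using \<theta> v_pos[of l] by (intro mult_right_mono mult_mono power_mono) (auto simp: \<rho>_def B1_def)
  finally show ?thesis using True by (simp add: nd_def max_def)
next
  case False
  have "v j \<le> v l" unfolding v_def using False by (intro w_antimono diff_le_mono power_increasing) auto
  then have "2 ^ (j + l) * v j \<le> 2 ^ (j + l) * v l" by simp
  also have "2 ^ (j + l) * v l = (1 / 2) ^ (j - l) * 4 ^ j * v l"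
  proof -
    have "(4::real) ^ j = 2 ^ (j - l) * 2 ^ (j + l)"
      using False two_power_mult_self[of j] by (simp add: power_add[symmetric])
    then show ?thesis by (simp add: power_divide)
  qed
  also have "(1 / 2) ^ (j - l) * 4 ^ j * v l \<le> (B1 * (\<rho>\<^sup>2) ^ (j - l)) * 4 ^ j * v l"
  proof -
    have "1 * (1 / 2) ^ (j - l) \<le> B1 * (\<rho>\<^sup>2) ^ (j - l)"
      using \<theta> by (intro mult_mono power_mono) (auto simp: \<rho>_def B1_def)
    then show ?thesis using v_pos[of l] by (intro mult_right_mono) auto
  qed
  finally have "2 ^ (j + l) * v j \<le> B1 * (\<rho>\<^sup>2) ^ (j - l) * 4 ^ j * v l" .
  moreover have "nd j l = j - l" "max j l = j" using False by (auto simp: nd_def)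
  ultimately show ?thesis by (simp only: mult.assoc)
qed

text \<open>The square of a norm bound: \<open>A * B1\<close> is the cost of one block, the
  remaining factor that of the Schur test over all blocks.\<close>

definition CH :: real where
  "CH = A * B1 * (2 / (1 - \<rho>))\<^sup>2"

lemma CH_pos: "0 < CH"
  using A_ge_1 rho by (auto simp: CH_def B1_def intro!: mult_pos_pos)

text \<open>On block \<open>l\<close> the denominator is at least \<open>2 ^ max j l\<close>, and
  the weight is \<open>v l\<close> up to the factor \<open>A\<close>. Cauchy-Schwarz over the
  \<open>2 ^ l\<close> indices then leaves the quantity of \<open>kernel_le\<close>.\<close>

lemma blk_hilbert_le:
  assumes x: "\<And>k. 0 \<le> x k"
  shows "sqrt (2 ^ j * v j) * (\<Sum>k\<in>blk l. x k / (2 ^ j + real k))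
    \<le> sqrt (A * B1) * (\<rho> ^ nd j l * sqrt (\<Sum>k\<in>blk l. w k * (x k)\<^sup>2))"
proof -
  let ?M = "2 ^ max j l :: real"
  have "(\<Sum>k\<in>blk l. x k / (2 ^ j + real k)) \<le> (\<Sum>k\<in>blk l. x k / ?M)"
  proof (rule sum_mono)
    fix k assume "k \<in> blk l"
    then have "2 ^ l \<le> real (Suc k)" unfolding mem_blk of_nat_power of_nat_numeral
      by (metis of_nat_le_iff of_nat_numeral of_nat_power)
    moreover have "(1::real) \<le> 2 ^ j" by simp
    ultimately have "?M \<le> 2 ^ j + real k" unfolding max_def by (simp; linarith)
    then show "x k / (2 ^ j + real k) \<le> x k / ?M" using x by (intro divide_left_mono) (auto intro!: mult_pos_pos add_pos_nonneg)
  qed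
  also have "\<dots> = (\<Sum>k\<in>blk l. 1 * x k) / ?M" by (simp add: sum_divide_distrib)
  finally have 1: "(\<Sum>k\<in>blk l. x k / (2 ^ j + real k)) \<le> (\<Sum>k\<in>blk l. 1 * x k) / ?M" .
  have "(\<Sum>k\<in>blk l. 1 * x k)\<^sup>2 \<le> (\<Sum>k\<in>blk l. 1\<^sup>2) * (\<Sum>k\<in>blk l. (x k)\<^sup>2)"
    by (rule Cauchy_Schwarz_ineq_sum)
  also have "\<dots> = 2 ^ l * (\<Sum>k\<in>blk l. (x k)\<^sup>2)" by (simp add: card_blk)
  also have "\<dots> \<le> 2 ^ l * (\<Sum>k\<in>blk l. A / v l * (w k * (x k)\<^sup>2))"
  proof (intro mult_left_mono sum_mono)
    fix k assume "k \<in> blk l"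
    then have "1 \<le> A / v l * w k" using w_blk_ge[of k l] v_pos[of l] A_ge_1 by (simp add: field_simps)
    then show "(x k)\<^sup>2 \<le> A / v l * (w k * (x k)\<^sup>2)"
      using mult_right_mono[of 1 "A / v l * w k" "(x k)\<^sup>2"] by (simp add: mult.assoc)
  qed auto
  also have "\<dots> = 2 ^ l * A / v l * (\<Sum>k\<in>blk l. w k * (x k)\<^sup>2)"
    unfolding sum_distrib_left[symmetric] by simp
  finally have 2: "(\<Sum>k\<in>blk l. 1 * x k)\<^sup>2 \<le> 2 ^ l * A / v l * (\<Sum>k\<in>blk l. w k * (x k)\<^sup>2)" .
  have S: "0 \<le> (\<Sum>k\<in>blk l. w k * (x k)\<^sup>2)" using w_pos by (intro sum_nonneg mult_nonneg_nonneg) (auto intro: less_imp_le)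
  have "(sqrt (2 ^ j * v j) * (\<Sum>k\<in>blk l. x k / (2 ^ j + real k)))\<^sup>2
     \<le> (2 ^ j * v j) * ((\<Sum>k\<in>blk l. 1 * x k) / ?M)\<^sup>2"
    unfolding power_mult_distrib using v_pos[of j] 1 x
    by (simp, intro mult_left_mono power_mono 1[simplified] sum_nonneg) auto
  also have "\<dots> = (2 ^ j * v j) * ((\<Sum>k\<in>blk l. 1 * x k)\<^sup>2 / 4 ^ max j l)"
    using two_power_mult_self[of "max j l"] by (simp add: power_divide power2_eq_square)
  also have "\<dots> \<le> (2 ^ j * v j) * (2 ^ l * A / v l * (\<Sum>k\<in>blk l. w k * (x k)\<^sup>2) / 4 ^ max j l)"
    using v_pos[of j] 2 by (intro mult_left_mono divide_right_mono) auto
  also have "\<dots> = (2 ^ (j + l) * v j) * (A / (4 ^ max j l * v l) * (\<Sum>k\<in>blk l. w k * (x k)\<^sup>2))"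
    by (simp add: power_add mult_ac)
  also have "\<dots> \<le> (B1 * (\<rho>\<^sup>2) ^ nd j l * (4 ^ max j l * v l)) * (A / (4 ^ max j l * v l) * (\<Sum>k\<in>blk l. w k * (x k)\<^sup>2))"
    using A_ge_1 v_pos[of l] S by (intro mult_right_mono kernel_le mult_nonneg_nonneg divide_nonneg_nonneg) auto
  also have "\<dots> = (A * B1) * ((\<rho>\<^sup>2) ^ nd j l * (\<Sum>k\<in>blk l. w k * (x k)\<^sup>2))"
    using v_pos[of l] by simp
  also have "\<dots> = (sqrt (A * B1) * (\<rho> ^ nd j l * sqrt (\<Sum>k\<in>blk l. w k * (x k)\<^sup>2)))\<^sup>2"
  proof -
    have "(\<rho> ^ nd j l)\<^sup>2 = (\<rho>\<^sup>2) ^ nd j l" by (simp only: power_mult[symmetric] mult.commute)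
    moreover have "0 \<le> A * B1" using A_ge_1 by (simp add: B1_def)
    ultimately show ?thesis using S by (simp only: power_mult_distrib real_sqrt_pow2)
  qed
  finally show ?thesis
    by (rule power2_le_imp_le) (use A_ge_1 S rho in \<open>auto simp: B1_def\<close>)
qed

text \<open>The row index enters only through its block, \<open>2 ^ j + k\<close> being a lower
  bound for \<open>n + k + 1\<close> there. Hence the coefficients \<open>b n\<close> can later be
  summed over a block separately from the kernel.\<close>

lemma hilbert_finite:
  assumes x: "\<And>k. 0 \<le> x k"
  shows "(\<Sum>j<J. 2 ^ j * v j * (\<Sum>k<K. x k / (2 ^ j + real k))\<^sup>2) \<le> CH * (\<Sum>k<K. w k * (x k)\<^sup>2)"
proof -
  \<comment> \<open>Padding with zeros makes the range of summation a union of whole blocks.\<close>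
  define x' where "x' k = (if k < K then x k else 0)" for k
  have x': "0 \<le> x' k" for k using x by (simp add: x'_def)
  obtain L where L: "K \<le> 2 ^ L - 1"
    by (metis Suc_pred' less_exp less_Suc_eq_le zero_less_numeral zero_less_power)
  have e1: "(\<Sum>k<K. x k / (2 ^ j + real k)) = (\<Sum>l<L. \<Sum>k\<in>blk l. x' k / (2 ^ j + real k))" for j
    unfolding sum_blk[symmetric] using L
    by (intro sum.mono_neutral_cong_left) (auto simp: x'_def)
  have e2: "(\<Sum>k<K. w k * (x k)\<^sup>2) = (\<Sum>l<L. \<Sum>k\<in>blk l. w k * (x' k)\<^sup>2)"
    unfolding sum_blk[symmetric] using L
    by (intro sum.mono_neutral_cong_left) (auto simp: x'_def)
  have S: "0 \<le> (\<Sum>k\<in>blk l. w k * (x' k)\<^sup>2)" for l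
    using w_pos by (intro sum_nonneg mult_nonneg_nonneg) (auto intro: less_imp_le)
  have "(\<Sum>j<J. 2 ^ j * v j * (\<Sum>k<K. x k / (2 ^ j + real k))\<^sup>2)
     = (\<Sum>j<J. (\<Sum>l<L. sqrt (2 ^ j * v j) * (\<Sum>k\<in>blk l. x' k / (2 ^ j + real k)))\<^sup>2)"
    unfolding e1 sum_distrib_left[symmetric] power_mult_distrib
    using v_pos by (simp add: less_imp_le)
  also have "\<dots> \<le> (\<Sum>j<J. (\<Sum>l<L. sqrt (A * B1) * (\<rho> ^ nd j l * sqrt (\<Sum>k\<in>blk l. w k * (x' k)\<^sup>2)))\<^sup>2)"
    using v_pos x' by (intro sum_mono power_mono blk_hilbert_le sum_nonneg mult_nonneg_nonneg) (auto simp: less_imp_le)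
  also have "\<dots> = A * B1 * (\<Sum>j<J. (\<Sum>l<L. \<rho> ^ nd j l * sqrt (\<Sum>k\<in>blk l. w k * (x' k)\<^sup>2))\<^sup>2)"
    using A_ge_1 by (simp add: sum_distrib_left[symmetric] power_mult_distrib B1_def)
  also have "\<dots> \<le> A * B1 * ((2 / (1 - \<rho>))\<^sup>2 * (\<Sum>l<L. (sqrt (\<Sum>k\<in>blk l. w k * (x' k)\<^sup>2))\<^sup>2))"
    using A_ge_1 rho by (intro mult_left_mono schur_test_nd) (auto simp: B1_def)
  also have "\<dots> = CH * (\<Sum>k<K. w k * (x k)\<^sup>2)"
    using S by (simp add: e2 CH_def)
  finally show ?thesis .
qed

text \<open>A single row \<open>j\<close> of the finite inequality already bounds all partial
  sums.\<close>

lemma hilbert_summable: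
  assumes x: "\<And>k. 0 \<le> x k" and s: "summable (\<lambda>k. w k * (x k)\<^sup>2)"
  shows "summable (\<lambda>k. x k / (2 ^ j + real k))"
proof (rule bounded_imp_summable)
  show "0 \<le> x k / (2 ^ j + real k)" for k using x by simp
  let ?S = "\<Sum>k. w k * (x k)\<^sup>2"
  show "(\<Sum>k\<le>n. x k / (2 ^ j + real k)) \<le> sqrt (CH * ?S / v j)" for n
  proof (rule real_le_rsqrt)
    have "v j * (\<Sum>k\<le>n. x k / (2 ^ j + real k))\<^sup>2 \<le> 2 ^ j * v j * (\<Sum>k<Suc n. x k / (2 ^ j + real k))\<^sup>2"
      using v_pos[of j] mult_right_mono[of 1 "2 ^ j" "v j * (\<Sum>k\<le>n. x k / (2 ^ j + real k))\<^sup>2"]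
      by (simp add: lessThan_Suc_atMost mult.assoc)
    also have "\<dots> \<le> (\<Sum>j<Suc j. 2 ^ j * v j * (\<Sum>k<Suc n. x k / (2 ^ j + real k))\<^sup>2)"
      using v_pos by (intro member_le_sum) (auto simp: less_imp_le)
    also have "\<dots> \<le> CH * (\<Sum>k<Suc n. w k * (x k)\<^sup>2)"
      by (rule hilbert_finite[OF x])
    also have "\<dots> \<le> CH * ?S"
      using CH_pos w_pos s by (intro mult_left_mono sum_le_suminf) (auto simp: less_imp_le)
    finally show "(\<Sum>k\<le>n. x k / (2 ^ j + real k))\<^sup>2 \<le> CH * ?S / v j"
      using v_pos[of j] by (simp add: field_simps)
  qed
qed

lemma hilbert_le:
  assumes x: "\<And>k. 0 \<le> x k" and s: "summable (\<lambda>k. w k * (x k)\<^sup>2)"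
  shows "(\<Sum>j<J. 2 ^ j * v j * (\<Sum>k. x k / (2 ^ j + real k))\<^sup>2) \<le> CH * (\<Sum>k. w k * (x k)\<^sup>2)"
proof (rule LIMSEQ_le_const2)
  show "(\<lambda>K. (\<Sum>j<J. 2 ^ j * v j * (\<Sum>k<K. x k / (2 ^ j + real k))\<^sup>2))
     \<longlonglongrightarrow> (\<Sum>j<J. 2 ^ j * v j * (\<Sum>k. x k / (2 ^ j + real k))\<^sup>2)"
    by (intro tendsto_intros summable_LIMSEQ hilbert_summable x s)
  have "(\<Sum>j<J. 2 ^ j * v j * (\<Sum>k<K. x k / (2 ^ j + real k))\<^sup>2) \<le> CH * (\<Sum>k. w k * (x k)\<^sup>2)" for K
    by (rule order.trans[OF hilbert_finite[OF x]])
      (use CH_pos w_pos s in \<open>auto intro!: mult_left_mono sum_le_suminf simp: less_imp_le\<close>)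
  then show "\<exists>N. \<forall>n\<ge>N. (\<Sum>j<J. 2 ^ j * v j * (\<Sum>k<n. x k / (2 ^ j + real k))\<^sup>2) \<le> CH * (\<Sum>k. w k * (x k)\<^sup>2)"
    by blast
qed

text \<open>Starting from block 0, \<open>w_decay\<close> loses at most a factor 2 per block, hence
  a factor of order \<open>n\<close> altogether. This polynomial bound makes the sequences of the
  weighted space converge as power series in the disc.\<close>

lemma w_lower: "w 0 / (A * B1 * real (Suc n)) \<le> w n"
proof -
  let ?j = "blk_of n"
  have j: "n \<in> blk ?j" by (rule blk_of)
  have "w 0 \<le> B * (2 * \<theta>) ^ (?j - 0) * w (2 ^ ?j - 1)"
    using w_decay[of 0 ?j] by simp
  also have "\<dots> \<le> B1 * 2 ^ ?j * w (2 ^ ?j - 1)"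
    using \<theta> w_pos by (intro mult_right_mono mult_mono) (auto simp: B1_def less_imp_le power_mult_distrib intro!: power_le_one)
  also have "\<dots> \<le> B1 * real (Suc n) * (A * w n)"
  proof (intro mult_mono)
    show "2 ^ ?j \<le> real (Suc n)" using j unfolding mem_blk by (metis of_nat_le_iff of_nat_numeral of_nat_power)
    show "w (2 ^ ?j - 1) \<le> A * w n" using w_blk_ge[OF j] A_ge_1 by (simp add: v_def field_simps)
  qed (use w_pos in \<open>auto simp: B1_def less_imp_le\<close>)
  finally have "w 0 \<le> w n * (A * B1 * real (Suc n))" by (simp only: mult_ac)
  moreover have "0 < A * B1 * real (Suc n)"
    using A_ge_1 by (intro mult_pos_pos) (auto simp: B1_def)
  ultimately show ?thesis by (simp only: pos_divide_le_eq)
qed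

end

section \<open>Weighted sequence spaces and operators given by matrices\<close>

text \<open>The space \<open>A\<^sup>2\<close> is described by Taylor coefficients; \<open>pw\<close> extends by zero because the
  elements of \<^const>\<open>A2\<close> do.\<close>

definition pconv :: "(nat \<Rightarrow> complex) set" where
  "pconv = {a. \<forall>z. cmod z < 1 \<longrightarrow> summable (\<lambda>n. a n * z ^ n)}"

definition pw :: "(nat \<Rightarrow> complex) \<Rightarrow> complex \<Rightarrow> complex" where
  "pw a z = (if z \<in> ball 0 1 then \<Sum>n. a n * z ^ n else 0)"

lemma pconvD: "a \<in> pconv \<Longrightarrow> cmod z < 1 \<Longrightarrow> summable (\<lambda>n. a n * z ^ n)"
  by (simp add: pconv_def)

lemma pconv_norm:
  assumes "a \<in> pconv" "cmod z < 1"
  shows "summable (\<lambda>n. cmod (a n * z ^ n))"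
proof (rule powser_insidea)
  let ?x = "complex_of_real ((1 + cmod z) / 2)"
  have n: "cmod ?x = (1 + cmod z) / 2"
    by (simp only: norm_of_real) simp
  show "summable (\<lambda>n. a n * ?x ^ n)" using assms(2) n by (intro pconvD assms(1)) simp
  show "cmod z < cmod ?x" using assms(2) n by simp
qed

lemma pw_sums: "a \<in> pconv \<Longrightarrow> cmod z < 1 \<Longrightarrow> (\<lambda>n. a n * z ^ n) sums pw a z"
  by (simp add: pw_def pconvD summable_sums)

lemma pw_outside: "z \<notin> ball 0 1 \<Longrightarrow> pw a z = 0"
  by (simp add: pw_def)

lemma pw_eqI:
  assumes "\<And>z. cmod z < 1 \<Longrightarrow> (\<lambda>n. a n * z ^ n) sums f z" "\<And>z. z \<notin> ball 0 1 \<Longrightarrow> f z = 0"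
  shows "f = pw a"
  using assms by (intro ext) (auto simp: pw_def sums_iff)

lemma pw_holomorphic: "a \<in> pconv \<Longrightarrow> pw a holomorphic_on ball 0 1"
  by (rule power_series_holomorphic[where a = a]) (use pw_sums in auto)

lemma powser_coeff:
  assumes "\<And>z. cmod z < 1 \<Longrightarrow> (\<lambda>n. a n * z ^ n) sums f z"
  shows "a n = (deriv ^^ n) f 0 / fact n"
proof -
  have "eventually (\<lambda>z. cmod z < 1) (nhds (0::complex))"
    using eventually_nhds_in_open[of "ball 0 1" "0::complex"] by simp
  then have "eventually (\<lambda>z. (\<lambda>n. fps_nth (Abs_fps a) n * z ^ n) sums f z) (nhds 0)"
    by eventually_elim (simp add: assms)
  then have "f has_fps_expansion Abs_fps a" by (rule has_fps_expansionI)
  from fps_nth_fps_expansion[OF this, of n] show ?thesis by simp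
qed

lemma pw_inj:
  assumes "a \<in> pconv" "b \<in> pconv" "pw a = pw b"
  shows "a = b"
proof
  fix n
  have "a n = (deriv ^^ n) (pw a) 0 / fact n" by (rule powser_coeff) (rule pw_sums[OF assms(1)])
  also have "\<dots> = b n" unfolding assms(3) by (rule powser_coeff[symmetric]) (rule pw_sums[OF assms(2)])
  finally show "a n = b n" .
qed

lemma pconv_mult_bounded:
  assumes "b \<in> pconv" "\<And>n. cmod (h n) \<le> K"
  shows "(\<lambda>n. b n * h n) \<in> pconv"
  unfolding pconv_def
proof safe
  fix z :: complex assume z: "cmod z < 1"
  show "summable (\<lambda>n. b n * h n * z ^ n)"
  proof (rule summable_comparison_test')
    show "summable (\<lambda>n. K * cmod (b n * z ^ n))" by (intro summable_mult pconv_norm assms z)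
    show "norm (b n * h n * z ^ n) \<le> K * cmod (b n * z ^ n)" for n
      using mult_right_mono[OF assms(2)[of n], of "cmod (b n * z ^ n)"] by (simp add: norm_mult mult_ac)
  qed
qed

lemma pconv_add: "a \<in> pconv \<Longrightarrow> b \<in> pconv \<Longrightarrow> (\<lambda>n. a n + b n) \<in> pconv"
  by (auto simp: pconv_def ring_distribs intro: summable_add)

lemma pw_add: "a \<in> pconv \<Longrightarrow> b \<in> pconv \<Longrightarrow> pw (\<lambda>n. a n + b n) = (\<lambda>z. pw a z + pw b z)"
  by (rule pw_eqI[symmetric]) (auto simp: ring_distribs pw_outside intro!: sums_add pw_sums)

lemma pconv_scale: "a \<in> pconv \<Longrightarrow> (\<lambda>n. c * a n) \<in> pconv"
  by (auto simp: pconv_def mult.assoc intro: summable_mult)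

lemma pw_scale: "a \<in> pconv \<Longrightarrow> pw (\<lambda>n. c * a n) = (\<lambda>z. c * pw a z)"
  by (rule pw_eqI[symmetric]) (auto simp: mult.assoc pw_outside intro!: sums_mult pw_sums)

lemma pw_diff:
  assumes "a \<in> pconv" "b \<in> pconv"
  shows "pw (\<lambda>n. a n - b n) = (\<lambda>z. pw a z - pw b z)"
  using pw_add[OF assms(1) pconv_scale[OF assms(2), of "-1"]] pw_scale[OF assms(2), of "-1"] by simp

lemma pw_sum:
  assumes "finite P" "\<And>p. p \<in> P \<Longrightarrow> e p \<in> pconv"
  shows "(\<lambda>n. \<Sum>p\<in>P. e p n) \<in> pconv \<and> pw (\<lambda>n. \<Sum>p\<in>P. e p n) = (\<lambda>z. \<Sum>p\<in>P. pw (e p) z)"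
  using assms
proof (induction P rule: finite_induct)
  case empty
  have "(\<lambda>n. 0) \<in> pconv" by (simp add: pconv_def)
  moreover have "pw (\<lambda>n. 0) = (\<lambda>z. 0)" by (auto simp: pw_def)
  ultimately show ?case by simp
next
  case (insert p P)
  then show ?case by (simp add: pconv_add pw_add)
qed

lemma sq_cmod_add_le: "(cmod (x + y))\<^sup>2 \<le> 2 * (cmod x)\<^sup>2 + 2 * (cmod y)\<^sup>2"
proof -
  have "(cmod (x + y))\<^sup>2 \<le> (cmod x + cmod y)\<^sup>2" by (intro power_mono norm_triangle_ineq) auto
  also have "\<dots> \<le> 2 * (cmod x)\<^sup>2 + 2 * (cmod y)\<^sup>2"
    using sum_squares_bound[of "cmod x" "cmod y"] by (simp add: power2_sum)
  finally show ?thesis .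
qed

context dyadic_weight
begin

definition l2w :: "(nat \<Rightarrow> complex) set" where
  "l2w = {a. summable (\<lambda>n. w n * (cmod (a n))\<^sup>2)}"

definition nrm :: "(nat \<Rightarrow> complex) \<Rightarrow> real" where
  "nrm a = sqrt (\<Sum>n. w n * (cmod (a n))\<^sup>2)"

lemma term_nonneg: "0 \<le> w n * (cmod (a n))\<^sup>2"
  using w_pos by (simp add: less_imp_le)

lemma nrm_nonneg: "a \<in> l2w \<Longrightarrow> 0 \<le> nrm a"
  unfolding nrm_def l2w_def by (auto intro!: suminf_nonneg term_nonneg)

lemma nrm_sq: "a \<in> l2w \<Longrightarrow> (nrm a)\<^sup>2 = (\<Sum>n. w n * (cmod (a n))\<^sup>2)"
  unfolding nrm_def l2w_def by (auto intro!: real_sqrt_pow2 suminf_nonneg term_nonneg)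

text \<open>The ends of blocks are cofinal among all partial sums.\<close>

lemma l2w_boundI:
  assumes "\<And>J. (\<Sum>n<2 ^ J - 1. w n * (cmod (a n))\<^sup>2) \<le> K\<^sup>2" "0 \<le> K"
  shows "a \<in> l2w" "nrm a \<le> K"
proof -
  have b: "(\<Sum>n<N. w n * (cmod (a n))\<^sup>2) \<le> K\<^sup>2" for N
  proof -
    have "N \<le> 2 ^ N - 1" using less_exp[of N] by linarith
    then have "(\<Sum>n<N. w n * (cmod (a n))\<^sup>2) \<le> (\<Sum>n<2 ^ N - 1. w n * (cmod (a n))\<^sup>2)"
      by (intro sum_mono2 term_nonneg) auto
    with assms(1) show ?thesis by (rule order.trans[rotated])
  qed
  have s: "summable (\<lambda>n. w n * (cmod (a n))\<^sup>2)"
    by (rule bounded_imp_summable[of _ "K\<^sup>2"]) (use b[of "Suc _"] term_nonneg in \<open>auto simp: lessThan_Suc_atMost\<close>)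
  then show "a \<in> l2w" by (simp add: l2w_def)
  have "(\<Sum>n. w n * (cmod (a n))\<^sup>2) \<le> K\<^sup>2" by (rule suminf_le_const[OF s b])
  then show "nrm a \<le> K" using assms(2) unfolding nrm_def by (intro real_le_lsqrt) (auto intro!: suminf_nonneg s term_nonneg)
qed

lemma l2w_partial_le: "a \<in> l2w \<Longrightarrow> finite I \<Longrightarrow> (\<Sum>n\<in>I. w n * (cmod (a n))\<^sup>2) \<le> (nrm a)\<^sup>2"
  by (subst nrm_sq) (auto simp: l2w_def intro!: sum_le_suminf term_nonneg)

lemma l2w_scale: "a \<in> l2w \<Longrightarrow> (\<lambda>n. c * a n) \<in> l2w"
  using summable_mult[of "\<lambda>n. w n * (cmod (a n))\<^sup>2" "(cmod c)\<^sup>2"]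
  by (simp add: l2w_def norm_mult power_mult_distrib mult_ac)

lemma nrm_scale: "a \<in> l2w \<Longrightarrow> nrm (\<lambda>n. c * a n) = cmod c * nrm a"
  using suminf_mult[of "\<lambda>n. w n * (cmod (a n))\<^sup>2" "(cmod c)\<^sup>2"]
  by (simp add: l2w_def nrm_def norm_mult power_mult_distrib mult_ac real_sqrt_mult)

text \<open>The crude factor 2 stands in for Minkowski's inequality; it is used only for boundedness
  and for limits, where constants do not matter.\<close>

lemma l2w_add:
  assumes "a \<in> l2w" "b \<in> l2w"
  shows "(\<lambda>n. a n + b n) \<in> l2w" "nrm (\<lambda>n. a n + b n) \<le> 2 * (nrm a + nrm b)"
proof -
  have "(\<Sum>n<N. w n * (cmod (a n + b n))\<^sup>2) \<le> (2 * (nrm a + nrm b))\<^sup>2" for N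
  proof -
    have "(\<Sum>n<N. w n * (cmod (a n + b n))\<^sup>2) \<le> (\<Sum>n<N. w n * (2 * (cmod (a n))\<^sup>2 + 2 * (cmod (b n))\<^sup>2))"
      using w_pos by (intro sum_mono mult_left_mono sq_cmod_add_le) (auto simp: less_imp_le)
    also have "\<dots> = 2 * (\<Sum>n<N. w n * (cmod (a n))\<^sup>2) + 2 * (\<Sum>n<N. w n * (cmod (b n))\<^sup>2)"
      by (simp add: sum.distrib sum_distrib_left ring_distribs mult_ac)
    also have "\<dots> \<le> 2 * (nrm a)\<^sup>2 + 2 * (nrm b)\<^sup>2"
      using assms by (intro add_mono mult_left_mono l2w_partial_le) auto
    also have "\<dots> \<le> (2 * (nrm a + nrm b))\<^sup>2"
      using nrm_nonneg[OF assms(1)] nrm_nonneg[OF assms(2)] by (simp add: power2_eq_square algebra_simps)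
    finally show ?thesis .
  qed
  then show "(\<lambda>n. a n + b n) \<in> l2w" "nrm (\<lambda>n. a n + b n) \<le> 2 * (nrm a + nrm b)"
    using nrm_nonneg[OF assms(1)] nrm_nonneg[OF assms(2)] by (auto intro!: l2w_boundI)
qed

lemma l2w_diff:
  assumes "a \<in> l2w" "b \<in> l2w"
  shows "(\<lambda>n. a n - b n) \<in> l2w" "nrm (\<lambda>n. a n - b n) \<le> 2 * (nrm a + nrm b)"
  using l2w_add[OF assms(1) l2w_scale[OF assms(2), of "-1"]] nrm_scale[OF assms(2), of "-1"] by auto

text \<open>By \<open>w_lower\<close> the square of \<open>cmod (a n)\<close> is of order at most
  \<open>n + 1\<close>, so \<open>a n\<close> is a bounded multiple of the coefficient of the
  convergent series with terms \<open>(n + 1) * z ^ n\<close>.\<close>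

lemma l2w_pconv: "a \<in> l2w \<Longrightarrow> a \<in> pconv"
proof -
  assume a: "a \<in> l2w"
  define K where "K = (nrm a)\<^sup>2 * (A * B1 / w 0)"
  have K: "0 \<le> K" using A_ge_1 w_pos[of 0] by (auto simp: K_def B1_def)
  have g: "(\<lambda>n. of_nat (Suc n)) \<in> pconv"
    using geometric_deriv_sums by (auto simp: pconv_def summable_def)
  have "cmod (a n / of_nat (Suc n)) \<le> 1 + K" for n
  proof -
    have "w 0 / (A * B1 * real (Suc n)) * (cmod (a n))\<^sup>2 \<le> w n * (cmod (a n))\<^sup>2"
      by (intro mult_right_mono w_lower) auto
    also have "\<dots> \<le> (nrm a)\<^sup>2" using l2w_partial_le[OF a, of "{n}"] by simp
    finally have le: "w 0 / (A * B1 * real (Suc n)) * (cmod (a n))\<^sup>2 \<le> (nrm a)\<^sup>2" .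
    have "0 < A * B1 * real (Suc n)" using A_ge_1 by (intro mult_pos_pos) (auto simp: B1_def)
    with le have "w 0 * (cmod (a n))\<^sup>2 \<le> (nrm a)\<^sup>2 * (A * B1 * real (Suc n))"
      by (simp only: times_divide_eq_left pos_divide_le_eq)
    then have "(cmod (a n))\<^sup>2 \<le> K * real (Suc n)"
      using w_pos[of 0] by (simp add: K_def field_simps)
    also have "\<dots> \<le> (1 + K)\<^sup>2 * (real (Suc n))\<^sup>2"
    proof (intro mult_mono)
      show "K \<le> (1 + K)\<^sup>2" using K by (simp add: power2_sum)
      show "real (Suc n) \<le> (real (Suc n))\<^sup>2" by (simp add: power2_eq_square)
    qed auto
    finally have "(cmod (a n))\<^sup>2 \<le> ((1 + K) * real (Suc n))\<^sup>2"
      by (simp only: power_mult_distrib)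
    moreover have "0 \<le> (1 + K) * real (Suc n)" using K by (intro mult_nonneg_nonneg) auto
    ultimately have "cmod (a n) \<le> (1 + K) * real (Suc n)" by (rule power2_le_imp_le)
    moreover have "cmod (of_nat (Suc n)) = real (Suc n)" by (rule norm_of_nat)
    moreover have "0 < real (Suc n)" by simp
    ultimately show ?thesis by (simp only: norm_divide pos_divide_le_eq)
  qed
  then have "(\<lambda>n. of_nat (Suc n) * (a n / of_nat (Suc n))) \<in> pconv"
    by (rule pconv_mult_bounded[OF g])
  then show ?thesis by (simp del: of_nat_Suc)
qed

lemma l2w_finite_support:
  assumes "finite I" "\<And>n. n \<notin> I \<Longrightarrow> a n = 0"
  shows "a \<in> l2w" "(nrm a)\<^sup>2 = (\<Sum>n\<in>I. w n * (cmod (a n))\<^sup>2)"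
proof -
  have s: "(\<lambda>n. w n * (cmod (a n))\<^sup>2) sums (\<Sum>n\<in>I. w n * (cmod (a n))\<^sup>2)"
    using assms by (intro sums_finite) auto
  then show a: "a \<in> l2w" by (auto simp: l2w_def summable_def)
  show "(nrm a)\<^sup>2 = (\<Sum>n\<in>I. w n * (cmod (a n))\<^sup>2)"
    using nrm_sq[OF a] s by (simp add: sums_iff)
qed

end

text \<open>\<open>T\<close> is given only through the formal image of the coefficients, which is
  not assumed to lie in \<open>l2w\<close>; whether \<open>T\<close> maps \<open>V\<close> into
  itself is part of what has to be decided. The sequence \<open>b\<close> holds the coefficients of
  the derivative of the symbol.\<close>

locale hilbert_setting = dyadic_weight +
  fixes b :: "nat \<Rightarrow> complex" and V :: "(complex \<Rightarrow> complex) set"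
    and N :: "(complex \<Rightarrow> complex) \<Rightarrow> real" and T :: "(complex \<Rightarrow> complex) \<Rightarrow> complex \<Rightarrow> complex"
  assumes b: "b \<in> pconv"
    and V: "V = pw ` l2w"
    and N: "a \<in> l2w \<Longrightarrow> N (pw a) = nrm a"
    and T: "a \<in> l2w \<Longrightarrow> T (pw a) = pw (\<lambda>n. \<Sum>k. b n / of_nat (n + k + 1) * a k)"
begin

abbreviation \<beta> :: "nat \<Rightarrow> real" where
  "\<beta> \<equiv> dyad b"

lemma mat_entry:
  assumes M: "\<And>n k. cmod (M n k) \<le> \<mu> (blk_of n) * cmod (b n) / real (n + k + 1)"
    and mu: "\<And>j. 0 \<le> \<mu> j"
    and a: "a \<in> l2w"
  shows "summable (\<lambda>k. cmod (M n k * a k))"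
    and "cmod (\<Sum>k. M n k * a k) \<le> \<mu> (blk_of n) * cmod (b n) * (\<Sum>k. cmod (a k) / (2 ^ blk_of n + real k))"
proof -
  let ?j = "blk_of n"
  have h: "summable (\<lambda>k. cmod (a k) / (2 ^ ?j + real k))"
    using a by (intro hilbert_summable) (auto simp: l2w_def)
  have le: "cmod (M n k * a k) \<le> \<mu> ?j * cmod (b n) * (cmod (a k) / (2 ^ ?j + real k))" for k
  proof -
    have "2 ^ ?j \<le> real (Suc n)" using blk_of[of n] unfolding mem_blk by (metis of_nat_le_iff of_nat_numeral of_nat_power)
    then have "2 ^ ?j + real k \<le> real (n + k + 1)" by simp
    then have "\<mu> ?j * cmod (b n) / real (n + k + 1) \<le> \<mu> ?j * cmod (b n) / (2 ^ ?j + real k)"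
      using mu[of ?j] by (intro divide_left_mono) (auto intro!: add_pos_nonneg mult_pos_pos)
    with M[of n k] have "cmod (M n k) \<le> \<mu> ?j * cmod (b n) / (2 ^ ?j + real k)" by linarith
    then have "cmod (M n k) * cmod (a k) \<le> \<mu> ?j * cmod (b n) / (2 ^ ?j + real k) * cmod (a k)"
      by (rule mult_right_mono) simp
    then show ?thesis by (simp add: norm_mult)
  qed
  show s: "summable (\<lambda>k. cmod (M n k * a k))"
    by (rule summable_comparison_test'[OF summable_mult[OF h]]) (use le in auto)
  show "cmod (\<Sum>k. M n k * a k) \<le> \<mu> ?j * cmod (b n) * (\<Sum>k. cmod (a k) / (2 ^ ?j + real k))"
  proof -
    have "cmod (\<Sum>k. M n k * a k) \<le> (\<Sum>k. cmod (M n k * a k))" by (rule summable_norm[OF s])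
    also have "\<dots> \<le> (\<Sum>k. \<mu> ?j * cmod (b n) * (cmod (a k) / (2 ^ ?j + real k)))"
      by (intro suminf_le le s summable_mult h)
    also have "\<dots> = \<mu> ?j * cmod (b n) * (\<Sum>k. cmod (a k) / (2 ^ ?j + real k))" by (rule suminf_mult[OF h])
    finally show ?thesis .
  qed
qed

text \<open>The multiplier \<open>\<mu>\<close> lets one estimate serve the full matrix, its part of
  finite rank, the remainder of the expansion and the restriction to far blocks. Only the products
  \<open>\<mu> j * \<beta> j\<close> count, because the squares of \<open>b n\<close> over a block
  sum to \<open>2 ^ j\<close> times the square of \<open>\<beta> j\<close>.\<close>

lemma mat_bound:
  assumes M: "\<And>n k. cmod (M n k) \<le> \<mu> (blk_of n) * cmod (b n) / real (n + k + 1)"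
    and mu: "\<And>j. 0 \<le> \<mu> j" and lam: "\<And>j. \<mu> j * \<beta> j \<le> t"
    and a: "a \<in> l2w"
  shows "(\<lambda>n. \<Sum>k. M n k * a k) \<in> l2w"
    and "nrm (\<lambda>n. \<Sum>k. M n k * a k) \<le> sqrt CH * t * nrm a"
proof -
  have lam0: "0 \<le> t" using lam[of 0] mu[of 0] dyad_nonneg[of b 0] by (meson mult_nonneg_nonneg order_trans)
  let ?h = "\<lambda>j. \<Sum>k. cmod (a k) / (2 ^ j + real k)"
  have sa: "summable (\<lambda>n. w n * (cmod (a n))\<^sup>2)" using a by (simp add: l2w_def)
  have "(\<Sum>n<2 ^ J - 1. w n * (cmod (\<Sum>k. M n k * a k))\<^sup>2) \<le> (sqrt CH * t * nrm a)\<^sup>2" for J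
  proof -
    have "(\<Sum>n<2 ^ J - 1. w n * (cmod (\<Sum>k. M n k * a k))\<^sup>2)
       = (\<Sum>j<J. \<Sum>n\<in>blk j. w n * (cmod (\<Sum>k. M n k * a k))\<^sup>2)" by (rule sum_blk)
    also have "\<dots> \<le> (\<Sum>j<J. t\<^sup>2 * (2 ^ j * v j * (?h j)\<^sup>2))"
    proof (rule sum_mono)
      fix j
      have "(\<Sum>n\<in>blk j. w n * (cmod (\<Sum>k. M n k * a k))\<^sup>2) \<le> (\<Sum>n\<in>blk j. v j * (\<mu> j * cmod (b n) * ?h j)\<^sup>2)"
      proof (intro sum_mono mult_mono power_mono)
        fix n assume n: "n \<in> blk j"
        show "w n \<le> v j" using n by (rule w_blk_le)
        show "cmod (\<Sum>k. M n k * a k) \<le> \<mu> j * cmod (b n) * ?h j"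
          using mat_entry(2)[OF M mu a, of n] by (simp add: blk_of_eq[OF n])
      qed (use v_pos less_imp_le in auto)
      also have "\<dots> = v j * (\<mu> j * ?h j)\<^sup>2 * (\<Sum>n\<in>blk j. (cmod (b n))\<^sup>2)"
        unfolding sum_distrib_left by (rule sum.cong) (auto simp: power_mult_distrib)
      also have "\<dots> = (\<mu> j * \<beta> j)\<^sup>2 * (2 ^ j * v j * (?h j)\<^sup>2)"
        unfolding dyad_sq[symmetric] by (simp add: power_mult_distrib mult_ac)
      also have "\<dots> \<le> t\<^sup>2 * (2 ^ j * v j * (?h j)\<^sup>2)"
        using mu lam dyad_nonneg v_pos[of j] by (intro mult_right_mono power_mono) auto
      finally show "(\<Sum>n\<in>blk j. w n * (cmod (\<Sum>k. M n k * a k))\<^sup>2) \<le> t\<^sup>2 * (2 ^ j * v j * (?h j)\<^sup>2)" .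
    qed
    also have "\<dots> = t\<^sup>2 * (\<Sum>j<J. 2 ^ j * v j * (?h j)\<^sup>2)" by (simp add: sum_distrib_left)
    also have "\<dots> \<le> t\<^sup>2 * (CH * (\<Sum>k. w k * (cmod (a k))\<^sup>2))"
      by (intro mult_left_mono hilbert_le sa) auto
    also have "\<dots> = (sqrt CH * t * nrm a)\<^sup>2"
      using CH_pos nrm_sq[OF a] by (simp add: power_mult_distrib)
    finally show ?thesis .
  qed
  moreover have "0 \<le> sqrt CH * t * nrm a" using lam0 CH_pos nrm_nonneg[OF a] by simp
  ultimately show "(\<lambda>n. \<Sum>k. M n k * a k) \<in> l2w" "nrm (\<lambda>n. \<Sum>k. M n k * a k) \<le> sqrt CH * t * nrm a"
    by (rule l2w_boundI)+
qed

definition cf :: "(complex \<Rightarrow> complex) \<Rightarrow> nat \<Rightarrow> complex" where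
  "cf f = inv_into l2w pw f"

lemma inj_pw: "inj_on pw l2w"
  by (intro inj_onI pw_inj) (auto intro: l2w_pconv)

lemma cf_pw: "a \<in> l2w \<Longrightarrow> cf (pw a) = a"
  by (simp add: cf_def inj_pw inv_into_f_f)

lemma VE: "f \<in> V \<Longrightarrow> (\<And>a. a \<in> l2w \<Longrightarrow> f = pw a \<Longrightarrow> thesis) \<Longrightarrow> thesis"
  using V by auto

lemma pw_V: "a \<in> l2w \<Longrightarrow> pw a \<in> V"
  using V by auto

lemma N_nonneg: "f \<in> V \<Longrightarrow> 0 \<le> N f"
  by (auto elim!: VE simp: N nrm_nonneg)

lemma V_diff:
  assumes "f \<in> V" "h \<in> V"
  shows "(\<lambda>x. f x - h x) \<in> V" "N (\<lambda>x. f x - h x) \<le> 2 * (N f + N h)"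
proof -
  obtain a c where "a \<in> l2w" "f = pw a" "c \<in> l2w" "h = pw c" using assms by (auto elim!: VE)
  then show "(\<lambda>x. f x - h x) \<in> V" "N (\<lambda>x. f x - h x) \<le> 2 * (N f + N h)"
    using l2w_diff[of a c] pw_diff[of a c] by (auto simp: l2w_pconv pw_V N dest: sym)
qed

lemma V_add: "f \<in> V \<Longrightarrow> h \<in> V \<Longrightarrow> (\<lambda>x. f x + h x) \<in> V"
  by (auto elim!: VE simp: pw_add[symmetric] l2w_pconv l2w_add pw_V)

lemma V_scale: "f \<in> V \<Longrightarrow> (\<lambda>x. c * f x) \<in> V"
  by (auto elim!: VE simp: pw_scale[symmetric] l2w_pconv l2w_scale pw_V)

text \<open>An approximating operator has to be a map on functions, so the matrix acts through
  \<open>cf\<close>, the inverse of \<open>pw\<close> on \<open>l2w\<close>.\<close>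

definition mop :: "(nat \<Rightarrow> nat \<Rightarrow> complex) \<Rightarrow> (complex \<Rightarrow> complex) \<Rightarrow> complex \<Rightarrow> complex" where
  "mop M f = pw (\<lambda>n. \<Sum>k. M n k * cf f k)"

lemma bounded_opsI:
  assumes M: "\<And>n k. cmod (M n k) \<le> \<mu> (blk_of n) * cmod (b n) / real (n + k + 1)"
    and mu: "\<And>j. 0 \<le> \<mu> j" and lam: "\<And>j. \<mu> j * \<beta> j \<le> t"
    and S: "\<And>a. a \<in> l2w \<Longrightarrow> S (pw a) = pw (\<lambda>n. \<Sum>k. M n k * a k)"
  shows "S \<in> bounded_ops V N"
  unfolding bounded_ops_def
proof (intro CollectI conjI ballI allI)
  note mb = mat_bound[OF M mu lam]
  have sm: "summable (\<lambda>k. M n k * a k)" if "a \<in> l2w" for n a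
    using mat_entry(1)[OF M mu that] by (rule summable_norm_cancel)
  show "S ` V \<subseteq> V" by (auto elim!: VE simp: S intro!: pw_V mb)
  show "\<exists>C. \<forall>f\<in>V. N (S f) \<le> C * N f"
    by (rule exI[of _ "sqrt CH * t"]) (auto elim!: VE simp: S N mb)
  fix f assume f: "f \<in> V"
  then obtain a where a: "a \<in> l2w" "f = pw a" by (rule VE)
  { fix h assume "h \<in> V"
    then obtain c where c: "c \<in> l2w" "h = pw c" by (rule VE)
    have "S (\<lambda>x. f x + h x) = S (pw (\<lambda>n. a n + c n))" using a c by (simp add: pw_add l2w_pconv)
    also have "\<dots> = pw (\<lambda>n. \<Sum>k. M n k * (a k + c k))" using a c by (simp add: S l2w_add)
    also have "\<dots> = pw (\<lambda>n. (\<Sum>k. M n k * a k) + (\<Sum>k. M n k * c k))"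
      using a c sm by (simp add: ring_distribs suminf_add)
    also have "\<dots> = (\<lambda>x. S f x + S h x)"
      using a c mb by (simp add: pw_add l2w_pconv S)
    finally show "S (\<lambda>x. f x + h x) = (\<lambda>x. S f x + S h x)" . }
  { fix c
    have "S (\<lambda>x. c * f x) = S (pw (\<lambda>n. c * a n))" using a by (simp add: pw_scale l2w_pconv)
    also have "\<dots> = pw (\<lambda>n. \<Sum>k. c * (M n k * a k))" using a by (simp add: S l2w_scale mult_ac)
    also have "\<dots> = pw (\<lambda>n. c * (\<Sum>k. M n k * a k))"
      using a sm by (simp add: suminf_mult)
    also have "\<dots> = (\<lambda>x. c * S f x)"
      using a mb by (simp add: pw_scale l2w_pconv S)
    finally show "S (\<lambda>x. c * f x) = (\<lambda>x. c * S f x)" . }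
qed

section \<open>Operator norm and singular numbers as approximation numbers\<close>

lemma zero_in_V: "(\<lambda>x. 0) \<in> V" and N_zero: "N (\<lambda>x. 0) = 0"
proof -
  have "(\<lambda>n. 0) \<in> l2w" "nrm (\<lambda>n. 0) = 0" by (auto simp: l2w_def nrm_def)
  moreover have "pw (\<lambda>n. 0) = (\<lambda>x. 0)" by (auto simp: pw_def)
  ultimately show "(\<lambda>x. 0) \<in> V" "N (\<lambda>x. 0) = 0" using pw_V[of "\<lambda>n. 0"] N[of "\<lambda>n. 0"] by simp_all
qed

lemma bounded_ops_zero:
  assumes "S \<in> bounded_ops V N"
  shows "S (\<lambda>x. 0) = (\<lambda>x. 0)"
proof -
  have "\<forall>f\<in>V. \<forall>c. S (\<lambda>x. c * f x) = (\<lambda>x. c * S f x)" using assms by (simp add: bounded_ops_def)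
  from this[rule_format, OF zero_in_V, of 0] show ?thesis by simp
qed

text \<open>The real supremum in \<open>op_norm\<close> can be compared with its members only if
  they are bounded.\<close>

lemma op_norm_bdd:
  assumes "S \<in> bounded_ops V N" "R \<in> bounded_ops V N"
  shows "bdd_above ((\<lambda>f. N (\<lambda>x. S f x - R f x) / N f) ` V)"
proof -
  obtain C where C: "\<And>f. f \<in> V \<Longrightarrow> N (S f) \<le> C * N f" using assms(1) unfolding bounded_ops_def by blast
  obtain D where D: "\<And>f. f \<in> V \<Longrightarrow> N (R f) \<le> D * N f" using assms(2) unfolding bounded_ops_def by blast
  have "N (\<lambda>x. S f x - R f x) / N f \<le> 2 * (\<bar>C\<bar> + \<bar>D\<bar>)" if f: "f \<in> V" for f
  proof (cases "N f = 0")
    case False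
    have "N (\<lambda>x. S f x - R f x) \<le> 2 * (N (S f) + N (R f))"
      using assms f by (intro V_diff) (auto simp: bounded_ops_def)
    also have "\<dots> \<le> 2 * (C * N f + D * N f)" using C[OF f] D[OF f] by simp
    also have "\<dots> \<le> 2 * (\<bar>C\<bar> * N f + \<bar>D\<bar> * N f)"
      using N_nonneg[OF f] by (intro mult_left_mono add_mono mult_right_mono) auto
    finally show ?thesis using False N_nonneg[OF f] by (simp add: divide_le_eq algebra_simps)
  qed simp
  then show ?thesis by (auto intro!: bdd_aboveI2)
qed

lemma op_norm_nonneg:
  assumes "S \<in> bounded_ops V N" "R \<in> bounded_ops V N"
  shows "0 \<le> op_norm V N (\<lambda>f x. S f x - R f x)"
proof -
  \<comment> \<open>At the zero function the quotient is 0 / 0 = 0, so the supremum cannot be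
    negative.\<close>
  have "N (\<lambda>x. S (\<lambda>x. 0) x - R (\<lambda>x. 0) x) / N (\<lambda>x. 0) \<le> op_norm V N (\<lambda>f x. S f x - R f x)"
    unfolding op_norm_def by (rule cSUP_upper[OF zero_in_V op_norm_bdd[OF assms]])
  then show ?thesis by (simp add: N_zero)
qed

text \<open>Keeps the index set of the infimum in \<open>singular_value\<close> nonempty for every
  \<open>n\<close>.\<close>

lemma zero_op: "(\<lambda>f x. 0) \<in> {R \<in> bounded_ops V N. rank_le V n R}"
proof -
  have "(\<lambda>f x. 0) \<in> bounded_ops V N"
    unfolding bounded_ops_def using zero_in_V N_zero by (auto intro!: exI[of _ 0])
  moreover have "rank_le V n (\<lambda>f x. 0)"
    unfolding rank_le_def by (rule exI[of _ "\<lambda>k x. 0"]) auto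
  ultimately show ?thesis by simp
qed

lemma singular_value_nonneg:
  assumes "S \<in> bounded_ops V N"
  shows "0 \<le> singular_value V N S n"
  unfolding singular_value_def
  by (rule cINF_greatest) (use zero_op[of n] op_norm_nonneg[OF assms] in auto)

lemma singular_value_le:
  assumes S: "S \<in> bounded_ops V N" and R: "R \<in> bounded_ops V N" "rank_le V n R"
    and K: "0 \<le> K" "\<And>f. f \<in> V \<Longrightarrow> N (\<lambda>x. S f x - R f x) \<le> K * N f"
  shows "singular_value V N S n \<le> K"
proof -
  have "singular_value V N S n \<le> op_norm V N (\<lambda>f x. S f x - R f x)"
    unfolding singular_value_def
    by (rule cINF_lower) (use R op_norm_nonneg[OF S] in \<open>auto intro!: bdd_belowI2[of _ 0]\<close>)
  also have "\<dots> \<le> K"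
    unfolding op_norm_def
  proof (rule cSUP_least)
    fix f assume f: "f \<in> V"
    show "N (\<lambda>x. S f x - R f x) / N f \<le> K"
      using K(2)[OF f] K(1) N_nonneg[OF f] by (cases "N f = 0") (auto simp: divide_le_eq)
  qed (use zero_in_V in auto)
  finally show ?thesis .
qed

lemma rank_leI:
  assumes P: "finite P" "card P \<le> n"
    and R: "\<And>f. f \<in> V \<Longrightarrow> \<exists>c. R f = (\<lambda>x. \<Sum>p\<in>P. c p * e p x)"
  shows "rank_le V n R"
  unfolding rank_le_def
proof -
  obtain h where h: "bij_betw h {..<card P} P" using ex_bij_betw_nat_finite[OF P(1)] by (auto simp: atLeast0LessThan)
  show "\<exists>e. \<forall>f\<in>V. \<exists>c. R f = (\<lambda>x. \<Sum>k<n. c k * e k x)"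
  proof (rule exI[of _ "\<lambda>k. e (h k)"], intro ballI)
    fix f assume "f \<in> V"
    then obtain c where c: "R f = (\<lambda>x. \<Sum>p\<in>P. c p * e p x)" using R by blast
    \<comment> \<open>\<open>rank_le\<close> works with exactly \<open>n\<close> spanning functions;
      the coefficients beyond \<open>card P\<close> are filled with 0.\<close>
    have "(\<Sum>p\<in>P. c p * e p x) = (\<Sum>k<n. (if k < card P then c (h k) else 0) * e (h k) x)" for x
    proof -
      have "(\<Sum>p\<in>P. c p * e p x) = (\<Sum>k<card P. c (h k) * e (h k) x)"
        by (rule sum.reindex_bij_betw[OF h, symmetric])
      also have "\<dots> = (\<Sum>k<n. (if k < card P then c (h k) else 0) * e (h k) x)"
        using P(2) by (intro sum.mono_neutral_cong_left) auto
      finally show ?thesis .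
    qed
    then have "R f = (\<lambda>x. \<Sum>k<n. (if k < card P then c (h k) else 0) * e (h k) x)"
      using c by simp
    then show "\<exists>c. R f = (\<lambda>x. \<Sum>k<n. c k * e (h k) x)"
      by (rule exI[of _ "\<lambda>k. if k < card P then c (h k) else 0"])
  qed
qed

end

section \<open>Upper bounds for singular numbers\<close>

text \<open>Greedy selection: earlier choices occupy at most \<open>n\<close> elements, so
  \<open>S n\<close> still offers a new one. This replaces sorting the double sequence in decreasing
  order.\<close>

lemma ex_injective_choice:
  fixes S :: "nat \<Rightarrow> 'a set"
  assumes "\<And>n::nat. \<exists>X. finite X \<and> n < card X \<and> X \<subseteq> S n"
  shows "\<exists>f. inj f \<and> (\<forall>n. f n \<in> S n)"
proof -
  have "\<exists>f. \<forall>n. f n \<in> S n - f ` {..<n}"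
  proof (rule dependent_wellorder_choice)
    fix n :: nat and f :: "nat \<Rightarrow> 'a"
    obtain X where X: "finite X" "n < card X" "X \<subseteq> S n" using assms by blast
    have "card (f ` {..<n}) \<le> n" using card_image_le[of "{..<n}" f] by simp
    then have "\<not> X \<subseteq> f ` {..<n}" using X card_mono[of "f ` {..<n}" X] by auto
    then show "\<exists>x. x \<in> S n - f ` {..<n}" using X by blast
  next
    fix r and f g :: "nat \<Rightarrow> 'a" and n
    assume "\<And>y. y < n \<Longrightarrow> f y = g y"
    then have "f ` {..<n} = g ` {..<n}" by (intro image_cong) auto
    then show "(r \<in> S n - f ` {..<n}) = (r \<in> S n - g ` {..<n})" by simp
  qed
  then obtain f where f: "\<And>n. f n \<in> S n - f ` {..<n}" by blast
  have "f m \<noteq> f n" if "m < n" for m n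
    using f[of n] that by (metis Diff_iff imageI lessThan_iff)
  then have "inj f" by (intro injI) (metis linorder_neqE_nat)
  with f show ?thesis by blast
qed

lemma finite_greater_of_summable_powr:
  fixes x :: "nat \<Rightarrow> real"
  assumes "0 < p" "\<And>n. 0 \<le> x n" "summable (\<lambda>n. x n powr p)" "0 < t"
  shows "finite {n. t < x n}"
proof -
  have "(\<lambda>n. x n powr p) \<longlonglongrightarrow> 0" by (rule summable_LIMSEQ_zero[OF assms(3)])
  then have "eventually (\<lambda>n. x n powr p < t powr p) sequentially"
    using assms(4) by (intro order_tendstoD(2)) auto
  then obtain n0 where n0: "\<And>n. n \<ge> n0 \<Longrightarrow> x n powr p < t powr p" by (auto simp: eventually_sequentially)
  have "n < n0" if "t < x n" for n
  proof (rule ccontr)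
    assume "\<not> n < n0"
    then have "x n powr p < t powr p" using n0 by simp
    moreover have "t powr p \<le> x n powr p" using that assms by (intro powr_mono2) auto
    ultimately show False by simp
  qed
  then have "{n. t < x n} \<subseteq> {..<n0}" by auto
  then show ?thesis by (rule finite_subset) simp
qed

lemma bounded_of_finite:
  fixes x :: "nat \<Rightarrow> real"
  assumes "finite {n. 1 < x n}"
  shows "\<exists>D. \<forall>n. x n \<le> D"
proof (rule exI[of _ "Max (insert 1 (x ` {n. 1 < x n}))"], rule allI)
  fix n
  show "x n \<le> Max (insert 1 (x ` {n. 1 < x n}))"
    using assms by (cases "1 < x n") (auto intro: Max_ge simp: Max_ge_iff)
qed

context hilbert_setting
begin

lemma T_bounded:
  assumes "\<And>j. \<beta> j \<le> t"
  shows "T \<in> bounded_ops V N"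
  by (rule bounded_opsI[where \<mu> = "\<lambda>_. 1" and t = t and M = "\<lambda>n k. b n / of_nat (n + k + 1)"])
    (use assms T in \<open>auto simp: norm_divide simp del: of_nat_Suc of_nat_add\<close>)

text \<open>The kernel \<open>1 / (n + k + 1)\<close> is expanded in powers of the distance of \<open>n + 1\<close> to the centre
  of its block; \<open>tay\<close> is the ratio of the resulting geometric series.\<close>

definition ctr :: "nat \<Rightarrow> real" where
  "ctr j = 3 / 2 * 2 ^ j"

definition tay :: "nat \<Rightarrow> nat \<Rightarrow> real" where
  "tay n k = (ctr (blk_of n) - real (Suc n)) / (ctr (blk_of n) + real k)"

lemma ctr_pos: "0 < ctr j"
  by (simp add: ctr_def)

text \<open>A point between \<open>2 ^ j\<close> and \<open>2 ^ Suc j\<close> is within half the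
  length of this interval from its midpoint, which is one third of \<open>ctr j\<close>. This is the
  origin of the ratio 3.\<close>

lemma tay_le: "\<bar>tay n k\<bar> \<le> 1 / 3"
proof -
  let ?j = "blk_of n"
  have "2 ^ ?j \<le> real (Suc n)" "real (Suc n) < 2 ^ Suc ?j"
    using blk_of[of n] unfolding mem_blk
    by (metis of_nat_le_iff of_nat_numeral of_nat_power, metis of_nat_less_iff of_nat_numeral of_nat_power)
  then have "\<bar>ctr ?j - real (Suc n)\<bar> \<le> 1 / 3 * ctr ?j" unfolding ctr_def power_Suc by linarith
  also have "\<dots> \<le> 1 / 3 * (ctr ?j + real k)" by simp
  finally show ?thesis using ctr_pos[of ?j] by (simp add: tay_def abs_div divide_le_eq)
qed

text \<open>\<open>n + k + 1\<close> is \<open>ctr (blk_of n) + k\<close> times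
  \<open>1 - tay n k\<close>, so the geometric series cut after \<open>r\<close> terms is exact up
  to the factor \<open>1 - tay n k ^ r\<close>. Each term is a function of \<open>n\<close> times a
  function of \<open>k\<close> within a block, so the block contributes rank at most
  \<open>r\<close>.\<close>

lemma tay_sum:
  "(1 - tay n k ^ r) / real (n + k + 1)
    = (\<Sum>i<r. (ctr (blk_of n) - real (Suc n)) ^ i / (ctr (blk_of n) + real k) ^ Suc i)"
proof -
  let ?c = "ctr (blk_of n)"
  have c: "0 < ?c + real k" using ctr_pos[of "blk_of n"] by simp
  have e: "real (n + k + 1) = (?c + real k) * (1 - tay n k)"
    using c by (simp add: tay_def field_simps)
  have "1 - tay n k \<noteq> 0" using tay_le[of n k] by auto
  then have "(1 - tay n k ^ r) / real (n + k + 1) = (\<Sum>i<r. tay n k ^ i) / (?c + real k)"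
    unfolding e one_diff_power_eq by simp
  also have "\<dots> = (\<Sum>i<r. (?c - real (Suc n)) ^ i / (?c + real k) ^ Suc i)"
    by (simp add: sum_divide_distrib tay_def power_divide mult.commute)
  finally show ?thesis .
qed

text \<open>Block \<open>j\<close> keeps \<open>r j\<close> terms of the expansion, so the
  approximant has rank at most the sum of the \<open>r j\<close>, while the remainder carries the
  multiplier \<open>(1 / 3) ^ r j\<close> there. In blocks outside \<open>J\<close> the approximant
  has zero rows.\<close>

lemma singular_value_upper:
  assumes D: "\<And>j. \<beta> j \<le> D" and J: "finite J" "\<And>j. j \<notin> J \<Longrightarrow> r j = 0" "(\<Sum>j\<in>J. r j) \<le> n"
    and t: "\<And>j. \<beta> j / 3 ^ r j \<le> t"
  shows "singular_value V N T n \<le> sqrt CH * t"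
proof -
  define H where "H = (\<lambda>n k. b n / complex_of_nat (n + k + 1))"
  define E where "E = (\<lambda>n k. H n k * of_real (tay n k ^ r (blk_of n)))"
  define M where "M = (\<lambda>n k. H n k * of_real (1 - tay n k ^ r (blk_of n)))"
  define P where "P = Sigma J (\<lambda>j. {..<r j})"
  \<comment> \<open>\<open>e (j, i)\<close> is the range vector of the rank-one term
    \<open>(j, i)\<close>, and the value of \<open>L\<close> at \<open>(j, i)\<close> is its
    functional.\<close>
  define e where "e = (\<lambda>(j, i) n. if n \<in> blk j then b n * of_real ((ctr j - real (Suc n)) ^ i) else 0)"
  define L where "L = (\<lambda>a (j, i). \<Sum>k. a k / complex_of_real ((ctr j + real k) ^ Suc i))"
  have P: "finite P" "card P \<le> n" using J by (auto simp: P_def)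
  have t0: "0 \<le> t" using t[of 0] dyad_nonneg[of b 0] by (meson divide_nonneg_nonneg order_trans zero_le_numeral zero_le_power)
  have Hn: "cmod (H n k) = 1 * cmod (b n) / real (n + k + 1)" for n k
    by (simp add: H_def norm_divide del: of_nat_Suc of_nat_add)
  have tp: "\<bar>tay n k ^ m\<bar> \<le> (1 / 3) ^ m" for n k m
    unfolding power_abs by (intro power_mono tay_le) auto
  have En: "cmod (E n k) \<le> (1 / 3) ^ r (blk_of n) * cmod (b n) / real (n + k + 1)" for n k
  proof -
    have "cmod (E n k) = \<bar>tay n k ^ r (blk_of n)\<bar> * (cmod (b n) / real (n + k + 1))"
      by (simp only: E_def norm_mult Hn norm_of_real mult.commute mult_1)
    also have "\<dots> \<le> (1 / 3) ^ r (blk_of n) * (cmod (b n) / real (n + k + 1))"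
      by (intro mult_right_mono tp) auto
    finally show ?thesis by simp
  qed
  have Mn: "cmod (M n k) \<le> 2 * cmod (b n) / real (n + k + 1)" for n k
  proof -
    have "cmod (M n k) = \<bar>1 - tay n k ^ r (blk_of n)\<bar> * (cmod (b n) / real (n + k + 1))"
      by (simp only: M_def norm_mult Hn norm_of_real mult.commute mult_1)
    also have "\<dots> \<le> 2 * (cmod (b n) / real (n + k + 1))"
    proof (intro mult_right_mono)
      have "\<bar>tay n k ^ r (blk_of n)\<bar> \<le> 1" using tp[of n k "r (blk_of n)"] power_le_one[of "1 / 3 :: real" "r (blk_of n)"] by simp
      then show "\<bar>1 - tay n k ^ r (blk_of n)\<bar> \<le> 2" by (simp add: abs_le_iff)
    qed auto
    finally show ?thesis by simp
  qed
  have mopM: "mop M (pw a) = pw (\<lambda>n. \<Sum>k. M n k * a k)" if "a \<in> l2w" for a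
    using that by (simp add: mop_def cf_pw)
  have Rb: "mop M \<in> bounded_ops V N"
  proof (rule bounded_opsI[where \<mu> = "\<lambda>_. 2" and t = "2 * D" and M = M])
    show "cmod (M n k) \<le> 2 * cmod (b n) / real (n + k + 1)" for n k by (rule Mn)
    show "2 * \<beta> j \<le> 2 * D" for j using D[of j] by simp
  qed (use mopM in auto)
  have e_l2w: "e p \<in> l2w" for p
    by (rule l2w_finite_support(1)[of "blk (fst p)"]) (auto simp: e_def split: prod.splits)
  have Ls: "summable (\<lambda>k. a k / complex_of_real ((ctr j + real k) ^ Suc i))" if a: "a \<in> l2w" for a j i
  proof (rule summable_comparison_test')
    show "summable (\<lambda>k. cmod (a k) / (2 ^ j + real k))"
      using a by (intro hilbert_summable) (auto simp: l2w_def)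
    fix k
    have 1: "(1::real) \<le> 2 ^ j" by simp
    have c: "2 ^ j + real k \<le> ctr j + real k" "1 \<le> ctr j + real k"
      using 1 unfolding ctr_def by linarith+
    have "2 ^ j + real k \<le> (ctr j + real k) * 1" using c by simp
    also have "\<dots> \<le> (ctr j + real k) * (ctr j + real k) ^ i"
      using c by (intro mult_left_mono one_le_power) auto
    finally have "2 ^ j + real k \<le> (ctr j + real k) ^ Suc i" by simp
    moreover have pos: "0 < (ctr j + real k) ^ Suc i" using c(2) by (intro zero_less_power) linarith
    ultimately have "cmod (a k) / (ctr j + real k) ^ Suc i \<le> cmod (a k) / (2 ^ j + real k)"
      by (intro divide_left_mono mult_pos_pos) (auto intro: add_pos_nonneg)
    then show "norm (a k / complex_of_real ((ctr j + real k) ^ Suc i)) \<le> cmod (a k) / (2 ^ j + real k)"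
      by (simp only: norm_divide norm_of_real abs_of_pos[OF pos])
  qed
  have row: "(\<Sum>k. M n k * a k) = (\<Sum>p\<in>P. L a p * e p n)" if a: "a \<in> l2w" for a n
  proof -
    let ?j = "blk_of n"
    have "M n k * a k = (\<Sum>i<r ?j. b n * of_real ((ctr ?j - real (Suc n)) ^ i) * (a k / complex_of_real ((ctr ?j + real k) ^ Suc i)))" for k
    proof -
      have "M n k = b n * of_real ((1 - tay n k ^ r ?j) / real (n + k + 1))"
        by (simp add: M_def H_def)
      also have "\<dots> = (\<Sum>i<r ?j. b n * (of_real ((ctr ?j - real (Suc n)) ^ i) / of_real ((ctr ?j + real k) ^ Suc i)))"
        by (simp only: tay_sum of_real_sum of_real_divide sum_distrib_left)
      finally have "M n k * a k = (\<Sum>i<r ?j. b n * (of_real ((ctr ?j - real (Suc n)) ^ i) / of_real ((ctr ?j + real k) ^ Suc i))) * a k"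
        by (rule arg_cong)
      also have "\<dots> = (\<Sum>i<r ?j. b n * of_real ((ctr ?j - real (Suc n)) ^ i) * (a k / complex_of_real ((ctr ?j + real k) ^ Suc i)))"
        unfolding sum_distrib_right by (intro sum.cong refl) (simp only: times_divide_eq_right times_divide_eq_left mult_ac)
      finally show ?thesis .
    qed
    then have "(\<Sum>k. M n k * a k) = (\<Sum>k. \<Sum>i<r ?j. b n * of_real ((ctr ?j - real (Suc n)) ^ i) * (a k / complex_of_real ((ctr ?j + real k) ^ Suc i)))"
      by presburger
    also have "\<dots> = (\<Sum>i<r ?j. \<Sum>k. b n * of_real ((ctr ?j - real (Suc n)) ^ i) * (a k / complex_of_real ((ctr ?j + real k) ^ Suc i)))"
      by (rule suminf_sum) (intro summable_mult Ls a)
    also have "\<dots> = (\<Sum>i<r ?j. b n * of_real ((ctr ?j - real (Suc n)) ^ i) * L a (?j, i))"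
      unfolding L_def prod.case by (intro sum.cong refl suminf_mult Ls a)
    also have "\<dots> = (\<Sum>i<r ?j. L a (?j, i) * e (?j, i) n)"
      by (simp add: e_def blk_of mult.commute)
    also have "\<dots> = (\<Sum>j\<in>J. \<Sum>i<r j. L a (j, i) * e (j, i) n)"
    proof (cases "?j \<in> J")
      case True
      have "(\<Sum>i<r j. L a (j, i) * e (j, i) n) = 0" if "j \<in> J - {?j}" for j
        using that blk_of_eq[of n j] by (intro sum.neutral) (auto simp: e_def)
      then show ?thesis using J(1) True by (simp add: sum.remove)
    next
      case False
      have "(\<Sum>i<r j. L a (j, i) * e (j, i) n) = 0" if "j \<in> J" for j
        using that False blk_of_eq[of n j] by (intro sum.neutral) (auto simp: e_def)
      then show ?thesis using J(2)[OF False] by simp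
    qed
    also have "\<dots> = (\<Sum>p\<in>P. L a p * e p n)"
      unfolding P_def using J(1) by (subst sum.Sigma) (auto simp: case_prod_unfold)
    finally show ?thesis .
  qed
  have Rr: "rank_le V n (mop M)"
  proof (rule rank_leI[OF P, where e = "\<lambda>p. pw (e p)"])
    fix f assume "f \<in> V"
    then obtain a where a: "a \<in> l2w" "f = pw a" by (rule VE)
    have "mop M f = pw (\<lambda>n. \<Sum>p\<in>P. L a p * e p n)" using a by (simp add: mopM row)
    also have "\<dots> = (\<lambda>x. \<Sum>p\<in>P. pw (\<lambda>n. L a p * e p n) x)"
      using P by (intro pw_sum[THEN conjunct2]) (auto intro: pconv_scale l2w_pconv e_l2w)
    also have "\<dots> = (\<lambda>x. \<Sum>p\<in>P. L a p * pw (e p) x)"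
      by (simp add: pw_scale l2w_pconv e_l2w)
    finally show "\<exists>c. mop M f = (\<lambda>x. \<Sum>p\<in>P. c p * pw (e p) x)" by blast
  qed
  show ?thesis
  proof (rule singular_value_le[OF T_bounded[OF D] Rb Rr])
    show "0 \<le> sqrt CH * t" using t0 CH_pos by simp
    fix f assume "f \<in> V"
    then obtain a where a: "a \<in> l2w" "f = pw a" by (rule VE)
    have lam: "(1 / 3) ^ r j * \<beta> j \<le> t" for j using t[of j] by (simp add: power_divide)
    have H1: "cmod (H n k) \<le> 1 * cmod (b n) / real (n + k + 1)" for n k by (simp only: Hn order.refl)
    have sH: "summable (\<lambda>k. H n k * a k)" for n
      by (rule summable_norm_cancel, rule mat_entry(1)[of H "\<lambda>_. 1", OF H1 _ a(1)]) simp
    have sM: "summable (\<lambda>k. M n k * a k)" for n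
      by (rule summable_norm_cancel, rule mat_entry(1)[of M "\<lambda>_. 2", OF Mn _ a(1)]) simp
    have Ha: "(\<lambda>n. \<Sum>k. H n k * a k) \<in> l2w"
      by (rule mat_bound(1)[of H "\<lambda>_. 1" D, OF H1 _ _ a(1)]) (use D in auto)
    have Ma: "(\<lambda>n. \<Sum>k. M n k * a k) \<in> l2w"
      by (rule mat_bound(1)[of M "\<lambda>_. 2" "2 * D", OF Mn _ _ a(1)]) (use D in auto)
    have "(\<lambda>x. T f x - mop M f x) = pw (\<lambda>n. (\<Sum>k. H n k * a k) - (\<Sum>k. M n k * a k))"
      using a Ha Ma by (simp add: T mopM pw_diff l2w_pconv H_def)
    also have "(\<lambda>n. (\<Sum>k. H n k * a k) - (\<Sum>k. M n k * a k)) = (\<lambda>n. \<Sum>k. E n k * a k)"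
      using sH sM by (subst suminf_diff) (auto simp: E_def M_def algebra_simps)
    finally have "N (\<lambda>x. T f x - mop M f x) = N (pw (\<lambda>n. \<Sum>k. E n k * a k))" by simp
    also have "\<dots> = nrm (\<lambda>n. \<Sum>k. E n k * a k)"
      by (intro N mat_bound(1)[of E "\<lambda>j. (1 / 3) ^ r j" t, OF En _ lam a(1)]) auto
    also have "\<dots> \<le> sqrt CH * t * nrm a"
      by (intro mat_bound(2)[of E "\<lambda>j. (1 / 3) ^ r j" t, OF En _ lam a(1)]) auto
    also have "nrm a = N f" using a by (simp add: N)
    finally show "N (\<lambda>x. T f x - mop M f x) \<le> sqrt CH * t * N f" .
  qed
qed

text \<open>Fewer terms above a multiple of the singular number than its index allows would
  contradict \<open>singular_value_upper\<close>; so more than \<open>n\<close> pairs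
  \<open>(j, i)\<close> have \<open>\<alpha>\<close> at least a multiple of the singular number
  \<open>n\<close>. An injective choice of such pairs dominates the singular numbers by distinct
  terms of a double series that converges geometrically in \<open>i\<close>.\<close>

lemma singular_summable:
  assumes p: "0 < p" and s: "summable (\<lambda>j. \<beta> j powr p)"
  shows "summable (\<lambda>n. singular_value V N T n powr p)"
proof -
  have fin: "finite {j. t < \<beta> j}" if "0 < t" for t
    using finite_greater_of_summable_powr[OF p dyad_nonneg s that] .
  obtain D where D: "\<And>j. \<beta> j \<le> D" using bounded_of_finite[OF fin[of 1]] by auto
  let ?s = "singular_value V N T"
  have s0: "0 \<le> ?s n" for n by (rule singular_value_nonneg[OF T_bounded[OF D]])
  define \<alpha> where "\<alpha> = (\<lambda>(j, i). \<beta> j / 3 ^ i :: real)"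
  \<comment> \<open>With the factor 2, having too few pairs above \<open>?s n / K\<close> would give
    \<open>?s n \<le> ?s n / 2\<close>.\<close>
  define K where "K = 2 * sqrt CH"
  have K: "0 < K" using CH_pos by (simp add: K_def)
  have "\<exists>f. inj f \<and> (\<forall>n. f n \<in> {x. ?s n \<le> K * \<alpha> x})"
  proof (rule ex_injective_choice)
    fix n
    show "\<exists>X. finite X \<and> n < card X \<and> X \<subseteq> {x. ?s n \<le> K * \<alpha> x}"
    proof (cases "?s n = 0")
      case True
      \<comment> \<open>A vanishing singular number is dominated by any \<open>n + 1\<close>
        pairs.\<close>
      show ?thesis
        by (rule exI[of _ "{0} \<times> {..n}"]) (use True K dyad_nonneg in \<open>auto simp: \<alpha>_def card_cartesian_product\<close>)
    next
      case False
      define t where "t = ?s n / K"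
      have t: "0 < t" using False s0[of n] K by (simp add: t_def)
      define J where "J = {j. t < \<beta> j}"
      define r where "r = (\<lambda>j. LEAST i. \<beta> j / 3 ^ i \<le> t)"
      have r: "\<beta> j / 3 ^ r j \<le> t" for j
        unfolding r_def
      proof (rule LeastI_ex)
        obtain i where "\<beta> j / t < 3 ^ i" using real_arch_pow[of 3 "\<beta> j / t"] by auto
        then show "\<exists>i. \<beta> j / 3 ^ i \<le> t" using t by (intro exI[of _ i]) (simp add: field_simps)
      qed
      have lt: "t < \<beta> j / 3 ^ i" if "i < r j" for i j
        using not_less_Least[of i "\<lambda>i. \<beta> j / 3 ^ i \<le> t"] that by (auto simp: r_def)
      have r0: "r j = 0" if "j \<notin> J" for j
        using that lt[of 0 j] by (auto simp: J_def)
      have fJ: "finite J" unfolding J_def by (rule fin[OF t])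
      have "n < (\<Sum>j\<in>J. r j)"
      proof (rule ccontr)
        assume "\<not> n < (\<Sum>j\<in>J. r j)"
        then have "?s n \<le> sqrt CH * t"
          by (intro singular_value_upper[OF D fJ r0 _ r]) auto
        then show False using False s0[of n] CH_pos by (simp add: t_def K_def)
      qed
      moreover have "Sigma J (\<lambda>j. {..<r j}) \<subseteq> {x. ?s n \<le> K * \<alpha> x}"
      proof (intro subsetI CollectI)
        fix x assume "x \<in> Sigma J (\<lambda>j. {..<r j})"
        then have "t \<le> \<alpha> x" using lt by (auto simp: \<alpha>_def less_imp_le)
        then show "?s n \<le> K * \<alpha> x" using K by (simp add: t_def field_simps)
      qed
      ultimately show ?thesis using fJ by (intro exI[of _ "Sigma J (\<lambda>j. {..<r j})"]) auto
    qed
  qed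
  then obtain f where f: "inj f" "\<And>n. ?s n \<le> K * \<alpha> (f n)" by auto
  have a0: "0 \<le> \<alpha> x" for x using dyad_nonneg by (auto simp: \<alpha>_def split: prod.splits)
  \<comment> \<open>The ratio of the geometric series in \<open>i\<close> after raising to the power
    \<open>p\<close>.\<close>
  define q where "q = (1 / 3 :: real) powr p"
  have q: "0 < q" "q < 1" using p powr_less_mono2[of p "1/3" 1] by (auto simp: q_def)
  have ap: "\<alpha> (j, i) powr p = \<beta> j powr p * q ^ i" for i j
  proof -
    have "\<alpha> (j, i) powr p = \<beta> j powr p * ((1 / 3) ^ i) powr p"
      using dyad_nonneg[of b j] by (simp add: \<alpha>_def powr_mult[symmetric] power_divide)
    also have "((1 / 3 :: real) ^ i) powr p = q ^ i"
      by (simp add: q_def powr_realpow[symmetric] powr_powr mult.commute)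
    finally show ?thesis .
  qed
  show ?thesis
  proof (rule bounded_imp_summable)
    show "0 \<le> ?s n powr p" for n by simp
    fix n
    have "finite (f ` {..n})" by simp
    then obtain I where I: "f ` {..n} \<subseteq> {..<I} \<times> {..<I}"
    proof -
      let ?U = "fst ` f ` {..n} \<union> snd ` f ` {..n}"
      have "finite ?U" by simp
      then obtain I where I: "\<forall>u\<in>?U. u < I" unfolding finite_nat_set_iff_bounded ..
      have "f ` {..n} \<subseteq> {..<I} \<times> {..<I}"
      proof
        fix x assume "x \<in> f ` {..n}"
        then have "fst x \<in> ?U" "snd x \<in> ?U" by blast+
        then show "x \<in> {..<I} \<times> {..<I}" using I by (simp add: mem_Times_iff)
      qed
      then show thesis by (rule that)
    qed
    have "(\<Sum>k\<le>n. ?s k powr p) \<le> (\<Sum>k\<le>n. K powr p * \<alpha> (f k) powr p)"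
    proof (rule sum_mono)
      fix k
      have "?s k powr p \<le> (K * \<alpha> (f k)) powr p" using p s0 f(2) by (intro powr_mono2) auto
      then show "?s k powr p \<le> K powr p * \<alpha> (f k) powr p" using K a0 by (simp add: powr_mult)
    qed
    also have "\<dots> = K powr p * (\<Sum>x\<in>f ` {..n}. \<alpha> x powr p)"
      using f(1) by (subst sum.reindex) (auto simp: sum_distrib_left intro: inj_on_subset)
    also have "\<dots> \<le> K powr p * (\<Sum>x\<in>{..<I} \<times> {..<I}. \<alpha> x powr p)"
      using I by (intro mult_left_mono sum_mono2) auto
    also have "(\<Sum>x\<in>{..<I} \<times> {..<I}. \<alpha> x powr p) = (\<Sum>j<I. \<beta> j powr p * (\<Sum>i<I. q ^ i))"
      by (simp add: sum.cartesian_product' ap sum_distrib_left)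
    also have "K powr p * \<dots> \<le> K powr p * (\<Sum>j<I. \<beta> j powr p * (1 / (1 - q)))"
      using sum_geometric_le[of q "{..<I}" 0] q by (intro mult_left_mono sum_mono) auto
    also have "\<dots> \<le> K powr p * ((\<Sum>j. \<beta> j powr p) * (1 / (1 - q)))"
      unfolding sum_distrib_right[symmetric] using q s
      by (intro mult_left_mono mult_right_mono sum_le_suminf) auto
    finally show "(\<Sum>k\<le>n. ?s k powr p) \<le> K powr p * ((\<Sum>j. \<beta> j powr p) * (1 / (1 - q)))" .
  qed
qed

end

section \<open>Compactness and lower bounds for singular numbers\<close>

text \<open>Gaussian elimination: an equation with a nonzero coefficient determines one unknown, and
  substituting it leaves one equation and one unknown fewer.\<close>

lemma homogeneous_system:
  fixes \<gamma> :: "'a \<Rightarrow> nat \<Rightarrow> 'b::field"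
  assumes "finite F" "n < card F"
  shows "\<exists>c. (\<exists>j\<in>F. c j \<noteq> 0) \<and> (\<forall>k<n. (\<Sum>j\<in>F. c j * \<gamma> j k) = 0)"
  using assms
proof (induction n arbitrary: F \<gamma>)
  case 0
  then have "F \<noteq> {}" by auto
  then show ?case by (intro exI[of _ "\<lambda>_. 1"]) auto
next
  case (Suc n)
  show ?case
  proof (cases "\<forall>j\<in>F. \<gamma> j n = 0")
    case True
    obtain c where c: "\<exists>j\<in>F. c j \<noteq> 0" "\<forall>k<n. (\<Sum>j\<in>F. c j * \<gamma> j k) = 0"
      using Suc.IH[OF Suc.prems(1), of \<gamma>] Suc.prems(2) by auto
    have "(\<Sum>j\<in>F. c j * \<gamma> j n) = 0" using True by simp
    with c show ?thesis by (intro exI[of _ c]) (auto simp: less_Suc_eq)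
  next
    case False
    then obtain i where i: "i \<in> F" "\<gamma> i n \<noteq> 0" by blast
    let ?F = "F - {i}"
    define \<delta> where "\<delta> j k = \<gamma> j k - \<gamma> j n / \<gamma> i n * \<gamma> i k" for j k
    have F': "finite ?F" "n < card ?F" using Suc.prems i by auto
    obtain c where c: "\<exists>j\<in>?F. c j \<noteq> 0" "\<forall>k<n. (\<Sum>j\<in>?F. c j * \<delta> j k) = 0"
      using Suc.IH[OF F', of \<delta>] by blast
    define s where "s = (\<Sum>j\<in>?F. c j * \<gamma> j n)"
    define c' where "c' = c(i := - s / \<gamma> i n)"
    have split: "(\<Sum>j\<in>F. c' j * \<gamma> j k) = - s / \<gamma> i n * \<gamma> i k + (\<Sum>j\<in>?F. c j * \<gamma> j k)" for k
      using Suc.prems(1) i(1) by (subst sum.remove[of _ i]) (auto simp: c'_def intro!: sum.cong)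
    have dk: "(\<Sum>j\<in>?F. c j * \<delta> j k) = (\<Sum>j\<in>?F. c j * \<gamma> j k) - s / \<gamma> i n * \<gamma> i k" for k
      by (simp add: \<delta>_def s_def right_diff_distrib sum_subtractf sum_distrib_right sum_divide_distrib mult.assoc)
    have "(\<Sum>j\<in>F. c' j * \<gamma> j k) = 0" if "k < Suc n" for k
    proof (cases "k = n")
      case True
      then show ?thesis using i(2) by (simp add: split s_def)
    next
      case False
      then have "(\<Sum>j\<in>?F. c j * \<delta> j k) = 0" using c(2) that by simp
      then show ?thesis unfolding split using dk[of k] by simp
    qed
    moreover have "\<exists>j\<in>F. c' j \<noteq> 0" using c(1) by (auto simp: c'_def)
    ultimately show ?thesis by blast
  qed
qed

context hilbert_setting
begin

text \<open>Images of a bounded sequence have bounded coefficients, so a subsequence converges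
  coefficientwise. Far blocks have small \<open>\<beta> j\<close> and contribute little uniformly in
  the sequence; the remaining blocks involve finitely many coefficients.\<close>

lemma T_compact:
  assumes fin: "\<And>t. 0 < t \<Longrightarrow> finite {j. t < \<beta> j}"
  shows "compact_op V N T"
  unfolding compact_op_def
proof (intro allI impI)
  fix u :: "nat \<Rightarrow> complex \<Rightarrow> complex" assume u: "\<forall>n. u n \<in> V \<and> N (u n) \<le> 1"
  obtain D where D: "\<And>j. \<beta> j \<le> D" using bounded_of_finite[OF fin[of 1]] by auto
  have "\<forall>n. \<exists>a. a \<in> l2w \<and> u n = pw a" using u by (auto elim: VE)
  then obtain a where a: "\<And>n. a n \<in> l2w" "\<And>n. u n = pw (a n)" by metis
  have a1: "nrm (a n) \<le> 1" for n using u a N by metis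
  define H where "H = (\<lambda>n k. b n / complex_of_nat (n + k + 1))"
  have Hn: "cmod (H n k) \<le> 1 * cmod (b n) / real (n + k + 1)" for n k
    by (simp add: H_def norm_divide del: of_nat_Suc of_nat_add)
  define c where "c = (\<lambda>n i. \<Sum>k. H i k * a n k)"
  have Tu: "T (u n) = pw (c n)" for n using a by (simp add: T c_def H_def)
  define K where "K = sqrt CH * D"
  have c: "c n \<in> l2w" "nrm (c n) \<le> K" for n
  proof -
    show "c n \<in> l2w" unfolding c_def by (rule mat_bound(1)[of H "\<lambda>_. 1" D, OF Hn _ _ a(1)]) (use D in auto)
    have "nrm (c n) \<le> sqrt CH * D * nrm (a n)"
      unfolding c_def by (rule mat_bound(2)[of H "\<lambda>_. 1" D, OF Hn _ _ a(1)]) (use D in auto)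
    also have "\<dots> \<le> sqrt CH * D * 1"
      using D[of 0] dyad_nonneg[of b 0] CH_pos by (intro mult_left_mono a1 mult_nonneg_nonneg) auto
    finally show "nrm (c n) \<le> K" by (simp add: K_def)
  qed
  have K0: "0 \<le> K" using c[of 0] nrm_nonneg order_trans by blast
  \<comment> \<open>Scaling by \<open>sqrt (w i)\<close> gives one bound for all coordinates, as the
    diagonal argument requires.\<close>
  have cK: "norm (complex_of_real (sqrt (w i)) * c n i) \<le> K" for n i
  proof (rule power2_le_imp_le[OF _ K0])
    have "(norm (complex_of_real (sqrt (w i)) * c n i))\<^sup>2 = w i * (cmod (c n i))\<^sup>2"
      using w_pos[of i] by (simp add: norm_mult power_mult_distrib)
    also have "\<dots> \<le> (nrm (c n))\<^sup>2" using l2w_partial_le[OF c(1), of "{i}"] by simp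
    also have "\<dots> \<le> K\<^sup>2" using c nrm_nonneg by (intro power_mono) auto
    finally show "(norm (complex_of_real (sqrt (w i)) * c n i))\<^sup>2 \<le> K\<^sup>2" .
  qed
  obtain s where s: "strict_mono (s :: nat \<Rightarrow> nat)"
    "\<And>i. i \<in> UNIV \<Longrightarrow> \<exists>l. (\<lambda>k. complex_of_real (sqrt (w i)) * c (s k) i) \<longlonglongrightarrow> l"
    using function_convergent_subsequence[of "UNIV :: nat set" "\<lambda>n i. complex_of_real (sqrt (w i)) * c n i" K] cK
    by (metis countableI_type)
  then obtain l where l: "\<And>i. (\<lambda>k. complex_of_real (sqrt (w i)) * c (s k) i) \<longlonglongrightarrow> l i" by (metis UNIV_I)
  define h where "h i = l i / complex_of_real (sqrt (w i))" for i
  have lim: "(\<lambda>k. c (s k) i) \<longlonglongrightarrow> h i" for i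
    using tendsto_divide[OF l[of i] tendsto_const, of "complex_of_real (sqrt (w i))"] w_pos[of i]
    by (simp add: h_def)
  have bound_limit: "(\<Sum>i\<in>I. w i * (cmod (h i))\<^sup>2) \<le> B"
    if "\<And>k. (\<Sum>i\<in>I. w i * (cmod (c (s k) i))\<^sup>2) \<le> B" for I B
    by (rule LIMSEQ_le_const2[where X = "\<lambda>k. \<Sum>i\<in>I. w i * (cmod (c (s k) i))\<^sup>2"])
      (use that in \<open>auto intro!: tendsto_intros lim\<close>)
  have h: "h \<in> l2w"
  proof (rule l2w_boundI(1)[OF bound_limit K0])
    fix J k
    have "(\<Sum>i<2 ^ J - 1. w i * (cmod (c (s k) i))\<^sup>2) \<le> (nrm (c (s k)))\<^sup>2" by (rule l2w_partial_le[OF c(1)]) simp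
    also have "\<dots> \<le> K\<^sup>2" using c nrm_nonneg by (intro power_mono) auto
    finally show "(\<Sum>i<2 ^ J - 1. w i * (cmod (c (s k) i))\<^sup>2) \<le> K\<^sup>2" .
  qed
  have lim0: "(\<lambda>k. nrm (\<lambda>i. c (s k) i - h i)) \<longlonglongrightarrow> 0"
  proof (rule LIMSEQ_I)
    fix e :: real assume e: "0 < e"
    \<comment> \<open>The two tails together cost \<open>4 * (sqrt CH * t)\<close>, which is
      \<open>e / 4\<close>; the head costs another \<open>e / 4\<close>, and the factor 2 of
      \<open>l2w_add\<close> brings the total to \<open>e\<close>.\<close>
    define t where "t = e / (16 * sqrt CH)"
    have t: "0 < t" using e CH_pos by (simp add: t_def)
    obtain J where "\<forall>j\<in>{j. t < \<beta> j}. j < J" using fin[OF t] unfolding finite_nat_set_iff_bounded ..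
    then have J: "\<beta> j \<le> t" if "J \<le> j" for j using that by (meson leD le_less_linear mem_Collect_eq)
    define tail_part where "tail_part x i = (if blk_of i < J then 0 else x i)" for x :: "nat \<Rightarrow> complex" and i
    define head_part where "head_part x i = (if blk_of i < J then x i else 0)" for x :: "nat \<Rightarrow> complex" and i
    have tc: "tail_part (c n) \<in> l2w" "nrm (tail_part (c n)) \<le> sqrt CH * t" for n
    proof -
      let ?M = "\<lambda>i k. if blk_of i < J then 0 else H i k"
      let ?\<mu> = "\<lambda>j. if j < J then 0 else 1 :: real"
      have tail_c: "tail_part (c n) = (\<lambda>i. \<Sum>k. ?M i k * a n k)" by (auto simp: tail_part_def c_def)
      have M: "cmod (?M i k) \<le> ?\<mu> (blk_of i) * cmod (b i) / real (i + k + 1)" for i k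
        using Hn[of i k] by simp
      have lam: "?\<mu> j * \<beta> j \<le> t" for j using J[of j] t by simp
      show "tail_part (c n) \<in> l2w" unfolding tail_c by (rule mat_bound(1)[OF M _ lam a(1)]) auto
      have "nrm (tail_part (c n)) \<le> sqrt CH * t * nrm (a n)"
        unfolding tail_c by (rule mat_bound(2)[OF M _ lam a(1)]) auto
      also have "\<dots> \<le> sqrt CH * t * 1" using t CH_pos by (intro mult_left_mono a1) auto
      finally show "nrm (tail_part (c n)) \<le> sqrt CH * t" by simp
    qed
    have tS: "(\<Sum>i\<in>I. w i * (cmod (tail_part x i))\<^sup>2) = (\<Sum>i\<in>I \<inter> {i. \<not> blk_of i < J}. w i * (cmod (x i))\<^sup>2)"
      if "finite I" for I x using that by (intro sum.mono_neutral_cong_right) (auto simp: tail_part_def)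
    have th: "tail_part h \<in> l2w" "nrm (tail_part h) \<le> sqrt CH * t"
    proof -
      have "(\<Sum>i<2 ^ J' - 1. w i * (cmod (tail_part h i))\<^sup>2) \<le> (sqrt CH * t)\<^sup>2" for J'
        unfolding tS[OF finite_lessThan]
      proof (rule bound_limit)
        fix k
        have "(\<Sum>i\<in>{..<2 ^ J' - 1} \<inter> {i. \<not> blk_of i < J}. w i * (cmod (c (s k) i))\<^sup>2)
           = (\<Sum>i<2 ^ J' - 1. w i * (cmod (tail_part (c (s k)) i))\<^sup>2)" by (rule tS[OF finite_lessThan, symmetric])
        also have "\<dots> \<le> (nrm (tail_part (c (s k))))\<^sup>2" by (rule l2w_partial_le[OF tc(1)]) simp
        also have "\<dots> \<le> (sqrt CH * t)\<^sup>2" using tc nrm_nonneg by (intro power_mono) auto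
        finally show "(\<Sum>i\<in>{..<2 ^ J' - 1} \<inter> {i. \<not> blk_of i < J}. w i * (cmod (c (s k) i))\<^sup>2) \<le> (sqrt CH * t)\<^sup>2" .
      qed
      moreover have "0 \<le> sqrt CH * t" using CH_pos t by simp
      ultimately show "tail_part h \<in> l2w" "nrm (tail_part h) \<le> sqrt CH * t" by (rule l2w_boundI)+
    qed
    let ?d = "\<lambda>k i. c (s k) i - h i"
    have hd2: "head_part (?d k) \<in> l2w" "(nrm (head_part (?d k)))\<^sup>2 = (\<Sum>i<2 ^ J - 1. w i * (cmod (?d k i))\<^sup>2)" for k
    proof -
      have z: "head_part (?d k) i = 0" if "i \<notin> {..<2 ^ J - 1}" for i using that by (simp add: head_part_def blk_of_less_iff)
      show "head_part (?d k) \<in> l2w" by (rule l2w_finite_support(1)[OF finite_lessThan z])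
      have "(nrm (head_part (?d k)))\<^sup>2 = (\<Sum>i<2 ^ J - 1. w i * (cmod (head_part (?d k) i))\<^sup>2)"
        by (rule l2w_finite_support(2)[OF finite_lessThan z])
      then show "(nrm (head_part (?d k)))\<^sup>2 = (\<Sum>i<2 ^ J - 1. w i * (cmod (?d k i))\<^sup>2)"
        by (simp add: head_part_def blk_of_less_iff)
    qed
    have "(\<lambda>k. (nrm (head_part (?d k)))\<^sup>2) \<longlonglongrightarrow> (\<Sum>i<2 ^ J - 1. w i * (cmod (h i - h i))\<^sup>2)"
      unfolding hd2 by (intro tendsto_intros lim)
    then have "eventually (\<lambda>k. (nrm (head_part (?d k)))\<^sup>2 < (e / 4)\<^sup>2) sequentially"
      using e by (intro order_tendstoD(2)[of _ 0]) auto
    then obtain k0 where k0: "\<And>k. k0 \<le> k \<Longrightarrow> (nrm (head_part (?d k)))\<^sup>2 < (e / 4)\<^sup>2"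
      by (auto simp: eventually_sequentially)
    show "\<exists>k0. \<forall>k\<ge>k0. norm (nrm (?d k) - 0) < e"
    proof (intro exI allI impI)
      fix k assume k: "k0 \<le> k"
      have 1: "nrm (head_part (?d k)) < e / 4" by (rule power2_less_imp_less[OF k0[OF k]]) (use e in simp)
      have 2: "(\<lambda>i. tail_part (c (s k)) i - tail_part h i) \<in> l2w" "nrm (\<lambda>i. tail_part (c (s k)) i - tail_part h i) \<le> 4 * (sqrt CH * t)"
        using l2w_diff[OF tc(1) th(1), of "s k"] tc(2)[of "s k"] th(2) by auto
      have "?d k = (\<lambda>i. head_part (?d k) i + (tail_part (c (s k)) i - tail_part h i))" by (auto simp: head_part_def tail_part_def)
      then have "nrm (?d k) \<le> 2 * (nrm (head_part (?d k)) + nrm (\<lambda>i. tail_part (c (s k)) i - tail_part h i))"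
        using l2w_add(2)[OF hd2(1) 2(1), of k] by simp
      also have "\<dots> < 2 * (e / 4 + 4 * (sqrt CH * t))" using 1 2 by simp
      also have "\<dots> = e" using CH_pos by (simp add: t_def)
      finally show "norm (nrm (?d k) - 0) < e"
        using nrm_nonneg[OF l2w_diff(1)[OF c(1) h]] by simp
    qed
  qed
  have "N (\<lambda>x. T (u (s k)) x - pw h x) = nrm (\<lambda>i. c (s k) i - h i)" for k
    unfolding Tu using c h by (subst pw_diff[symmetric]) (auto intro: l2w_pconv N l2w_diff)
  then have "(\<lambda>k. N (\<lambda>x. T (u (s k)) x - pw h x)) \<longlonglongrightarrow> 0" using lim0 by simp
  then show "\<exists>h\<in>V. \<exists>s. strict_mono s \<and> (\<lambda>k. N (\<lambda>x. T (u (s k)) x - h x)) \<longlonglongrightarrow> 0"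
    using s(1) pw_V[OF h] by blast
qed

section \<open>Test functions on blocks and the lower bound\<close>

definition tvec :: "nat \<Rightarrow> nat \<Rightarrow> complex" where
  "tvec j k = (if k \<in> blk j then 1 / of_real (sqrt (2 ^ j * v j)) else 0)"

definition tcomb :: "nat set \<Rightarrow> (nat \<Rightarrow> complex) \<Rightarrow> nat \<Rightarrow> complex" where
  "tcomb F c k = (\<Sum>j\<in>F. c j * tvec j k)"

lemma tvec_l2w: "tvec j \<in> l2w"
  by (rule l2w_finite_support(1)[of "blk j"]) (auto simp: tvec_def)

lemma tcomb_eq:
  assumes "finite F" "j \<in> F" "k \<in> blk j"
  shows "tcomb F c k = c j / of_real (sqrt (2 ^ j * v j))"
proof -
  have "tcomb F c k = (\<Sum>i\<in>{j}. c i * tvec i k)"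
    unfolding tcomb_def using assms blk_unique by (intro sum.mono_neutral_right) (auto simp: tvec_def)
  then show ?thesis using assms by (simp add: tvec_def)
qed

lemma tcomb_outside: "k \<notin> (\<Union>j\<in>F. blk j) \<Longrightarrow> tcomb F c k = 0"
  unfolding tcomb_def by (intro sum.neutral) (auto simp: tvec_def)

lemma sum_UN_blk: "finite F \<Longrightarrow> (\<Sum>n\<in>(\<Union>j\<in>F. blk j). f n) = (\<Sum>j\<in>F. \<Sum>n\<in>blk j. f n)"
  using blk_unique by (intro sum.UNION_disjoint) auto

text \<open>The entries of \<open>tvec j\<close> are scaled so that \<open>2 ^ j\<close> terms of
  weight close to \<open>v j\<close> add up to about 1. As blocks are disjoint, these vectors are
  orthonormal up to the factor \<open>A\<close>.\<close>

lemma tcomb_nrm: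
  assumes F: "finite F"
  shows "tcomb F c \<in> l2w" "(nrm (tcomb F c))\<^sup>2 \<le> (\<Sum>j\<in>F. (cmod (c j))\<^sup>2)"
    "(\<Sum>j\<in>F. (cmod (c j))\<^sup>2) / A \<le> (nrm (tcomb F c))\<^sup>2"
proof -
  have fin: "finite (\<Union>j\<in>F. blk j)" using F by simp
  show "tcomb F c \<in> l2w" by (rule l2w_finite_support(1)[OF fin tcomb_outside])
  have "(nrm (tcomb F c))\<^sup>2 = (\<Sum>j\<in>F. \<Sum>n\<in>blk j. w n * (cmod (tcomb F c n))\<^sup>2)"
    unfolding sum_UN_blk[OF F, symmetric] by (rule l2w_finite_support(2)[OF fin tcomb_outside])
  also have "\<dots> = (\<Sum>j\<in>F. \<Sum>n\<in>blk j. w n * ((cmod (c j))\<^sup>2 / (2 ^ j * v j)))"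
    using v_pos F by (intro sum.cong refl) (simp add: tcomb_eq norm_divide power_divide less_imp_le)
  finally have e: "(nrm (tcomb F c))\<^sup>2 = (\<Sum>j\<in>F. \<Sum>n\<in>blk j. w n * ((cmod (c j))\<^sup>2 / (2 ^ j * v j)))" .
  have "(\<Sum>j\<in>F. \<Sum>n\<in>blk j. w n * ((cmod (c j))\<^sup>2 / (2 ^ j * v j))) \<le> (\<Sum>j\<in>F. \<Sum>n\<in>blk j. v j * ((cmod (c j))\<^sup>2 / (2 ^ j * v j)))"
    using v_pos by (intro sum_mono mult_right_mono w_blk_le) (auto simp: less_imp_le)
  also have "\<dots> = (\<Sum>j\<in>F. (cmod (c j))\<^sup>2)"
    using v_pos by (intro sum.cong refl) (simp add: card_blk less_imp_neq[symmetric])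
  finally show "(nrm (tcomb F c))\<^sup>2 \<le> (\<Sum>j\<in>F. (cmod (c j))\<^sup>2)" using e by simp
  have "(\<Sum>j\<in>F. (cmod (c j))\<^sup>2) / A = (\<Sum>j\<in>F. \<Sum>n\<in>blk j. v j / A * ((cmod (c j))\<^sup>2 / (2 ^ j * v j)))"
    unfolding sum_divide_distrib using v_pos by (intro sum.cong refl) (simp add: card_blk less_imp_neq[symmetric])
  also have "\<dots> \<le> (\<Sum>j\<in>F. \<Sum>n\<in>blk j. w n * ((cmod (c j))\<^sup>2 / (2 ^ j * v j)))"
    using v_pos by (intro sum_mono mult_right_mono w_blk_ge) (auto simp: less_imp_le)
  finally show "(\<Sum>j\<in>F. (cmod (c j))\<^sup>2) / A \<le> (nrm (tcomb F c))\<^sup>2" using e by simp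
qed

definition hs :: "nat \<Rightarrow> nat \<Rightarrow> real" where
  "hs n j = (\<Sum>k\<in>blk j. 1 / real (n + k + 1))"

text \<open>There are \<open>2 ^ j\<close> terms, each with a denominator of at most
  \<open>4 * 2 ^ j\<close>.\<close>

lemma hs_diag:
  assumes "n \<in> blk j" shows "1 / 4 \<le> hs n j"
proof -
  have "(\<Sum>k\<in>blk j. 1 / (4 * 2 ^ j)) \<le> hs n j"
    unfolding hs_def
  proof (intro sum_mono divide_left_mono)
    fix k assume "k \<in> blk j"
    then show "real (n + k + 1) \<le> 4 * 2 ^ j" using real_mem_blk[OF assms] real_mem_blk[of k j] by simp
  qed auto
  then show ?thesis by (simp add: card_blk)
qed

lemma hs_nonneg: "0 \<le> hs n j"
  unfolding hs_def by (intro sum_nonneg) auto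

lemma hs_le:
  assumes "n \<in> blk i" shows "hs n j \<le> 2 ^ j / 2 ^ max i j"
proof -
  have "hs n j \<le> (\<Sum>k\<in>blk j. 1 / 2 ^ max i j)"
    unfolding hs_def
  proof (intro sum_mono divide_left_mono)
    fix k assume "k \<in> blk j"
    then show "2 ^ max i j \<le> real (n + k + 1)"
      using real_mem_blk[OF assms] real_mem_blk[of k j] by (auto simp: max_def)
  qed auto
  then show ?thesis by (simp add: card_blk)
qed

text \<open>The left side is the matrix entry relative to normalised blocks, without the factor
  \<open>b n\<close>. Its square is at most the quantity of \<open>kernel_le\<close>, whose decay it
  inherits.\<close>

lemma hs_offdiag:
  assumes "n \<in> blk i"
  shows "sqrt (2 ^ i * v i) * hs n j / sqrt (2 ^ j * v j) \<le> sqrt B1 * \<rho> ^ nd i j"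
proof (rule power2_le_imp_le)
  have four: "(2 ^ m)\<^sup>2 = (4::real) ^ m" for m using two_power_mult_self[of m] by (simp add: power2_eq_square)
  have "(sqrt (2 ^ i * v i) * hs n j / sqrt (2 ^ j * v j))\<^sup>2 = (2 ^ i * v i) * (hs n j)\<^sup>2 / (2 ^ j * v j)"
    using v_pos by (simp add: power_mult_distrib power_divide less_imp_le)
  also have "\<dots> \<le> (2 ^ i * v i) * (2 ^ j / 2 ^ max i j)\<^sup>2 / (2 ^ j * v j)"
    using v_pos hs_le[OF assms] hs_nonneg by (intro divide_right_mono mult_left_mono power_mono) (auto simp: less_imp_le)
  also have "\<dots> = (2 ^ (i + j) * v i) / (4 ^ max i j * v j)"
    using v_pos[of j] by (simp add: power_divide four power_add field_simps two_power_mult_self)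
  also have "\<dots> \<le> (B1 * (\<rho>\<^sup>2) ^ nd i j * (4 ^ max i j * v j)) / (4 ^ max i j * v j)"
    using v_pos[of j] by (intro divide_right_mono kernel_le) auto
  also have "\<dots> = B1 * (\<rho>\<^sup>2) ^ nd i j" using v_pos[of j] by simp
  also have "\<dots> = (sqrt B1 * \<rho> ^ nd i j)\<^sup>2"
    by (simp add: power_mult_distrib B1_def power_mult[symmetric] mult.commute)
  finally show "(sqrt (2 ^ i * v i) * hs n j / sqrt (2 ^ j * v j))\<^sup>2 \<le> (sqrt B1 * \<rho> ^ nd i j)\<^sup>2" .
  show "0 \<le> sqrt B1 * \<rho> ^ nd i j" using rho by (simp add: B1_def)
qed

lemma tcomb_row:
  assumes F: "finite F"
  shows "(\<Sum>k. b n / of_nat (n + k + 1) * tcomb F c k)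
    = b n * (\<Sum>j\<in>F. c j * of_real (hs n j / sqrt (2 ^ j * v j)))"
proof -
  have "(\<Sum>k. b n / of_nat (n + k + 1) * tcomb F c k)
      = (\<Sum>k\<in>(\<Union>j\<in>F. blk j). b n / of_nat (n + k + 1) * tcomb F c k)"
    using F by (intro suminf_finite) (auto simp: tcomb_outside)
  also have "\<dots> = (\<Sum>j\<in>F. \<Sum>k\<in>blk j. b n / of_nat (n + k + 1) * (c j / of_real (sqrt (2 ^ j * v j))))"
    unfolding sum_UN_blk[OF F] using F by (intro sum.cong refl) (simp add: tcomb_eq)
  also have "\<dots> = (\<Sum>j\<in>F. b n * (c j * of_real (hs n j / sqrt (2 ^ j * v j))))"
  proof (intro sum.cong refl)
    fix j
    have "(\<Sum>k\<in>blk j. b n / of_nat (n + k + 1) * (c j / of_real (sqrt (2 ^ j * v j))))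
        = (\<Sum>k\<in>blk j. (b n * c j / of_real (sqrt (2 ^ j * v j))) * of_real (1 / real (n + k + 1)))"
      by (intro sum.cong refl) simp
    also have "\<dots> = (b n * c j / of_real (sqrt (2 ^ j * v j))) * of_real (hs n j)"
      by (simp only: hs_def of_real_sum sum_distrib_left)
    finally show "(\<Sum>k\<in>blk j. b n / of_nat (n + k + 1) * (c j / of_real (sqrt (2 ^ j * v j))))
        = b n * (c j * of_real (hs n j / sqrt (2 ^ j * v j)))" by simp
  qed
  finally show ?thesis by (simp only: sum_distrib_left)
qed

text \<open>In \<open>T_lower\<close> the image is known to lie in \<open>V\<close> only as a
  function; convergence in the disc is what allows \<open>pw_inj\<close> to recover its
  coefficients. The multiplier of \<open>b n\<close> is bounded in \<open>n\<close> because
  \<open>hs\<close> is at most 1.\<close>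

lemma tcomb_image_pconv:
  assumes F: "finite F"
  shows "(\<lambda>n. \<Sum>k. b n / of_nat (n + k + 1) * tcomb F c k) \<in> pconv"
  unfolding tcomb_row[OF F]
proof (rule pconv_mult_bounded[OF b])
  fix n
  have "cmod (\<Sum>j\<in>F. c j * of_real (hs n j / sqrt (2 ^ j * v j))) \<le> (\<Sum>j\<in>F. cmod (c j) * (1 / sqrt (2 ^ j * v j)))"
  proof (rule sum_norm_le)
    fix j assume "j \<in> F"
    have "hs n j \<le> 2 ^ j / 2 ^ max (blk_of n) j" by (rule hs_le[OF blk_of])
    also have "\<dots> \<le> 1" by (simp add: power_increasing)
    finally have "\<bar>hs n j / sqrt (2 ^ j * v j)\<bar> \<le> 1 / sqrt (2 ^ j * v j)"
      using hs_nonneg[of n j] v_pos[of j] by (simp add: divide_right_mono)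
    then show "cmod (c j * of_real (hs n j / sqrt (2 ^ j * v j))) \<le> cmod (c j) * (1 / sqrt (2 ^ j * v j))"
      unfolding norm_mult norm_of_real by (intro mult_left_mono) auto
  qed
  then show "cmod (\<Sum>j\<in>F. c j * of_real (hs n j / sqrt (2 ^ j * v j))) \<le> (\<Sum>j\<in>F. cmod (c j) * (1 / sqrt (2 ^ j * v j)))" .
qed

text \<open>Normalised diagonal entries are at least \<open>1 / 4\<close>, and separation makes the
  off-diagonal part \<open>E\<close> small. After squaring, \<open>1 / 16\<close> of the sum of
  squares is available, of which hypothesis \<open>m\<close> lets \<open>E\<close> consume at most
  half. The remaining \<open>1 / 32\<close> against the factor \<open>2 * A\<close> gives
  \<open>64 * A\<close>.\<close>

lemma tcomb_lower:
  assumes F: "finite F" and sep: "\<And>i j. i \<in> F \<Longrightarrow> j \<in> F \<Longrightarrow> i \<noteq> j \<Longrightarrow> m \<le> nd i j"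
    and m: "2 * B1 * (2 * \<rho> ^ m / (1 - \<rho>))\<^sup>2 \<le> 1 / 32"
    and t: "0 \<le> t" "\<And>j. j \<in> F \<Longrightarrow> t \<le> \<beta> j"
    and x: "x = (\<lambda>n. \<Sum>k. b n / of_nat (n + k + 1) * tcomb F c k)" "x \<in> l2w"
  shows "t\<^sup>2 * (\<Sum>j\<in>F. (cmod (c j))\<^sup>2) \<le> 64 * A * (nrm x)\<^sup>2"
proof -
  let ?c = "\<lambda>j. cmod (c j)"
  define E where "E i = (\<Sum>j\<in>F. (if i = j then 0 else \<rho> ^ nd i j) * ?c j)" for i
  define X where "X i = (\<Sum>n\<in>blk i. w n * (cmod (x n))\<^sup>2)" for i
  have E0: "0 \<le> E i" for i unfolding E_def using rho by (intro sum_nonneg) auto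
  have X0: "0 \<le> X i" for i unfolding X_def by (intro sum_nonneg term_nonneg)
  have one: "t\<^sup>2 * ((?c i)\<^sup>2 / 16 - 2 * B1 * (E i)\<^sup>2) \<le> 2 * A * X i" if i: "i \<in> F" for i
  proof -
    have row: "(cmod (b n))\<^sup>2 * ((?c i)\<^sup>2 / 16 - 2 * B1 * (E i)\<^sup>2) \<le> 2 * A * 2 ^ i * (w n * (cmod (x n))\<^sup>2)"
      if n: "n \<in> blk i" for n
    proof -
      define z where "z j = sqrt (2 ^ i * v i) * hs n j / sqrt (2 ^ j * v j)" for j
      define S where "S = (\<Sum>j\<in>F. c j * of_real (z j))"
      \<comment> \<open>Rescaling the row turns its entries into the numbers \<open>z j\<close> that
        \<open>hs_diag\<close> and \<open>hs_offdiag\<close> estimate.\<close>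
      have sq: "of_real (sqrt (2 ^ i * v i)) * x n = b n * S"
        unfolding x(1) tcomb_row[OF F] S_def z_def by (simp add: sum_distrib_left mult_ac)
      have zi: "1 / 4 \<le> z i" using hs_diag[OF n] v_pos[of i] by (simp add: z_def)
      have S: "S = c i * of_real (z i) + (\<Sum>j\<in>F - {i}. c j * of_real (z j))"
        unfolding S_def using F i by (rule sum.remove)
      have z0: "0 \<le> z j" for j using hs_nonneg v_pos by (simp add: z_def less_imp_le)
      have "cmod (\<Sum>j\<in>F - {i}. c j * of_real (z j)) \<le> (\<Sum>j\<in>F - {i}. sqrt B1 * ((if i = j then 0 else \<rho> ^ nd i j) * ?c j))"
      proof (rule sum_norm_le)
        fix j assume "j \<in> F - {i}"
        moreover have "z j * ?c j \<le> sqrt B1 * \<rho> ^ nd i j * ?c j"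
          unfolding z_def by (intro mult_right_mono hs_offdiag n) auto
        ultimately show "cmod (c j * of_real (z j)) \<le> sqrt B1 * ((if i = j then 0 else \<rho> ^ nd i j) * ?c j)"
          using z0[of j] by (auto simp: norm_mult mult_ac)
      qed
      also have "\<dots> \<le> sqrt B1 * E i"
        unfolding E_def sum_distrib_left[symmetric] using F rho by (intro mult_left_mono sum_mono2) (auto simp: B1_def)
      finally have off: "cmod (\<Sum>j\<in>F - {i}. c j * of_real (z j)) \<le> sqrt B1 * E i" .
      have "?c i * (1 / 4) \<le> ?c i * z i" using zi by (intro mult_left_mono) auto
      also have "\<dots> = cmod (S - (\<Sum>j\<in>F - {i}. c j * of_real (z j)))" using z0[of i] by (simp add: S norm_mult)
      also have "\<dots> \<le> cmod S + sqrt B1 * E i" using norm_triangle_ineq4[of S] off by (meson add_left_mono order_trans)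
      finally have "(?c i / 4)\<^sup>2 \<le> (cmod S + sqrt B1 * E i)\<^sup>2" by (intro power_mono) auto
      also have "\<dots> \<le> 2 * (cmod S)\<^sup>2 + 2 * (sqrt B1 * E i)\<^sup>2"
        using sum_squares_bound[of "cmod S" "sqrt B1 * E i"] by (simp add: power2_sum)
      finally have "(?c i)\<^sup>2 / 16 - 2 * B1 * (E i)\<^sup>2 \<le> 2 * (cmod S)\<^sup>2"
        by (simp add: power_divide power_mult_distrib B1_def)
      then have "(cmod (b n))\<^sup>2 * ((?c i)\<^sup>2 / 16 - 2 * B1 * (E i)\<^sup>2) \<le> (cmod (b n))\<^sup>2 * (2 * (cmod S)\<^sup>2)"
        by (intro mult_left_mono) auto
      also have "\<dots> = 2 * (cmod (b n * S))\<^sup>2" by (simp add: norm_mult power_mult_distrib)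
      also have "\<dots> = 2 * (2 ^ i * v i * (cmod (x n))\<^sup>2)"
        using v_pos[of i] by (simp only: sq[symmetric] norm_mult norm_of_real power_mult_distrib) (simp add: less_imp_le)
      also have "\<dots> \<le> 2 * (2 ^ i * (A * w n) * (cmod (x n))\<^sup>2)"
        using w_blk_ge[OF n] A_ge_1 by (intro mult_left_mono mult_right_mono) (auto simp: divide_le_eq mult.commute)
      finally show ?thesis by (simp add: mult_ac)
    qed
    have "(2 ^ i * (\<beta> i)\<^sup>2) * ((?c i)\<^sup>2 / 16 - 2 * B1 * (E i)\<^sup>2) \<le> 2 * A * 2 ^ i * X i"
      unfolding dyad_sq X_def sum_distrib_right sum_distrib_left by (intro sum_mono row)
    then have "2 ^ i * ((\<beta> i)\<^sup>2 * ((?c i)\<^sup>2 / 16 - 2 * B1 * (E i)\<^sup>2)) \<le> 2 ^ i * (2 * A * X i)" by (simp only: mult_ac)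
    then have le: "(\<beta> i)\<^sup>2 * ((?c i)\<^sup>2 / 16 - 2 * B1 * (E i)\<^sup>2) \<le> 2 * A * X i" by simp
    show ?thesis
    \<comment> \<open>Replacing \<open>\<beta> i\<close> by the smaller \<open>t\<close> is
      legitimate only for a nonnegative bracket; otherwise the left side is at most 0
      anyway.\<close>
    proof (cases "0 \<le> (?c i)\<^sup>2 / 16 - 2 * B1 * (E i)\<^sup>2")
      case True
      then have "t\<^sup>2 * ((?c i)\<^sup>2 / 16 - 2 * B1 * (E i)\<^sup>2) \<le> (\<beta> i)\<^sup>2 * ((?c i)\<^sup>2 / 16 - 2 * B1 * (E i)\<^sup>2)"
        using t i by (intro mult_right_mono power_mono) auto
      with le show ?thesis by linarith
    next
      case False
      then have "t\<^sup>2 * ((?c i)\<^sup>2 / 16 - 2 * B1 * (E i)\<^sup>2) \<le> 0" by (intro mult_nonneg_nonpos) auto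
      also have "0 \<le> 2 * A * X i" using A_ge_1 X0 by simp
      finally show ?thesis .
    qed
  qed
  have Es: "(\<Sum>i\<in>F. (E i)\<^sup>2) \<le> (2 * \<rho> ^ m / (1 - \<rho>))\<^sup>2 * (\<Sum>j\<in>F. (?c j)\<^sup>2)"
    unfolding E_def
  proof (rule schur_test)
    show "0 \<le> 2 * \<rho> ^ m / (1 - \<rho>)" using rho by simp
    have *: "(\<Sum>j\<in>F. if i = j then 0 else \<rho> ^ nd j i) \<le> 2 * \<rho> ^ m / (1 - \<rho>)" if "i \<in> F" for i
    proof -
      have "(\<Sum>j\<in>F. if i = j then 0 else \<rho> ^ nd j i) = (\<Sum>j\<in>F - {i}. \<rho> ^ nd j i)"
        using F by (intro sum.mono_neutral_cong_right) auto
      also have "\<dots> \<le> 2 * \<rho> ^ m / (1 - \<rho>)" using rho F that sep by (intro sum_nd_le) auto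
      finally show ?thesis .
    qed
    show "(\<Sum>j\<in>F. if i = j then 0 else \<rho> ^ nd i j) \<le> 2 * \<rho> ^ m / (1 - \<rho>)" if "i \<in> F" for i
      using *[OF that] by (simp only: nd_commute[of i])
    show "(\<Sum>i\<in>F. if i = j then 0 else \<rho> ^ nd i j) \<le> 2 * \<rho> ^ m / (1 - \<rho>)" if "j \<in> F" for j
      using *[OF that] by (simp add: eq_commute)
  qed (use rho in auto)
  define C where "C = (\<Sum>j\<in>F. (?c j)\<^sup>2)"
  have C0: "0 \<le> C" unfolding C_def by (intro sum_nonneg) auto
  have "2 * B1 * (\<Sum>i\<in>F. (E i)\<^sup>2) \<le> 2 * B1 * ((2 * \<rho> ^ m / (1 - \<rho>))\<^sup>2 * C)"
    using Es unfolding C_def by (intro mult_left_mono) (auto simp: B1_def)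
  also have "\<dots> = (2 * B1 * (2 * \<rho> ^ m / (1 - \<rho>))\<^sup>2) * C" by simp
  also have "\<dots> \<le> 1 / 32 * C" using m C0 by (intro mult_right_mono)
  finally have "C / 32 \<le> C / 16 - 2 * B1 * (\<Sum>i\<in>F. (E i)\<^sup>2)" by simp
  then have "t\<^sup>2 * (C / 32) \<le> t\<^sup>2 * (C / 16 - 2 * B1 * (\<Sum>i\<in>F. (E i)\<^sup>2))" by (intro mult_left_mono) auto
  also have "\<dots> = (\<Sum>i\<in>F. t\<^sup>2 * ((?c i)\<^sup>2 / 16 - 2 * B1 * (E i)\<^sup>2))"
    by (simp add: C_def sum_distrib_left sum_subtractf sum_divide_distrib right_diff_distrib)
  also have "\<dots> \<le> (\<Sum>i\<in>F. 2 * A * X i)" by (intro sum_mono one)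
  also have "\<dots> = 2 * A * (\<Sum>n\<in>(\<Union>j\<in>F. blk j). w n * (cmod (x n))\<^sup>2)"
    unfolding sum_UN_blk[OF F] by (simp add: X_def sum_distrib_left)
  also have "\<dots> \<le> 2 * A * (nrm x)\<^sup>2" using A_ge_1 F by (intro mult_left_mono l2w_partial_le x(2)) auto
  finally show ?thesis unfolding C_def by simp
qed

text \<open>Blocks at distance \<open>gap\<close> make the compressed operator diagonally dominant.\<close>

definition gap :: nat where
  "gap = (SOME m. 2 * B1 * (2 * \<rho> ^ m / (1 - \<rho>))\<^sup>2 \<le> 1 / 32 \<and> 0 < m)"

lemma gap: "2 * B1 * (2 * \<rho> ^ gap / (1 - \<rho>))\<^sup>2 \<le> 1 / 32" "0 < gap"
proof -
  have "(\<lambda>m. 2 * B1 * (2 * \<rho> ^ m / (1 - \<rho>))\<^sup>2) \<longlonglongrightarrow> 2 * B1 * (2 * 0 / (1 - \<rho>))\<^sup>2"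
    using rho by (intro tendsto_intros LIMSEQ_realpow_zero) auto
  then have "eventually (\<lambda>m. 2 * B1 * (2 * \<rho> ^ m / (1 - \<rho>))\<^sup>2 < 1 / 32) sequentially"
    by (intro order_tendstoD(2)) auto
  then have "eventually (\<lambda>m. 2 * B1 * (2 * \<rho> ^ m / (1 - \<rho>))\<^sup>2 \<le> 1 / 32 \<and> 0 < m) sequentially"
    using eventually_gt_at_top[of 0] by eventually_elim auto
  then have "\<exists>m. 2 * B1 * (2 * \<rho> ^ m / (1 - \<rho>))\<^sup>2 \<le> 1 / 32 \<and> 0 < m"
    by (rule eventually_happens'[rotated]) simp
  then have "2 * B1 * (2 * \<rho> ^ gap / (1 - \<rho>))\<^sup>2 \<le> 1 / 32 \<and> 0 < gap" unfolding gap_def by (rule someI_ex)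
  then show "2 * B1 * (2 * \<rho> ^ gap / (1 - \<rho>))\<^sup>2 \<le> 1 / 32" "0 < gap" by auto
qed

text \<open>The inverse root of the constant \<open>64 * A\<close> in
  \<open>tcomb_lower\<close>.\<close>

definition c0 :: real where "c0 = 1 / (8 * sqrt A)"

lemma c0_pos: "0 < c0" using A_ge_1 by (simp add: c0_def)

lemma T_lower:
  assumes TB: "T \<in> bounded_ops V N" and F: "finite F"
    and sep: "\<And>i j. i \<in> F \<Longrightarrow> j \<in> F \<Longrightarrow> i \<noteq> j \<Longrightarrow> gap \<le> nd i j"
    and t: "0 \<le> t" "\<And>j. j \<in> F \<Longrightarrow> t \<le> \<beta> j"
  shows "c0 * t * N (pw (tcomb F c)) \<le> N (T (pw (tcomb F c)))"
proof -
  define x where "x = (\<lambda>n. \<Sum>k. b n / of_nat (n + k + 1) * tcomb F c k)"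
  note tc = tcomb_nrm[OF F, of c]
  have Tx: "T (pw (tcomb F c)) = pw x" unfolding x_def by (rule T[OF tc(1)])
  have "T (pw (tcomb F c)) \<in> V" using TB pw_V[OF tc(1)] by (auto simp: bounded_ops_def)
  \<comment> \<open>Boundedness yields some sequence \<open>y\<close> in \<open>l2w\<close>
    representing the image; injectivity of \<open>pw\<close> identifies it with the formal image
    \<open>x\<close>, which so far was only known to converge in the disc.\<close>
  then obtain y where y: "y \<in> l2w" "pw x = pw y" unfolding Tx by (rule VE)
  have xy: "x = y" by (rule pw_inj[OF _ l2w_pconv[OF y(1)] y(2)]) (unfold x_def, rule tcomb_image_pconv[OF F])
  have x: "x \<in> l2w" using y xy by simp
  have "(c0 * t * nrm (tcomb F c))\<^sup>2 = t\<^sup>2 * (nrm (tcomb F c))\<^sup>2 / (64 * A)"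
    using A_ge_1 by (simp add: c0_def power_mult_distrib power_divide)
  also have "\<dots> \<le> t\<^sup>2 * (\<Sum>j\<in>F. (cmod (c j))\<^sup>2) / (64 * A)"
    using A_ge_1 by (intro divide_right_mono mult_left_mono tc) auto
  also have "\<dots> \<le> (64 * A * (nrm x)\<^sup>2) / (64 * A)"
    using A_ge_1 by (intro divide_right_mono tcomb_lower[OF F sep gap(1) t x_def x]) auto
  also have "\<dots> = (nrm x)\<^sup>2" using A_ge_1 by simp
  finally have "c0 * t * nrm (tcomb F c) \<le> nrm x"
    by (rule power2_le_imp_le) (rule nrm_nonneg[OF x])
  then show ?thesis by (simp add: Tx N x tc)
qed

lemma tcomb_N_pos:
  assumes "finite F" "\<exists>j\<in>F. c j \<noteq> 0"
  shows "0 < N (pw (tcomb F c))"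
proof -
  obtain j where j: "j \<in> F" "c j \<noteq> 0" using assms by blast
  have "0 < (\<Sum>j\<in>F. (cmod (c j))\<^sup>2)" using assms(1) j by (intro sum_pos2[of _ j]) auto
  then have "0 < (\<Sum>j\<in>F. (cmod (c j))\<^sup>2) / A" using A_ge_1 by simp
  also have "\<dots> \<le> (nrm (tcomb F c))\<^sup>2" by (rule tcomb_nrm[OF assms(1)])
  finally have "nrm (tcomb F c) \<noteq> 0" by auto
  then show ?thesis using tcomb_nrm(1)[OF assms(1), of c] nrm_nonneg[of "tcomb F c"] by (simp add: N)
qed

text \<open>The lower bound on a single block, where the separation condition is void.\<close>

lemma beta_le_of_bounded:
  assumes TB: "T \<in> bounded_ops V N"
  shows "\<exists>C. \<forall>j. \<beta> j \<le> C"
proof -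
  obtain C where C: "\<And>f. f \<in> V \<Longrightarrow> N (T f) \<le> C * N f" using TB unfolding bounded_ops_def by blast
  have "\<beta> j \<le> C / c0" for j
  proof -
    let ?f = "pw (tcomb {j} (\<lambda>_. 1))"
    have pos: "0 < N ?f" by (rule tcomb_N_pos) auto
    have "c0 * \<beta> j * N ?f \<le> N (T ?f)" by (rule T_lower[OF TB]) (use dyad_nonneg in auto)
    also have "\<dots> \<le> C * N ?f" by (intro C pw_V tcomb_nrm) auto
    finally show ?thesis using pos c0_pos by (simp add: field_simps)
  qed
  then show ?thesis by blast
qed

lemma bounded_ops_sum:
  assumes S: "S \<in> bounded_ops V N" and F: "finite F" and f: "\<And>j. j \<in> F \<Longrightarrow> f j \<in> V"
  shows "(\<lambda>x. \<Sum>j\<in>F. c j * f j x) \<in> V \<and> S (\<lambda>x. \<Sum>j\<in>F. c j * f j x) = (\<lambda>x. \<Sum>j\<in>F. c j * S (f j) x)"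
  using F f
proof (induction F rule: finite_induct)
  case empty
  then show ?case using zero_in_V bounded_ops_zero[OF S] by simp
next
  case (insert j F)
  have lin: "\<And>f h. f \<in> V \<Longrightarrow> h \<in> V \<Longrightarrow> S (\<lambda>x. f x + h x) = (\<lambda>x. S f x + S h x)"
    "\<And>f c. f \<in> V \<Longrightarrow> S (\<lambda>x. c * f x) = (\<lambda>x. c * S f x)"
    using S by (auto simp: bounded_ops_def)
  have fj: "(\<lambda>x. c j * f j x) \<in> V" using insert by (intro V_scale) auto
  with insert show ?case
    using V_add[OF fj] lin(1)[OF fj] lin(2)[of "f j" "c j"] by simp
qed

lemma singular_value_lower:
  assumes TB: "T \<in> bounded_ops V N" and F: "finite F" "n < card F"
    and sep: "\<And>i j. i \<in> F \<Longrightarrow> j \<in> F \<Longrightarrow> i \<noteq> j \<Longrightarrow> gap \<le> nd i j"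
    and t: "0 \<le> t" "\<And>j. j \<in> F \<Longrightarrow> t \<le> \<beta> j"
  shows "c0 * t \<le> singular_value V N T n"
  unfolding singular_value_def
proof (rule cINF_greatest)
  show "{R \<in> bounded_ops V N. rank_le V n R} \<noteq> {}" using zero_op[of n] by blast
  fix R assume "R \<in> {R \<in> bounded_ops V N. rank_le V n R}"
  then have R: "R \<in> bounded_ops V N" "rank_le V n R" by auto
  obtain e where e: "\<forall>f\<in>V. \<exists>c. R f = (\<lambda>x. \<Sum>k<n. c k * e k x)" using R(2) by (auto simp: rank_le_def)
  have tv: "pw (tvec j) \<in> V" for j by (rule pw_V[OF tvec_l2w])
  then have "\<forall>j. \<exists>c. R (pw (tvec j)) = (\<lambda>x. \<Sum>k<n. c k * e k x)" using e by blast
  \<comment> \<open>\<open>\<gamma> j\<close> holds the coordinates of the image of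
    \<open>tvec j\<close> under \<open>R\<close>; \<open>n\<close> equations in more than
    \<open>n\<close> unknowns leave a nontrivial combination that \<open>R\<close>
    annihilates.\<close>
  then obtain \<gamma> where \<gamma>: "\<And>j. R (pw (tvec j)) = (\<lambda>x. \<Sum>k<n. \<gamma> j k * e k x)" by metis
  obtain c where c: "\<exists>j\<in>F. c j \<noteq> 0" "\<forall>k<n. (\<Sum>j\<in>F. c j * \<gamma> j k) = 0"
    using homogeneous_system[OF F, of \<gamma>] by blast
  let ?f = "pw (tcomb F c)"
  have fV: "?f \<in> V" by (intro pw_V tcomb_nrm F)
  have f: "?f = (\<lambda>x. \<Sum>j\<in>F. c j * pw (tvec j) x)"
  proof -
    have "?f = pw (\<lambda>n. \<Sum>j\<in>F. c j * tvec j n)" by (rule arg_cong[of _ _ pw]) (simp add: tcomb_def fun_eq_iff)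
    also have "\<dots> = (\<lambda>x. \<Sum>j\<in>F. pw (\<lambda>n. c j * tvec j n) x)"
      using F by (intro pw_sum[THEN conjunct2]) (auto intro: pconv_scale l2w_pconv tvec_l2w)
    finally show ?thesis by (simp add: pw_scale l2w_pconv tvec_l2w)
  qed
  have "R ?f = (\<lambda>x. \<Sum>j\<in>F. c j * R (pw (tvec j)) x)"
    unfolding f using bounded_ops_sum[OF R(1) F(1), of "\<lambda>j. pw (tvec j)" c] tv by simp
  also have "\<dots> = (\<lambda>x. \<Sum>k<n. (\<Sum>j\<in>F. c j * \<gamma> j k) * e k x)"
    unfolding \<gamma> sum_distrib_left sum_distrib_right by (subst sum.swap) (simp add: mult.assoc)
  also have "\<dots> = (\<lambda>x. 0)" using c(2) by simp
  finally have Rf: "R ?f = (\<lambda>x. 0)" .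
  have pos: "0 < N ?f" by (rule tcomb_N_pos[OF F(1) c(1)])
  have "c0 * t * N ?f \<le> N (T ?f)" by (rule T_lower[OF TB F(1) sep t])
  then have "c0 * t \<le> N (\<lambda>x. T ?f x - R ?f x) / N ?f" using pos by (simp add: Rf le_divide_eq)
  also have "\<dots> \<le> op_norm V N (\<lambda>f x. T f x - R f x)"
    unfolding op_norm_def by (rule cSUP_upper[OF fV op_norm_bdd[OF TB R(1)]])
  finally show "c0 * t \<le> op_norm V N (\<lambda>f x. T f x - R f x)" .
qed

text \<open>The least \<open>\<beta> j\<close> bounds all others on \<open>F\<close> from below, so
  it is controlled by the singular number with index \<open>card F - 1\<close>. Removing its block
  and inducting replaces sorting.\<close>

lemma beta_sum_le:
  assumes TB: "T \<in> bounded_ops V N" and p: "0 < p" and F: "finite F"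
    and sep: "\<And>i j. i \<in> F \<Longrightarrow> j \<in> F \<Longrightarrow> i \<noteq> j \<Longrightarrow> gap \<le> nd i j"
  shows "(\<Sum>j\<in>F. \<beta> j powr p) \<le> (\<Sum>n<card F. (singular_value V N T n / c0) powr p)"
  using F sep
proof (induction "card F" arbitrary: F)
  case 0
  then show ?case by simp
next
  case (Suc n)
  then have ne: "F \<noteq> {}" by auto
  define t where "t = Min (\<beta> ` F)"
  have "t \<in> \<beta> ` F" unfolding t_def using Suc.prems ne by (intro Min_in) auto
  then obtain i where i: "i \<in> F" "t = \<beta> i" by auto
  have t: "t \<le> \<beta> j" if "j \<in> F" for j unfolding t_def using Suc.prems that by (intro Min_le) auto
  have cF: "card F = Suc n" and cF': "card (F - {i}) = n" using Suc i by auto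
  have "c0 * t \<le> singular_value V N T n"
    by (rule singular_value_lower[OF TB Suc.prems(1) _ Suc.prems(2) _ t]) (use cF i dyad_nonneg in auto)
  then have "\<beta> i \<le> singular_value V N T n / c0" using i c0_pos by (simp add: field_simps)
  then have 1: "\<beta> i powr p \<le> (singular_value V N T n / c0) powr p"
    using p dyad_nonneg by (intro powr_mono2) auto
  have 2: "(\<Sum>j\<in>F - {i}. \<beta> j powr p) \<le> (\<Sum>k<card (F - {i}). (singular_value V N T k / c0) powr p)"
    using Suc.hyps(1)[of "F - {i}"] Suc.prems cF' by simp
  have "(\<Sum>j\<in>F. \<beta> j powr p) = \<beta> i powr p + (\<Sum>j\<in>F - {i}. \<beta> j powr p)"
    using Suc.prems i by (intro sum.remove) auto
  with 1 2 show ?case unfolding cF cF' by simp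
qed

text \<open>Each of the \<open>gap\<close> residue classes modulo \<open>gap\<close> is a separated
  set, to which \<open>beta_sum_le\<close> applies with the same bound.\<close>

lemma beta_summable:
  assumes TB: "T \<in> bounded_ops V N" and p: "0 < p"
    and s: "summable (\<lambda>n. singular_value V N T n powr p)"
  shows "summable (\<lambda>j. \<beta> j powr p)"
proof (rule bounded_imp_summable)
  show "0 \<le> \<beta> j powr p" for j by simp
  fix J
  let ?S = "\<Sum>n. singular_value V N T n powr p"
  let ?K = "(1 / c0) powr p * ?S"
  have e: "(singular_value V N T n / c0) powr p = (1 / c0) powr p * singular_value V N T n powr p" for n
    using c0_pos singular_value_nonneg[OF TB, of n] by (subst powr_mult[symmetric]) auto
  have "(\<Sum>j\<le>J. \<beta> j powr p) = (\<Sum>r<gap. \<Sum>j\<in>{j\<in>{..J}. j mod gap = r}. \<beta> j powr p)"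
    using gap(2) by (intro sum.group[symmetric]) auto
  also have "\<dots> \<le> (\<Sum>r<gap. ?K)"
  proof (rule sum_mono)
    fix r
    let ?F = "{j\<in>{..J}. j mod gap = r}"
    have "(\<Sum>j\<in>?F. \<beta> j powr p) \<le> (\<Sum>n<card ?F. (singular_value V N T n / c0) powr p)"
    proof (rule beta_sum_le[OF TB p])
      fix i j assume ij: "i \<in> ?F" "j \<in> ?F" "i \<noteq> j"
      have *: "gap \<le> l - k" if "k < l" "k mod gap = l mod gap" for k l :: nat
      proof -
        have "gap dvd l - k" using that by (metis less_imp_le mod_eq_dvd_iff_nat)
        then show ?thesis using that by (intro dvd_imp_le) auto
      qed
      show "gap \<le> nd i j" using *[of i j] *[of j i] ij by (cases "i < j") (auto simp: nd_def)
    qed simp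
    also have "\<dots> = (1 / c0) powr p * (\<Sum>n<card ?F. singular_value V N T n powr p)"
      by (simp add: e sum_distrib_left)
    also have "\<dots> \<le> ?K" by (intro mult_left_mono sum_le_suminf s) auto
    finally show "(\<Sum>j\<in>?F. \<beta> j powr p) \<le> ?K" .
  qed
  finally show "(\<Sum>j\<le>J. \<beta> j powr p) \<le> real gap * ?K" by simp
qed

theorem schatten_finite:
  assumes "p \<noteq> \<infinity>" "0 < enn2real p"
  shows "T \<in> schatten p V N \<longleftrightarrow> summable (\<lambda>j. \<beta> j powr enn2real p)"
proof
  assume "T \<in> schatten p V N"
  then show "summable (\<lambda>j. \<beta> j powr enn2real p)"
    using beta_summable assms by (auto simp: schatten_def)
next
  assume s: "summable (\<lambda>j. \<beta> j powr enn2real p)"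
  have fin: "finite {j. t < \<beta> j}" if "0 < t" for t
    using finite_greater_of_summable_powr[OF assms(2) dyad_nonneg s that] .
  obtain D where D: "\<And>j. \<beta> j \<le> D" using bounded_of_finite[OF fin[of 1]] by auto
  show "T \<in> schatten p V N"
    using assms T_bounded[OF D] T_compact[OF fin] singular_summable[OF assms(2) s] by (simp add: schatten_def)
qed

theorem schatten_infinite:
  "T \<in> schatten \<infinity> V N \<longleftrightarrow> (\<exists>C. \<forall>j. \<beta> j \<le> C)"
  using T_bounded beta_le_of_bounded by (auto simp: schatten_def)

end

section \<open>Parseval on circles\<close>

text \<open>Half-open, so that the layers partition the radii from 0 to 1. On layer \<open>k\<close>
  the distance to 1 is \<open>(1 / 2) ^ k\<close> up to a factor 2, which matches the exponents in
  block \<open>k\<close>.\<close>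

definition layer :: "nat \<Rightarrow> real set" where
  "layer k = {1 - (1 / 2) ^ k..<1 - (1 / 2) ^ Suc k}"

lemma mem_layer: "r \<in> layer k \<longleftrightarrow> (1 / 2) ^ Suc k < 1 - r \<and> 1 - r \<le> (1 / 2) ^ k"
  by (auto simp: layer_def)

lemma layer_unique:
  assumes "r \<in> layer k" "r \<in> layer l" shows "k = l"
proof -
  have "\<not> k < l" if "r \<in> layer k" "r \<in> layer l" for k l
  proof
    assume "k < l"
    then have "(1 / 2 :: real) ^ l \<le> (1 / 2) ^ Suc k" by (intro power_decreasing) auto
    with that show False unfolding mem_layer by linarith
  qed
  from this[OF assms] this[OF assms(2,1)] show ?thesis by simp
qed

lemma ex_layer:
  assumes "0 \<le> r" "r < 1" shows "\<exists>k. r \<in> layer k"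
proof -
  have ex: "\<exists>k. (1 / 2) ^ k < 1 - r"
    using real_arch_pow_inv[of "1 - r" "1 / 2"] assms by auto
  define k where "k = (LEAST k. (1 / 2) ^ k < 1 - r)"
  have k: "(1 / 2) ^ k < 1 - r" unfolding k_def by (rule LeastI_ex[OF ex])
  have "k \<noteq> 0" using k assms by (intro notI) auto
  then obtain l where l: "k = Suc l" using not0_implies_Suc by blast
  have "\<not> (1 / 2) ^ l < 1 - r" using not_less_Least[of l "\<lambda>k. (1 / 2) ^ k < 1 - r"] l by (simp add: k_def)
  then have "r \<in> layer l" using k l unfolding mem_layer by auto
  then show ?thesis by blast
qed

lemma layer_bounds: "r \<in> layer k \<Longrightarrow> 0 \<le> r \<and> r < 1"
  unfolding mem_layer using power_le_one[of "1 / 2 :: real" k] zero_less_power[of "1 / 2 :: real" "Suc k"] by auto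

lemma emeasure_layer: "emeasure lebesgue (layer k) = ennreal ((1 / 2) ^ Suc k)"
proof -
  have "layer k \<in> sets lborel" by (simp add: layer_def)
  then have "emeasure lebesgue (layer k) = emeasure lborel (layer k)" by simp
  also have "\<dots> = ennreal ((1 / 2) ^ Suc k)" unfolding layer_def by (subst emeasure_lborel_Ico) auto
  finally show ?thesis .
qed

lemma layer_sets [measurable]: "layer k \<in> sets lebesgue"
  by (simp add: layer_def)

text \<open>Comparison with a step function: monotonicity of the integral suffices, so measurability
  has to be checked only for the step function.\<close>

lemma nn_integral_layers_ge:
  assumes K: "finite K" and C: "\<And>k. 0 \<le> C k"
    and F: "\<And>k r. k \<in> K \<Longrightarrow> r \<in> layer k \<Longrightarrow> ennreal (C k) \<le> F r"
  shows "ennreal (\<Sum>k\<in>K. C k * (1 / 2) ^ Suc k) \<le> (\<integral>\<^sup>+ r. F r \<partial>lebesgue)"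
proof -
  have "ennreal (\<Sum>k\<in>K. C k * (1 / 2) ^ Suc k) = (\<Sum>k\<in>K. ennreal (C k) * emeasure lebesgue (layer k))"
    using C by (simp add: emeasure_layer ennreal_mult[symmetric] sum_ennreal del: power_Suc)
  also have "\<dots> = (\<integral>\<^sup>+ r. (\<Sum>k\<in>K. ennreal (C k) * indicator (layer k) r) \<partial>lebesgue)"
    by (subst nn_integral_sum) (auto simp: nn_integral_cmult_indicator)
  also have "\<dots> \<le> (\<integral>\<^sup>+ r. F r \<partial>lebesgue)"
  proof (rule nn_integral_mono)
    fix r :: real
    show "(\<Sum>k\<in>K. ennreal (C k) * indicator (layer k) r) \<le> F r"
    proof (cases "\<exists>k\<in>K. r \<in> layer k")
      case True
      then obtain k where k: "k \<in> K" "r \<in> layer k" by blast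
      have "(\<Sum>k\<in>K. ennreal (C k) * indicator (layer k) r) = (\<Sum>l\<in>{k}. ennreal (C l) * indicator (layer l) r)"
        using K k by (intro sum.mono_neutral_right) (auto simp: indicator_def dest: layer_unique[OF k(2)])
      then show ?thesis using F[OF k] k by simp
    next
      case False
      then have "(\<Sum>k\<in>K. ennreal (C k) * indicator (layer k) r) = 0" by (intro sum.neutral) (auto simp: indicator_def)
      then show ?thesis by simp
    qed
  qed
  finally show ?thesis .
qed

lemma nn_integral_layers_le:
  assumes C: "\<And>k. 0 \<le> C k" "summable (\<lambda>k. C k * (1 / 2) ^ Suc k)"
    and F: "\<And>k r. r \<in> layer k \<Longrightarrow> F r \<le> ennreal (C k)" "\<And>r. r \<notin> {0<..<1} \<Longrightarrow> F r = 0"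
  shows "(\<integral>\<^sup>+ r. F r \<partial>lebesgue) < \<infinity>"
proof -
  have "(\<integral>\<^sup>+ r. F r \<partial>lebesgue) \<le> (\<integral>\<^sup>+ r. (\<Sum>k. ennreal (C k) * indicator (layer k) r) \<partial>lebesgue)"
  proof (rule nn_integral_mono)
    fix r :: real
    show "F r \<le> (\<Sum>k. ennreal (C k) * indicator (layer k) r)"
    proof (cases "r \<in> {0<..<1}")
      case True
      then obtain k where k: "r \<in> layer k" using ex_layer[of r] by auto
      have "F r \<le> (\<Sum>l\<in>{k}. ennreal (C l) * indicator (layer l) r)" using F(1)[OF k] k by simp
      also have "\<dots> \<le> (\<Sum>k. ennreal (C k) * indicator (layer k) r)" by (intro sum_le_suminf) auto
      finally show ?thesis .
    qed (simp add: F)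
  qed
  also have "\<dots> = (\<Sum>k. ennreal (C k) * emeasure lebesgue (layer k))"
    by (subst nn_integral_suminf) (auto simp: nn_integral_cmult_indicator)
  also have "\<dots> = (\<Sum>k. ennreal (C k * (1 / 2) ^ Suc k))"
    using C by (simp add: emeasure_layer ennreal_mult del: power_Suc)
  also have "\<dots> = ennreal (\<Sum>k. C k * (1 / 2) ^ Suc k)"
    using C by (intro suminf_ennreal2) auto
  also have "\<dots> < \<infinity>" by simp
  finally show ?thesis .
qed

section \<open>Fourier coefficients and termwise integration on a circle\<close>

abbreviation circ :: "real measure" where
  "circ \<equiv> restrict_space lborel {-pi..pi}"

lemma finite_measure_circ: "finite_measure circ"
  by (intro finite_measureI) (simp add: emeasure_restrict_space space_restrict_space)

lemma measurable_circ:
  fixes f :: "real \<Rightarrow> complex"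
  assumes "continuous_on UNIV f"
  shows "f \<in> borel_measurable circ"
  using borel_measurable_continuous_onI[OF assms] by (intro measurable_restrict_space1) simp

lemma integral_series:
  fixes u :: "nat \<Rightarrow> real \<Rightarrow> complex"
  assumes m: "\<And>n. u n \<in> borel_measurable circ" and c: "\<And>n \<theta>. cmod (u n \<theta>) \<le> c n" "summable c"
  shows "integrable circ (\<lambda>\<theta>. \<Sum>n. u n \<theta>)"
    and "(\<lambda>n. integral\<^sup>L circ (u n)) sums (integral\<^sup>L circ (\<lambda>\<theta>. \<Sum>n. u n \<theta>))"
proof -
  interpret finite_measure circ by (rule finite_measure_circ)
  have i: "integrable circ (u n)" for n
    by (rule integrable_const_bound[of _ "c n"]) (use m c in auto)
  have s: "summable (\<lambda>n. cmod (u n \<theta>))" for \<theta>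
    by (rule summable_comparison_test'[OF c(2)]) (use c in auto)
  have "summable (\<lambda>n. \<integral>\<theta>. cmod (u n \<theta>) \<partial>circ)"
  proof (rule summable_comparison_test')
    show "summable (\<lambda>n. c n * measure circ (space circ))" by (intro summable_mult2 c)
    fix n
    have "(\<integral>\<theta>. cmod (u n \<theta>) \<partial>circ) \<le> (\<integral>\<theta>. c n \<partial>circ)"
      using i c by (intro integral_mono) auto
    then show "norm (\<integral>\<theta>. cmod (u n \<theta>) \<partial>circ) \<le> c n * measure circ (space circ)"
      by (simp add: mult.commute)
  qed
  with i s show "integrable circ (\<lambda>\<theta>. \<Sum>n. u n \<theta>)"
    "(\<lambda>n. integral\<^sup>L circ (u n)) sums (integral\<^sup>L circ (\<lambda>\<theta>. \<Sum>n. u n \<theta>))"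
    by (auto intro!: integrable_suminf sums_integral)
qed

lemma integral_circ_cis:
  "integral\<^sup>L circ (\<lambda>\<theta>. cis (real_of_int k * \<theta>)) = (if k = 0 then 2 * pi else 0)"
proof (cases "k = 0")
  case True
  then show ?thesis by (simp add: measure_restrict_space space_restrict_space scaleR_conv_of_real)
next
  case False
  let ?F = "\<lambda>\<theta>. cis (real_of_int k * \<theta>) / (\<i> * of_int k)"
  have d: "(?F has_vector_derivative cis (real_of_int k * \<theta>)) (at \<theta> within {-pi..pi})" for \<theta>
  proof -
    have "((\<lambda>\<theta>. cis (real_of_int k * \<theta>)) has_derivative (\<lambda>x. (real_of_int k * x) *\<^sub>R (\<i> * cis (real_of_int k * \<theta>)))) (at \<theta> within {-pi..pi})"
      by (auto intro!: derivative_eq_intros)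
    then have "((\<lambda>\<theta>. cis (real_of_int k * \<theta>)) has_vector_derivative (real_of_int k *\<^sub>R (\<i> * cis (real_of_int k * \<theta>)))) (at \<theta> within {-pi..pi})"
      by (simp add: has_vector_derivative_def mult.commute)
    from has_vector_derivative_divide[OF this, of "\<i> * of_int k"] False
    show ?thesis by (simp add: scaleR_conv_of_real)
  qed
  have c: "continuous_on {-pi..pi} (\<lambda>\<theta>. cis (real_of_int k * \<theta>))" by (intro continuous_intros)
  have "integral\<^sup>L circ (\<lambda>\<theta>. cis (real_of_int k * \<theta>)) = (\<integral>\<theta>. indicator {-pi..pi} \<theta> *\<^sub>R cis (real_of_int k * \<theta>) \<partial>lborel)"
    by (subst integral_restrict_space) auto
  also have "\<dots> = ?F pi - ?F (-pi)"
    by (rule integral_FTC_Icc) (use d c in auto)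
  also have "cis (real_of_int k * pi) = cis (real_of_int k * - pi)"
    using sin_npi_int[of k] by (simp add: complex_eq_iff mult.commute)
  then have "?F pi - ?F (-pi) = 0" by simp
  finally show ?thesis using False by simp
qed

text \<open>The moduli of the terms are constant on the circle and summable, so termwise integration
  is justified. It is used twice: for the Fourier coefficients of \<open>F\<close>, and for
  \<open>cnj F * F\<close> with the first factor expanded.\<close>

lemma circle_parseval:
  assumes a: "a \<in> pconv" and r: "0 \<le> r" "r < 1"
  shows "integrable circ (\<lambda>\<theta>. (cmod (pw a (of_real r * cis \<theta>)))\<^sup>2)"
    and "(\<lambda>n. (cmod (a n))\<^sup>2 * r ^ (2 * n)) sums ((\<integral>\<theta>. (cmod (pw a (of_real r * cis \<theta>)))\<^sup>2 \<partial>circ) / (2 * pi))"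
proof -
  define F where "F \<theta> = pw a (of_real r * cis \<theta>)" for \<theta>
  have s: "summable (\<lambda>n. cmod (a n) * r ^ n)"
    using pconv_norm[OF a, of "of_real r"] r by (simp add: norm_mult norm_power)
  have pwr: "(of_real r * cis \<theta>) ^ n = of_real (r ^ n) * cis (real n * \<theta>)" for \<theta> n
    by (simp add: power_mult_distrib Complex.DeMoivre)
  have Fs: "F \<theta> = (\<Sum>n. a n * (of_real (r ^ n) * cis (real n * \<theta>)))" for \<theta>
    using r by (simp add: F_def pw_def norm_mult pwr)
  have Fss: "(\<lambda>n. a n * (of_real (r ^ n) * cis (real n * \<theta>))) sums F \<theta>" for \<theta>
    using pw_sums[OF a, of "of_real r * cis \<theta>"] r by (simp add: F_def norm_mult pwr)
  define K where "K = (\<Sum>n. cmod (a n) * r ^ n)"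
  have Fb: "cmod (F \<theta>) \<le> K" for \<theta>
  proof -
    have e: "cmod (a n * (of_real (r ^ n) * cis (real n * \<theta>))) = cmod (a n) * r ^ n" for n
      using r by (simp add: norm_mult norm_power)
    show ?thesis unfolding Fs K_def using summable_norm[of "\<lambda>n. a n * (of_real (r ^ n) * cis (real n * \<theta>))"] s
      by (simp only: e)
  qed
  have cisI: "integral\<^sup>L circ (\<lambda>\<theta>. cnj (cis (real n * \<theta>)) * F \<theta>) = 2 * pi * a n * of_real (r ^ n)" for n
  proof -
    let ?u = "\<lambda>m \<theta>. (a m * of_real (r ^ m)) * cis (real_of_int (int m - int n) * \<theta>)"
    have Fu: "cnj (cis (real n * \<theta>)) * F \<theta> = (\<Sum>m. ?u m \<theta>)" for \<theta>
    proof -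
      have "(\<lambda>m. cnj (cis (real n * \<theta>)) * (a m * (of_real (r ^ m) * cis (real m * \<theta>)))) sums (cnj (cis (real n * \<theta>)) * F \<theta>)"
        by (intro sums_mult Fss)
      moreover have "cnj (cis (real n * \<theta>)) * (a m * (of_real (r ^ m) * cis (real m * \<theta>))) = ?u m \<theta>" for m
      proof -
        have "cis (real_of_int (int m - int n) * \<theta>) = cnj (cis (real n * \<theta>)) * cis (real m * \<theta>)"
          by (simp add: cis_cnj cis_mult algebra_simps)
        then show ?thesis by simp
      qed
      ultimately have "(\<lambda>m. ?u m \<theta>) sums (cnj (cis (real n * \<theta>)) * F \<theta>)" by (simp only:)
      then show ?thesis by (simp only: sums_iff)
    qed
    have "(\<lambda>m. integral\<^sup>L circ (?u m)) sums integral\<^sup>L circ (\<lambda>\<theta>. \<Sum>m. ?u m \<theta>)"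
    proof (rule integral_series(2)[OF _ _ s])
      show "?u m \<in> borel_measurable circ" for m by (intro measurable_circ continuous_intros)
      show "cmod (?u m \<theta>) \<le> cmod (a m) * r ^ m" for m \<theta> using r by (simp add: norm_mult norm_power)
    qed
    moreover have "integral\<^sup>L circ (?u m) = (if m = n then 2 * pi * a n * of_real (r ^ n) else 0)" for m
      by (subst integral_mult_right_zero, subst integral_circ_cis) auto
    ultimately have "(\<lambda>m. if m = n then 2 * pi * a n * of_real (r ^ n) else 0) sums integral\<^sup>L circ (\<lambda>\<theta>. \<Sum>m. ?u m \<theta>)"
      by simp
    moreover have "(\<lambda>m. if m = n then 2 * pi * a n * of_real (r ^ n) else 0) sums (2 * pi * a n * of_real (r ^ n))"
      using sums_single[of n "\<lambda>m. 2 * pi * a m * of_real (r ^ m)"] by (simp cong: if_cong)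
    ultimately show ?thesis unfolding Fu by (rule sums_unique2)
  qed
  have Fint: "integrable circ F"
    unfolding Fs[abs_def]
  proof (rule integral_series(1)[OF _ _ s])
    show "(\<lambda>\<theta>. a n * (of_real (r ^ n) * cis (real n * \<theta>))) \<in> borel_measurable circ" for n
      by (intro measurable_circ continuous_intros)
    show "cmod (a n * (of_real (r ^ n) * cis (real n * \<theta>))) \<le> cmod (a n) * r ^ n" for n \<theta>
      using r by (simp add: norm_mult norm_power)
  qed
  let ?w = "\<lambda>n \<theta>. (cnj (a n) * of_real (r ^ n)) * (cnj (cis (real n * \<theta>)) * F \<theta>)"
  have Fw: "of_real ((cmod (F \<theta>))\<^sup>2) = (\<Sum>n. ?w n \<theta>)" for \<theta>
  proof -
    have "(\<lambda>n. cnj (a n * (of_real (r ^ n) * cis (real n * \<theta>))) * F \<theta>) sums (cnj (F \<theta>) * F \<theta>)"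
      by (intro sums_mult2 Fss[THEN sums_cnj[THEN iffD2]])
    then have "(\<lambda>n. ?w n \<theta>) sums (cnj (F \<theta>) * F \<theta>)" by (simp add: mult_ac)
    then show ?thesis by (simp add: sums_iff complex_norm_square mult.commute del: of_real_power)
  qed
  have wm: "?w n \<in> borel_measurable circ" for n
  proof (rule borel_measurable_times)
    show "(\<lambda>\<theta>. cnj (a n) * of_real (r ^ n)) \<in> borel_measurable circ" by simp
    show "(\<lambda>\<theta>. cnj (cis (real n * \<theta>)) * F \<theta>) \<in> borel_measurable circ"
      by (intro borel_measurable_times borel_measurable_integrable[OF Fint] measurable_circ continuous_intros)
  qed
  have wb: "cmod (?w n \<theta>) \<le> cmod (a n) * r ^ n * K" for n \<theta>
    using r Fb[of \<theta>] by (simp add: norm_mult norm_power mult_left_mono)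
  have wsum: "summable (\<lambda>n. cmod (a n) * r ^ n * K)" by (intro summable_mult2 s)
  have I: "integrable circ (\<lambda>\<theta>. complex_of_real ((cmod (F \<theta>))\<^sup>2))"
    unfolding Fw by (rule integral_series(1)[OF wm wb wsum])
  then show "integrable circ (\<lambda>\<theta>. (cmod (pw a (of_real r * cis \<theta>)))\<^sup>2)"
    unfolding F_def[symmetric] using complex_of_real_integrable_eq by blast
  have "(\<lambda>n. integral\<^sup>L circ (?w n)) sums integral\<^sup>L circ (\<lambda>\<theta>. complex_of_real ((cmod (F \<theta>))\<^sup>2))"
    unfolding Fw by (rule integral_series(2)[OF wm wb wsum])
  moreover have "integral\<^sup>L circ (?w n) = of_real (2 * pi * ((cmod (a n))\<^sup>2 * r ^ (2 * n)))" for n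
  proof -
    have "integral\<^sup>L circ (?w n) = (cnj (a n) * of_real (r ^ n)) * (2 * pi * a n * of_real (r ^ n))"
      by (subst integral_mult_right_zero) (simp only: cisI)
    also have "\<dots> = of_real (2 * pi) * (a n * cnj (a n)) * of_real (r ^ n * r ^ n)"
      by (simp add: mult_ac)
    also have "\<dots> = of_real (2 * pi * ((cmod (a n))\<^sup>2 * r ^ (2 * n)))"
      by (simp only: complex_norm_square[symmetric] power_add[symmetric] mult_2[symmetric] of_real_mult mult.assoc)
    finally show ?thesis .
  qed
  moreover have "integral\<^sup>L circ (\<lambda>\<theta>. complex_of_real ((cmod (F \<theta>))\<^sup>2)) = of_real (integral\<^sup>L circ (\<lambda>\<theta>. (cmod (F \<theta>))\<^sup>2))"
    by (rule integral_complex_of_real)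
  ultimately have "(\<lambda>n. 2 * pi * ((cmod (a n))\<^sup>2 * r ^ (2 * n))) sums integral\<^sup>L circ (\<lambda>\<theta>. (cmod (F \<theta>))\<^sup>2)"
    by (simp only: sums_of_real_iff)
  from sums_divide[OF this, of "2 * pi"]
  show "(\<lambda>n. (cmod (a n))\<^sup>2 * r ^ (2 * n)) sums ((\<integral>\<theta>. (cmod (pw a (of_real r * cis \<theta>)))\<^sup>2 \<partial>circ) / (2 * pi))"
    by (simp add: F_def)
qed

text \<open>\<open>M2\<close> is written with the Henstock-Kurzweil integral; integrability on the
  circle identifies it with the Lebesgue integral of \<open>circle_parseval\<close>.\<close>

lemma M2_eq:
  assumes a: "a \<in> pconv" and r: "0 \<le> r" "r < 1" and f: "\<And>z. z \<in> ball 0 1 \<Longrightarrow> f z = pw a z"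
  shows "summable (\<lambda>n. (cmod (a n))\<^sup>2 * r ^ (2 * n))"
    and "M2 r f = sqrt (\<Sum>n. (cmod (a n))\<^sup>2 * r ^ (2 * n))"
proof -
  note P = circle_parseval[OF a r]
  show "summable (\<lambda>n. (cmod (a n))\<^sup>2 * r ^ (2 * n))" using P(2) by (simp add: sums_iff)
  let ?h = "\<lambda>\<theta>. (cmod (pw a (of_real r * cis \<theta>)))\<^sup>2"
  have "set_integrable lborel {-pi..pi} ?h"
    using P(1) by (simp add: set_integrable_def integrable_restrict_space)
  then have "integral {-pi..pi} ?h = (LINT \<theta>:{-pi..pi}|lborel. ?h \<theta>)"
    by (simp add: set_borel_integral_eq_integral)
  also have "\<dots> = integral\<^sup>L circ ?h"
    by (simp add: set_lebesgue_integral_def integral_restrict_space)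
  finally have "integral {-pi..pi} ?h = integral\<^sup>L circ ?h" .
  moreover have "integral {-pi..pi} (\<lambda>\<theta>. (cmod (f (of_real r * cis \<theta>)))\<^sup>2) = integral {-pi..pi} ?h"
    using r by (intro integral_cong) (simp add: f norm_mult)
  ultimately show "M2 r f = sqrt (\<Sum>n. (cmod (a n))\<^sup>2 * r ^ (2 * n))"
    using P(2) by (simp add: M2_def sums_iff)
qed

section \<open>The spaces B(2,p) in terms of dyadic blocks\<close>

text \<open>By Bernoulli the power \<open>2 ^ j\<close> of \<open>1 - (1 / 2) ^ Suc j\<close> is at
  least \<open>1 / 2\<close>, and the exponent \<open>2 * n\<close> is at most four times
  \<open>2 ^ j\<close>.\<close>

lemma power_blk_ge:
  fixes r :: real
  assumes r: "1 - (1 / 2) ^ Suc j \<le> r" "r \<le> 1" and n: "n \<in> blk j"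
  shows "1 / 16 \<le> r ^ (2 * n)"
proof -
  have r01: "0 \<le> r" "r \<le> 1" using r power_le_one[of "1 / 2 :: real" "Suc j"] by auto
  have "1 + real (2 ^ j) * (- ((1 / 2) ^ Suc j)) \<le> (1 + (- ((1 / 2) ^ Suc j))) ^ (2 ^ j)"
    using power_le_one[of "1 / 2 :: real" "Suc j"] by (intro Bernoulli_inequality) simp
  moreover have "real (2 ^ j) * (- ((1 / 2) ^ Suc j)) = - (1 / 2)" by (simp add: power_divide)
  ultimately have "1 / 2 \<le> (1 - (1 / 2) ^ Suc j :: real) ^ (2 ^ j)" by simp
  also have "\<dots> \<le> r ^ (2 ^ j)"
    using r power_le_one[of "1 / 2 :: real" "Suc j"] by (intro power_mono) (auto simp: layer_def)
  finally have "(1 / 2) ^ 4 \<le> (r ^ (2 ^ j)) ^ 4" by (intro power_mono) auto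
  also have "\<dots> = r ^ (2 ^ j * 4)" by (rule power_mult[symmetric])
  also have "\<dots> \<le> r ^ (2 * n)"
  proof (intro power_decreasing)
    show "2 * n \<le> 2 ^ j * 4" using n by (simp add: mem_blk)
  qed (use r01 in auto)
  finally show ?thesis by (simp add: power_divide)
qed

text \<open>From \<open>1 - x \<le> exp (- x)\<close> and \<open>n \<ge> 2 ^ j - 1\<close>; the
  missing unit costs at most the factor \<open>exp 1\<close>.\<close>

lemma layer_power_exp_le:
  assumes r: "r \<in> layer i" and n: "n \<in> blk j" and ij: "i \<le> j"
  shows "r ^ (2 * n) \<le> exp (1 - 2 ^ (j - i))"
proof -
  have r01: "0 \<le> r" "r < 1" using layer_bounds[OF r] by auto
  define x where "x = (2::real) ^ (j - i)"
  have xe: "2 ^ j = 2 ^ i * x" using ij by (simp add: x_def power_add[symmetric])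
  have "r \<le> 1 + - ((1 / 2) ^ Suc i)" using r by (simp add: layer_def)
  also have "\<dots> \<le> exp (- ((1 / 2) ^ Suc i))" by (rule exp_ge_add_one_self)
  finally have "r ^ (2 * n) \<le> exp (- ((1 / 2) ^ Suc i)) ^ (2 * n)" using r01 by (intro power_mono)
  also have "\<dots> = exp (- ((1 / 2) ^ i * real n))"
    by (simp add: exp_of_nat_mult[symmetric])
  also have "\<dots> \<le> exp (1 - x)"
  proof -
    have "2 ^ i * x - 1 \<le> real n" using real_mem_blk[OF n] xe by simp
    then have "(1 / 2) ^ i * (2 ^ i * x - 1) \<le> (1 / 2) ^ i * real n" by (intro mult_left_mono) auto
    moreover have "(1 / 2) ^ i * (2 ^ i * x - 1) = x - (1 / 2) ^ i"
      by (simp add: algebra_simps power_divide)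
    moreover have "(1 / 2 :: real) ^ i \<le> 1" by (simp add: power_le_one)
    ultimately show ?thesis by simp
  qed
  finally show ?thesis by (simp add: x_def)
qed

text \<open>For \<open>j > i\<close> and \<open>x = 2 ^ (j - i)\<close>, the bounds
  \<open>exp 1 \<le> 3\<close> and \<open>exp x \<ge> x ^ 2 / 2\<close> give
  \<open>6 / x ^ 2\<close>. One power of \<open>x\<close> compensates \<open>2 ^ j\<close> against
  \<open>2 ^ i\<close>, the other is the decay.\<close>

lemma layer_power_le:
  assumes r: "r \<in> layer i" and n: "n \<in> blk j"
  shows "2 ^ j * r ^ (2 * n) \<le> 6 * 2 ^ i * (1 / 2) ^ nd i j"
proof (cases "j \<le> i")
  case True
  have r01: "0 \<le> r" "r < 1" using layer_bounds[OF r] by auto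
  have "2 ^ j * r ^ (2 * n) \<le> 2 ^ j * 1" using r01 by (intro mult_left_mono power_le_one) auto
  also have "\<dots> = 2 ^ i * (1 / 2) ^ nd i j"
    using True by (simp add: nd_def power_diff power_divide)
  also have "\<dots> \<le> 6 * 2 ^ i * (1 / 2) ^ nd i j" by simp
  finally show ?thesis .
next
  case False
  have r01: "0 \<le> r" "r < 1" using layer_bounds[OF r] by auto
  define x where "x = (2::real) ^ (j - i)"
  have x: "0 < x" by (simp add: x_def)
  have xe: "2 ^ j = 2 ^ i * x" using False by (simp add: x_def power_add[symmetric])
  have "r ^ (2 * n) \<le> exp (1 - x)"
    using layer_power_exp_le[OF r n] False by (simp add: x_def)
  also have "\<dots> = exp 1 * exp (- x)" by (simp add: exp_add[symmetric])
  also have "\<dots> \<le> 3 * (2 / x\<^sup>2)"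
  proof (intro mult_mono)
    have "x\<^sup>2 / 2 \<le> exp x" using exp_lower_Taylor_quadratic[of x] x by linarith
    then show "exp (- x) \<le> 2 / x\<^sup>2" using x by (simp add: exp_minus field_simps)
  qed (use exp_le in auto)
  finally have "2 ^ j * r ^ (2 * n) \<le> 2 ^ j * (3 * (2 / x\<^sup>2))" by (intro mult_left_mono) auto
  also have "\<dots> = 6 * 2 ^ i * (1 / x)" using x by (simp add: xe power2_eq_square)
  also have "1 / x = (1 / 2) ^ nd i j" using False by (simp add: x_def nd_def power_divide)
  finally show ?thesis .
qed

text \<open>Shows the integrand of the gauge as a power of \<open>M2 r f * sqrt (1 - r)\<close>
  against \<open>dr / (1 - r)\<close>, a measure for which all layers have the same mass.\<close>

lemma powr_split:
  assumes "0 \<le> x" "0 < y" "0 < q"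
  shows "x powr q * y powr (q / 2 - 1) = (x * sqrt y) powr q / (y::real)"
proof -
  have "(x * sqrt y) powr q = x powr q * y powr (q / 2)"
    using assms by (simp add: powr_mult powr_half_sqrt[symmetric] powr_powr)
  then show ?thesis using assms by (simp add: powr_diff)
qed

locale disc_coeffs =
  fixes b :: "nat \<Rightarrow> complex" and f :: "complex \<Rightarrow> complex"
  assumes b: "b \<in> pconv" and f: "\<And>z. z \<in> ball 0 1 \<Longrightarrow> f z = pw b z"
begin

lemma M2_sums:
  assumes "0 \<le> r" "r < 1"
  shows "summable (\<lambda>n. (cmod (b n))\<^sup>2 * r ^ (2 * n))" "(M2 r f)\<^sup>2 = (\<Sum>n. (cmod (b n))\<^sup>2 * r ^ (2 * n))" "0 \<le> M2 r f"
proof -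
  have M: "M2 r f = sqrt (\<Sum>n. (cmod (b n))\<^sup>2 * r ^ (2 * n))" by (rule M2_eq(2)[OF b assms]) (rule f)
  show s: "summable (\<lambda>n. (cmod (b n))\<^sup>2 * r ^ (2 * n))" by (rule M2_eq(1)[OF b assms]) (rule f)
  have "0 \<le> (\<Sum>n. (cmod (b n))\<^sup>2 * r ^ (2 * n))" using s assms by (intro suminf_nonneg) auto
  then show "(M2 r f)\<^sup>2 = (\<Sum>n. (cmod (b n))\<^sup>2 * r ^ (2 * n))" "0 \<le> M2 r f" by (simp_all add: M)
qed

text \<open>The layer lies one step further out than the block because \<open>power_blk_ge\<close>
  needs \<open>r \<ge> 1 - (1 / 2) ^ Suc j\<close>; its constant \<open>1 / 16\<close> becomes
  \<open>1 / 4\<close> under the root.\<close>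

lemma M2_lower:
  assumes r: "r \<in> layer (Suc j)"
  shows "sqrt (2 ^ j) * dyad b j / 4 \<le> M2 r f"
proof (rule power2_le_imp_le)
  have r01: "0 \<le> r" "r < 1" using layer_bounds[OF r] by auto
  have "(sqrt (2 ^ j) * dyad b j / 4)\<^sup>2 = 2 ^ j * (dyad b j)\<^sup>2 / 16" by (simp add: power_mult_distrib power_divide)
  also have "\<dots> = (\<Sum>n\<in>blk j. (cmod (b n))\<^sup>2 * (1 / 16))"
    unfolding dyad_sq by (simp add: sum_divide_distrib)
  also have "\<dots> \<le> (\<Sum>n\<in>blk j. (cmod (b n))\<^sup>2 * r ^ (2 * n))"
    using r r01 by (intro sum_mono mult_left_mono power_blk_ge) (auto simp: layer_def)
  also have "\<dots> \<le> (\<Sum>n. (cmod (b n))\<^sup>2 * r ^ (2 * n))"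
    using r01 by (intro sum_le_suminf M2_sums) auto
  also have "\<dots> = (M2 r f)\<^sup>2" using M2_sums(2)[OF r01] by simp
  finally show "(sqrt (2 ^ j) * dyad b j / 4)\<^sup>2 \<le> (M2 r f)\<^sup>2" .
  show "0 \<le> M2 r f" by (rule M2_sums(3)[OF r01])
qed

lemma M2_upper:
  assumes r: "r \<in> layer i" and S: "\<And>J. (\<Sum>j<J. (1 / 2) ^ nd i j * (dyad b j)\<^sup>2) \<le> S"
  shows "(M2 r f)\<^sup>2 * (1 - r) \<le> 6 * S"
proof -
  have r01: "0 \<le> r" "r < 1" using layer_bounds[OF r] by auto
  have "(\<Sum>n. (cmod (b n))\<^sup>2 * r ^ (2 * n)) \<le> 6 * 2 ^ i * S"
  proof (rule suminf_le_const[OF M2_sums(1)[OF r01]])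
    fix m
    have "m \<le> 2 ^ m - 1" using less_exp[of m] by linarith
    then have "(\<Sum>n<m. (cmod (b n))\<^sup>2 * r ^ (2 * n)) \<le> (\<Sum>n<2 ^ m - 1. (cmod (b n))\<^sup>2 * r ^ (2 * n))"
      using r01 by (intro sum_mono2) auto
    also have "\<dots> = (\<Sum>j<m. \<Sum>n\<in>blk j. (cmod (b n))\<^sup>2 * r ^ (2 * n))" by (rule sum_blk)
    also have "\<dots> \<le> (\<Sum>j<m. 6 * 2 ^ i * ((1 / 2) ^ nd i j * (dyad b j)\<^sup>2))"
    proof (rule sum_mono)
      fix j
      have "(\<Sum>n\<in>blk j. (cmod (b n))\<^sup>2 * r ^ (2 * n)) \<le> (\<Sum>n\<in>blk j. (cmod (b n))\<^sup>2 * (6 * 2 ^ i * (1 / 2) ^ nd i j / 2 ^ j))"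
        using layer_power_le[OF r] by (intro sum_mono mult_left_mono) (auto simp: pos_le_divide_eq mult.commute)
      also have "\<dots> = 2 ^ j * (dyad b j)\<^sup>2 * (6 * 2 ^ i * (1 / 2) ^ nd i j / 2 ^ j)"
        unfolding dyad_sq sum_distrib_right ..
      also have "\<dots> = 6 * 2 ^ i * ((1 / 2) ^ nd i j * (dyad b j)\<^sup>2)" by simp
      finally show "(\<Sum>n\<in>blk j. (cmod (b n))\<^sup>2 * r ^ (2 * n)) \<le> 6 * 2 ^ i * ((1 / 2) ^ nd i j * (dyad b j)\<^sup>2)" .
    qed
    also have "\<dots> = 6 * 2 ^ i * (\<Sum>j<m. (1 / 2) ^ nd i j * (dyad b j)\<^sup>2)" by (simp only: sum_distrib_left)
    also have "\<dots> \<le> 6 * 2 ^ i * S" by (intro mult_left_mono S) auto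
    finally show "(\<Sum>n<m. (cmod (b n))\<^sup>2 * r ^ (2 * n)) \<le> 6 * 2 ^ i * S" .
  qed
  then have "(M2 r f)\<^sup>2 * (1 - r) \<le> (6 * 2 ^ i * S) * (1 / 2) ^ i"
    unfolding M2_sums(2)[OF r01]
  proof (rule mult_mono)
    show "1 - r \<le> (1 / 2) ^ i" using r by (simp add: mem_layer)
    show "0 \<le> 6 * 2 ^ i * S" using S[of 0] by simp
  qed (use r01 in auto)
  then show ?thesis by (simp add: power_divide)
qed

lemma M2_sup_finite_iff:
  "(SUP r\<in>{0<..<1}. ennreal (M2 r f * (1 - r) powr (1 / 2))) < \<infinity> \<longleftrightarrow> (\<exists>C. \<forall>j. dyad b j \<le> C)"
    (is "?S < \<infinity> \<longleftrightarrow> _")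
proof
  assume "?S < \<infinity>"
  then obtain C where C: "0 \<le> C" "?S = ennreal C" by (cases ?S) auto
  have "dyad b j \<le> 4 * sqrt 2 * C" for j
  proof -
    define r :: real where "r = 1 - (1 / 2) ^ Suc j"
    have "(1 / 2 :: real) ^ Suc j \<le> 1 / 2" by (simp add: power_le_one)
    then have r: "r \<in> {0<..<1}" "r \<in> layer (Suc j)" by (auto simp: r_def layer_def)
    have "ennreal (M2 r f * (1 - r) powr (1 / 2)) \<le> ?S" by (rule SUP_upper[OF r(1)])
    then have "M2 r f * sqrt (1 - r) \<le> C" using C r by (simp add: powr_half_sqrt)
    moreover have "sqrt (2 ^ j) * dyad b j / 4 * sqrt (1 - r) \<le> M2 r f * sqrt (1 - r)"
      using r by (intro mult_right_mono M2_lower) auto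
    moreover have "sqrt (2 ^ j) * sqrt (1 - r) = 1 / sqrt 2"
      by (simp add: r_def real_sqrt_mult[symmetric] power_divide) (simp add: real_sqrt_divide)
    then have "sqrt (2 ^ j) * dyad b j / 4 * sqrt (1 - r) = dyad b j / (4 * sqrt 2)"
      by (metis (no_types, opaque_lifting) mult.commute mult.left_commute mult.right_neutral times_divide_eq_right divide_divide_eq_left)
    ultimately have "dyad b j / (4 * sqrt 2) \<le> C" by linarith
    then show ?thesis by (simp add: divide_le_eq mult.commute)
  qed
  then show "\<exists>C. \<forall>j. dyad b j \<le> C" by blast
next
  assume "\<exists>C. \<forall>j. dyad b j \<le> C"
  then obtain C where C: "\<And>j. dyad b j \<le> C" by blast
  have C0: "0 \<le> C" using C[of 0] dyad_nonneg[of b 0] by linarith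
  \<comment> \<open>The 5 comes from \<open>6 * 4 \<le> 5 ^ 2\<close>.\<close>
  have "?S \<le> ennreal (5 * C)"
  proof (rule SUP_least)
    fix r :: real assume r: "r \<in> {0<..<1}"
    obtain i where i: "r \<in> layer i" using ex_layer[of r] r by auto
    have "(M2 r f)\<^sup>2 * (1 - r) \<le> 6 * (4 * C\<^sup>2)"
    proof (rule M2_upper[OF i])
      fix J
      have "(\<Sum>j<J. (1 / 2) ^ nd i j * (dyad b j)\<^sup>2) \<le> (\<Sum>j<J. (1 / 2) ^ nd j i * C\<^sup>2)"
        using C dyad_nonneg by (intro sum_mono mult_mono power_mono) (auto simp: nd_commute)
      also have "\<dots> = (\<Sum>j<J. (1 / 2) ^ nd j i) * C\<^sup>2" by (simp only: sum_distrib_right)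
      also have "\<dots> \<le> 4 * C\<^sup>2"
        using sum_nd_le[of "1 / 2" "{..<J}" 0 i] by (intro mult_right_mono) auto
      finally show "(\<Sum>j<J. (1 / 2) ^ nd i j * (dyad b j)\<^sup>2) \<le> 4 * C\<^sup>2" .
    qed
    then have "(M2 r f * sqrt (1 - r))\<^sup>2 \<le> (5 * C)\<^sup>2" using r by (simp add: power_mult_distrib)
        (smt (verit) zero_le_power2)
    then have "M2 r f * sqrt (1 - r) \<le> 5 * C" by (rule power2_le_imp_le) (use C0 in simp)
    then show "ennreal (M2 r f * (1 - r) powr (1 / 2)) \<le> ennreal (5 * C)"
      using r by (simp add: powr_half_sqrt ennreal_leI)
  qed
  then show "?S < \<infinity>" using le_less_trans by fastforce
qed

lemma M2_integral_finite_iff: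
  assumes q: "0 < q"
  shows "(\<integral>\<^sup>+ r\<in>{0<..<1}. ennreal (M2 r f powr q * (1 - r) powr (q / 2 - 1)) \<partial>lebesgue) < \<infinity>
    \<longleftrightarrow> summable (\<lambda>j. dyad b j powr q)" (is "?I < \<infinity> \<longleftrightarrow> _")
proof
  assume "?I < \<infinity>"
  then obtain C where C: "0 \<le> C" "?I = ennreal C" by (cases ?I) auto
  show "summable (\<lambda>j. dyad b j powr q)"
  proof (rule bounded_imp_summable)
    show "0 \<le> dyad b j powr q" for j by simp
    fix J
    \<comment> \<open>The 8 combines the 4 of \<open>M2_lower\<close> with the root of
      \<open>2 ^ j * (1 / 2) ^ (j + 2)\<close>, which is \<open>1 / 2\<close>; the index
      \<open>k - 1\<close> undoes the shift between layer and block.\<close>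
    let ?C = "\<lambda>k. (dyad b (k - 1) / 8) powr q * 2 ^ k"
    have "ennreal (\<Sum>k\<in>Suc ` {..J}. ?C k * (1 / 2) ^ Suc k) \<le> ?I"
    proof (rule nn_integral_layers_ge)
      fix k r assume "k \<in> Suc ` {..J}" and r: "r \<in> layer k"
      then obtain j where k: "k = Suc j" by auto
      have y: "(1 / 2) ^ Suc (Suc j) < 1 - r" "1 - r \<le> (1 / 2) ^ Suc j" "0 < 1 - r"
        using r layer_bounds[OF r] by (auto simp: mem_layer k)
      have "1 - (1 / 2) ^ Suc j \<ge> (1 / 2 :: real)" by (simp add: power_le_one)
      then have r01: "r \<in> {0<..<1}" using y by auto
      have M0: "0 \<le> M2 r f" using r01 by (intro M2_sums) auto
      have "dyad b j / 8 = (sqrt (2 ^ j) * dyad b j / 4) * sqrt ((1 / 2) ^ Suc (Suc j))"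
        by (simp add: real_sqrt_mult real_sqrt_divide power_divide)
      also have "\<dots> \<le> M2 r f * sqrt (1 - r)"
        using r y M0 dyad_nonneg[of b j] by (intro mult_mono M2_lower) (auto simp: k)
      finally have "(dyad b j / 8) powr q \<le> (M2 r f * sqrt (1 - r)) powr q"
        using q dyad_nonneg[of b j] by (intro powr_mono2) auto
      then have "(dyad b j / 8) powr q * (1 / (1 / 2) ^ Suc j) \<le> (M2 r f * sqrt (1 - r)) powr q * (1 / (1 - r))"
        using y by (intro mult_mono divide_left_mono mult_pos_pos) auto
      also have "\<dots> = M2 r f powr q * (1 - r) powr (q / 2 - 1)"
        using powr_split[OF M0 y(3) q] by simp
      finally have "?C k \<le> M2 r f powr q * (1 - r) powr (q / 2 - 1)"
        by (simp add: k power_divide)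
      then show "ennreal (?C k) \<le> ennreal (M2 r f powr q * (1 - r) powr (q / 2 - 1)) * indicator {0<..<1} r"
        using r01 by (simp add: ennreal_leI)
    qed auto
    moreover have "(\<Sum>k\<in>Suc ` {..J}. ?C k * (1 / 2) ^ Suc k) = (\<Sum>j\<le>J. dyad b j powr q * ((1 / 8) powr q / 2))"
      by (subst sum.reindex) (auto intro!: sum.cong simp: powr_divide power_divide dyad_nonneg)
    ultimately have "(\<Sum>j\<le>J. dyad b j powr q) * ((1 / 8) powr q / 2) \<le> C"
      using C unfolding sum_distrib_right by simp
    then show "(\<Sum>j\<le>J. dyad b j powr q) \<le> C / ((1 / 8) powr q / 2)"
      by (subst pos_le_divide_eq) auto
  qed
next
  assume s: "summable (\<lambda>j. dyad b j powr q)"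
  \<comment> \<open>The square of \<open>3 / 4\<close> still exceeds \<open>1 / 2\<close>, so the
    decay can be split into a factor for the supremum and a factor for the summation.\<close>
  define \<kappa> where "\<kappa> = (3 / 4 :: real) powr (q / 2)"
  have \<kappa>: "0 < \<kappa>" "\<kappa> < 1" using q powr_less_mono2[of "q / 2" "3 / 4" 1] by (auto simp: \<kappa>_def)
  have \<kappa>p: "((3 / 4) ^ n) powr (q / 2) = \<kappa> ^ n" for n
    by (simp add: \<kappa>_def powr_realpow[symmetric] powr_powr mult.commute)
  \<comment> \<open>Bounding the supremum over \<open>j\<close> by the sum \<open>Z\<close> of \<open>q / 2\<close>-th powers replaces the
    triangle inequality of the \<open>q\<close>-norm.\<close>
  define Z where "Z i = (\<Sum>j. \<kappa> ^ nd i j * dyad b j powr q)" for i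
  have Zs: "summable (\<lambda>j. \<kappa> ^ nd i j * dyad b j powr q)" for i
    by (rule summable_comparison_test'[OF s]) (use \<kappa> in \<open>auto intro!: mult_left_le_one_le power_le_one\<close>)
  have Z0: "0 \<le> Z i" for i unfolding Z_def using \<kappa> by (intro suminf_nonneg Zs) auto
  have Zsum: "summable Z"
  proof (rule bounded_imp_summable[OF Z0])
    fix I
    have "(\<Sum>i\<le>I. Z i) = (\<Sum>j. \<Sum>i\<le>I. \<kappa> ^ nd i j * dyad b j powr q)"
      unfolding Z_def by (rule suminf_sum[symmetric]) (rule Zs)
    also have "\<dots> \<le> (\<Sum>j. 2 / (1 - \<kappa>) * dyad b j powr q)"
    proof (intro suminf_le summable_sum Zs summable_mult s)
      fix j
      have "(\<Sum>i\<le>I. \<kappa> ^ nd i j * dyad b j powr q) = (\<Sum>i\<le>I. \<kappa> ^ nd i j) * dyad b j powr q"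
        by (simp only: sum_distrib_right)
      also have "\<dots> \<le> 2 / (1 - \<kappa>) * dyad b j powr q"
        using sum_nd_le[of \<kappa> "{..I}" 0 j] \<kappa> by (intro mult_right_mono) auto
      finally show "(\<Sum>i\<le>I. \<kappa> ^ nd i j * dyad b j powr q) \<le> 2 / (1 - \<kappa>) * dyad b j powr q" .
    qed
    finally show "(\<Sum>i\<le>I. Z i) \<le> (\<Sum>j. 2 / (1 - \<kappa>) * dyad b j powr q)" .
  qed
  \<comment> \<open>The 7 comes from \<open>6 * 8 \<le> 7 ^ 2\<close>; the power of 2 bounds
    \<open>1 / (1 - r)\<close> on layer \<open>i\<close>.\<close>
  let ?C = "\<lambda>i. 7 powr q * Z i * 2 ^ Suc i"
  show "?I < \<infinity>"
  proof (rule nn_integral_layers_le[of ?C])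
    show "0 \<le> ?C i" for i using Z0 by simp
    show "summable (\<lambda>i. ?C i * (1 / 2) ^ Suc i)"
      using summable_mult[OF Zsum, of "7 powr q"] by (simp add: power_divide)
    fix i r assume r: "r \<in> layer i"
    have y: "(1 / 2) ^ Suc i < 1 - r" "0 < 1 - r" "0 \<le> r" "r < 1"
      using r layer_bounds[OF r] by (auto simp: mem_layer)
    have M0: "0 \<le> M2 r f" by (rule M2_sums(3)[OF y(3,4)])
    define W where "W = Z i powr (2 / q)"
    have W: "(3 / 4) ^ nd i j * (dyad b j)\<^sup>2 \<le> W" for j
    proof -
      have "((3 / 4) ^ nd i j * (dyad b j)\<^sup>2) powr (q / 2) = \<kappa> ^ nd i j * dyad b j powr q"
      proof (cases "dyad b j = 0")
        case False
        then have "(dyad b j)\<^sup>2 = dyad b j powr 2" using dyad_nonneg[of b j] by simp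
        then show ?thesis by (simp only: powr_mult \<kappa>p powr_powr) simp
      qed simp
      also have "\<dots> = (\<Sum>j\<in>{j}. \<kappa> ^ nd i j * dyad b j powr q)" by simp
      also have "\<dots> \<le> Z i" unfolding Z_def using \<kappa> by (intro sum_le_suminf Zs) auto
      finally have "(((3 / 4) ^ nd i j * (dyad b j)\<^sup>2) powr (q / 2)) powr (2 / q) \<le> Z i powr (2 / q)"
        using q by (intro powr_mono2) auto
      then show ?thesis using q by (simp add: powr_powr W_def)
    qed
    have M48: "(M2 r f)\<^sup>2 * (1 - r) \<le> 6 * (8 * W)"
    proof (rule M2_upper[OF r])
      fix J
      have "(\<Sum>j<J. (1 / 2) ^ nd i j * (dyad b j)\<^sup>2) \<le> (\<Sum>j<J. (3 / 4) ^ nd j i * W)"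
      proof (rule sum_mono)
        fix j
        have "(1 / 2 :: real) ^ nd i j \<le> (3 / 4 * (3 / 4)) ^ nd i j" by (intro power_mono) auto
        then have "(1 / 2) ^ nd i j * (dyad b j)\<^sup>2 \<le> (3 / 4 * (3 / 4)) ^ nd i j * (dyad b j)\<^sup>2" by (intro mult_right_mono) auto
        also have "\<dots> = (3 / 4) ^ nd i j * ((3 / 4) ^ nd i j * (dyad b j)\<^sup>2)" by (simp only: power_mult_distrib mult.assoc)
        also have "\<dots> \<le> (3 / 4) ^ nd i j * W" by (intro mult_left_mono W) auto
        finally show "(1 / 2) ^ nd i j * (dyad b j)\<^sup>2 \<le> (3 / 4) ^ nd j i * W" by (simp only: nd_commute)
      qed
      also have "\<dots> = (\<Sum>j<J. (3 / 4) ^ nd j i) * W" by (simp only: sum_distrib_right)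
      also have "\<dots> \<le> 8 * W"
        using sum_nd_le[of "3 / 4" "{..<J}" 0 i] by (intro mult_right_mono) (auto simp: W_def)
      finally show "(\<Sum>j<J. (1 / 2) ^ nd i j * (dyad b j)\<^sup>2) \<le> 8 * W" .
    qed
    have W0: "0 \<le> W" by (simp add: W_def)
    have Z2: "(Z i powr (1 / q))\<^sup>2 = W" by (simp add: W_def power2_eq_square powr_add[symmetric])
    have "(M2 r f * sqrt (1 - r))\<^sup>2 = (M2 r f)\<^sup>2 * (1 - r)" using y by (simp add: power_mult_distrib)
    also have "\<dots> \<le> 7\<^sup>2 * W" using M48 W0 by simp
    also have "\<dots> = (7 * Z i powr (1 / q))\<^sup>2" by (simp only: power_mult_distrib Z2)
    finally have "(M2 r f * sqrt (1 - r))\<^sup>2 \<le> (7 * Z i powr (1 / q))\<^sup>2" .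
    then have "M2 r f * sqrt (1 - r) \<le> 7 * Z i powr (1 / q)" by (rule power2_le_imp_le) simp
    then have "(M2 r f * sqrt (1 - r)) powr q \<le> (7 * Z i powr (1 / q)) powr q"
      using q M0 y by (intro powr_mono2) auto
    also have "\<dots> = 7 powr q * Z i" using q Z0[of i] by (simp add: powr_mult powr_powr)
    finally have "(M2 r f * sqrt (1 - r)) powr q * (1 / (1 - r)) \<le> 7 powr q * Z i * (1 / (1 / 2) ^ Suc i)"
      using y Z0[of i] by (intro mult_mono divide_left_mono mult_pos_pos) auto
    then have "M2 r f powr q * (1 - r) powr (q / 2 - 1) \<le> ?C i"
      using powr_split[OF M0 y(2) q] by (simp add: power_divide)
    then show "ennreal (M2 r f powr q * (1 - r) powr (q / 2 - 1)) * indicator {0<..<1} r \<le> ennreal (?C i)"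
      by (auto simp: indicator_def intro: ennreal_leI)
  qed auto
qed

end

lemma B2_iff:
  assumes g: "g holomorphic_on ball 0 1" and b: "b \<in> pconv"
    and dg: "\<And>z. z \<in> ball 0 1 \<Longrightarrow> deriv g z = pw b z"
  shows "g \<in> B2 \<infinity> \<longleftrightarrow> (\<exists>C. \<forall>j. dyad b j \<le> C)"
    and "p \<noteq> \<infinity> \<Longrightarrow> 0 < enn2real p \<Longrightarrow> g \<in> B2 p \<longleftrightarrow> summable (\<lambda>j. dyad b j powr enn2real p)"
proof -
  interpret disc_coeffs b "deriv g" using b dg by unfold_locales auto
  show "g \<in> B2 \<infinity> \<longleftrightarrow> (\<exists>C. \<forall>j. dyad b j \<le> C)"
    using g M2_sup_finite_iff by (simp add: B2_def B2_gauge_def ennreal_add_less_top)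
  assume "p \<noteq> \<infinity>" "0 < enn2real p"
  then show "g \<in> B2 p \<longleftrightarrow> summable (\<lambda>j. dyad b j powr enn2real p)"
    using g M2_integral_finite_iff[of "enn2real p"] by (simp add: B2_def B2_gauge_def ennreal_add_less_top)
qed

section \<open>Radial measurable functions\<close>

lemma ball_borel_measurable [measurable]: "ball (x :: complex) r \<in> sets borel"
  by simp

section \<open>Rotation invariance and polar coordinates\<close>

lemma nn_integral_lborel_translate:
  fixes h :: "'a::euclidean_space \<Rightarrow> ennreal"
  assumes [measurable]: "h \<in> borel_measurable borel"
  shows "(\<integral>\<^sup>+ x. h (c + x) \<partial>lborel) = (\<integral>\<^sup>+ x. h x \<partial>lborel)"
proof -
  have "(\<integral>\<^sup>+ x. h x \<partial>lborel) = (\<integral>\<^sup>+ x. h x \<partial>distr lborel borel ((+) c))" by (simp add: lborel_distr_plus)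
  also have "\<dots> = (\<integral>\<^sup>+ x. h (c + x) \<partial>lborel)" by (subst nn_integral_distr) auto
  finally show ?thesis by simp
qed

lemma emeasure_ball_complex: "0 \<le> r \<Longrightarrow> emeasure lborel (ball (c :: complex) r) = ennreal (pi * r\<^sup>2)"
  by (simp add: emeasure_ball unit_ball_vol_2)

text \<open>A rotated copy of the Lebesgue measure is translation invariant, hence, by Fubini, a
  multiple of the Lebesgue measure; the unit disc determines the factor.\<close>

lemma emeasure_lborel_rotate:
  fixes c :: complex
  assumes c: "cmod c = 1" and A [measurable]: "A \<in> sets borel"
  shows "emeasure lborel ((\<lambda>z. c * z) -` A) = emeasure lborel A"
proof -
  have cc: "cnj c * c = 1" "c * cnj c = 1" using c by (simp_all add: complex_norm_square[symmetric] mult.commute)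
  let ?B = "ball 0 1 :: complex set"
  let ?i = "\<lambda>S z. indicator S z :: ennreal"
  have [measurable]: "?B \<in> sets borel" by simp
  have "emeasure lborel ((\<lambda>z. c * z) -` A) * emeasure lborel ?B
      = (\<integral>\<^sup>+ y. ?i ?B y * (\<integral>\<^sup>+ x. ?i A (c * x) \<partial>lborel) \<partial>lborel)"
  proof -
    have "(\<lambda>z. c * z) -` A \<in> sets borel" using measurable_sets[of "\<lambda>z. c * z" borel borel A] by simp
    then have "(\<integral>\<^sup>+ x. ?i ((\<lambda>z. c * z) -` A) x \<partial>lborel) = emeasure lborel ((\<lambda>z. c * z) -` A)"
      by (intro nn_integral_indicator) simp
    then have "(\<integral>\<^sup>+ x. ?i A (c * x) \<partial>lborel) = emeasure lborel ((\<lambda>z. c * z) -` A)"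
      by (simp only: indicator_vimage)
    then show ?thesis by (simp add: nn_integral_multc mult.commute)
  qed
  \<comment> \<open>For fixed \<open>y\<close>, translating \<open>x\<close> by
    \<open>cnj c * y\<close> turns \<open>c * x\<close> into \<open>y + c * x\<close>. With both
    variables in one argument, Fubini allows the shift to be moved onto the disc.\<close>
  also have "\<dots> = (\<integral>\<^sup>+ y. (\<integral>\<^sup>+ x. ?i ?B y * ?i A (y + c * x) \<partial>lborel) \<partial>lborel)"
  proof (rule nn_integral_cong)
    fix y :: complex
    have "(\<integral>\<^sup>+ x. ?i A (c * x) \<partial>lborel) = (\<integral>\<^sup>+ x. ?i A (c * (cnj c * y + x)) \<partial>lborel)"
      by (rule nn_integral_lborel_translate[symmetric]) measurable
    also have "\<dots> = (\<integral>\<^sup>+ x. ?i A (y + c * x) \<partial>lborel)"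
      by (simp add: distrib_left mult.assoc[symmetric] cc)
    finally show "?i ?B y * (\<integral>\<^sup>+ x. ?i A (c * x) \<partial>lborel) = (\<integral>\<^sup>+ x. ?i ?B y * ?i A (y + c * x) \<partial>lborel)"
      by (simp add: nn_integral_cmult)
  qed
  also have "\<dots> = (\<integral>\<^sup>+ x. (\<integral>\<^sup>+ y. ?i ?B y * ?i A (y + c * x) \<partial>lborel) \<partial>lborel)"
    by (rule lborel_pair.Fubini') measurable
  also have "\<dots> = (\<integral>\<^sup>+ x. (\<integral>\<^sup>+ y. ?i ?B (y - c * x) * ?i A y \<partial>lborel) \<partial>lborel)"
  proof (rule nn_integral_cong)
    fix x :: complex
    have "(\<integral>\<^sup>+ y. ?i ?B y * ?i A (y + c * x) \<partial>lborel) = (\<integral>\<^sup>+ y. ?i ?B (- (c * x) + y) * ?i A (- (c * x) + y + c * x) \<partial>lborel)"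
      by (rule nn_integral_lborel_translate[symmetric]) measurable
    then show "(\<integral>\<^sup>+ y. ?i ?B y * ?i A (y + c * x) \<partial>lborel) = (\<integral>\<^sup>+ y. ?i ?B (y - c * x) * ?i A y \<partial>lborel)"
      by simp
  qed
  also have "\<dots> = (\<integral>\<^sup>+ y. (\<integral>\<^sup>+ x. ?i ?B (y - c * x) * ?i A y \<partial>lborel) \<partial>lborel)"
    by (rule lborel_pair.Fubini') measurable
  also have "\<dots> = (\<integral>\<^sup>+ y. emeasure lborel ?B * ?i A y \<partial>lborel)"
  proof (rule nn_integral_cong)
    fix y :: complex
    have "cmod (y - c * x) = cmod (cnj c * y - x)" for x
    proof -
      have "cnj c * (y - c * x) = cnj c * y - x" by (simp add: right_diff_distrib mult.assoc[symmetric] cc)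
      then have "cmod (cnj c * y - x) = cmod (cnj c) * cmod (y - c * x)" by (metis norm_mult)
      then show ?thesis using c by simp
    qed
    then have "y - c * x \<in> ?B \<longleftrightarrow> x \<in> ball (cnj c * y) 1" for x
      by (simp only: mem_ball dist_norm diff_0 norm_minus_cancel)
    then have "?i ?B (y - c * x) = ?i (ball (cnj c * y) 1) x" for x
      by (simp only: indicator_def)
    then have "(\<integral>\<^sup>+ x. ?i ?B (y - c * x) \<partial>lborel) = emeasure lborel (ball (cnj c * y) 1)" by simp
    also have "\<dots> = emeasure lborel ?B" by (simp add: emeasure_ball_complex)
    finally show "(\<integral>\<^sup>+ x. ?i ?B (y - c * x) * ?i A y \<partial>lborel) = emeasure lborel ?B * ?i A y"
      by (simp add: nn_integral_multc)
  qed
  also have "\<dots> = emeasure lborel A * emeasure lborel ?B"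
    by (subst nn_integral_cmult_indicator) (auto simp: mult.commute)
  finally have "emeasure lborel ((\<lambda>z. c * z) -` A) * ennreal pi = emeasure lborel A * ennreal pi"
    by (simp add: emeasure_ball_complex)
  then have "emeasure lborel ((\<lambda>z. c * z) -` A) * ennreal pi / ennreal pi = emeasure lborel A * ennreal pi / ennreal pi"
    by (rule arg_cong)
  then show ?thesis by (simp add: ennreal_mult_divide_eq)
qed

lemma nn_integral_lborel_rotate:
  assumes c: "cmod c = 1" and h [measurable]: "h \<in> borel_measurable borel"
  shows "(\<integral>\<^sup>+ z. h (c * z) \<partial>lborel) = (\<integral>\<^sup>+ z. h z \<partial>lborel)"
proof -
  have "distr lborel borel (\<lambda>z. c * z) = lborel"
  proof (rule measure_eqI)
    fix A assume "A \<in> sets (distr lborel borel (\<lambda>z. c * z))"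
    then have A: "A \<in> sets borel" by simp
    have "emeasure (distr lborel borel (\<lambda>z. c * z)) A = emeasure lborel ((\<lambda>z. c * z) -` A)"
      using A by (subst emeasure_distr) auto
    then show "emeasure (distr lborel borel (\<lambda>z. c * z)) A = emeasure lborel A"
      using emeasure_lborel_rotate[OF c A] by simp
  qed simp
  then have "(\<integral>\<^sup>+ z. h z \<partial>lborel) = (\<integral>\<^sup>+ z. h z \<partial>distr lborel borel (\<lambda>z. c * z))" by simp
  also have "\<dots> = (\<integral>\<^sup>+ z. h (c * z) \<partial>lborel)" by (subst nn_integral_distr) auto
  finally show ?thesis by simp
qed

text \<open>The image of area under the modulus and the measure with density
  \<open>2 * pi * s\<close> give the same finite mass to every upper half-line, and such values
  determine a measure on the line.\<close>

lemma polar_nn_integral: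
  fixes h :: "real \<Rightarrow> ennreal"
  assumes h [measurable]: "h \<in> borel_measurable borel"
  shows "(\<integral>\<^sup>+ z. h (cmod z) * indicator (ball 0 1) z \<partial>lborel)
    = (\<integral>\<^sup>+ s. h s * (ennreal (2 * pi * s) * indicator {0<..<1} s) \<partial>lborel)"
proof -
  let ?M = "distr (restrict_space lborel (ball 0 1)) borel cmod"
  let ?g = "\<lambda>s. ennreal (2 * pi * s) * indicator {0<..<1} s"
  let ?N = "density lborel ?g"
  have [measurable]: "cmod \<in> borel_measurable (restrict_space lborel (ball 0 1))"
    by (intro measurable_restrict_space1) simp
  have M: "emeasure ?M {x<..} = ennreal (pi * (1 - (max 0 (min x 1))\<^sup>2))" for x
  proof -
    define y where "y = max 0 (min x 1)"
    have y: "0 \<le> y" "y \<le> 1" by (auto simp: y_def)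
    have "emeasure ?M {x<..} = emeasure lborel (ball 0 1 \<inter> {z. x < cmod z})"
      by (subst emeasure_distr) (auto simp: emeasure_restrict_space space_restrict_space intro!: arg_cong[where f = "emeasure lborel"])
    also have "\<dots> = emeasure lborel (ball 0 1 - (ball 0 1 \<inter> (if x < 0 then {} else cball 0 y)) :: complex set)"
      by (rule arg_cong[where f = "emeasure lborel"]) (auto simp: y_def intro: less_le_trans[OF _ norm_ge_zero])
    also have "\<dots> = emeasure lborel (ball 0 1 :: complex set) - emeasure lborel (ball 0 1 \<inter> (if x < 0 then {} else cball 0 y) :: complex set)"
    proof (rule emeasure_Diff)
      have "emeasure lborel (ball 0 1 \<inter> (if x < 0 then {} else cball 0 y) :: complex set) \<le> emeasure lborel (ball 0 1 :: complex set)"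
        by (intro emeasure_mono) auto
      also have "\<dots> < \<infinity>" by (simp add: emeasure_ball_complex)
      finally show "emeasure lborel (ball 0 1 \<inter> (if x < 0 then {} else cball 0 y) :: complex set) \<noteq> \<infinity>" by simp
    qed auto
    also have "emeasure lborel (ball 0 1 \<inter> (if x < 0 then {} else cball 0 y) :: complex set) = ennreal (pi * y\<^sup>2)"
    proof (cases "x < 0")
      case True
      then show ?thesis by (simp add: y_def)
    next
      case False
      show ?thesis
      proof (cases "y < 1")
        case True
        then have "ball 0 1 \<inter> cball 0 y = (cball 0 y :: complex set)" by auto
        then show ?thesis using False y by (simp add: emeasure_cball unit_ball_vol_2)
      next
        case False': False
        then have "y = 1" using y by simp
        moreover have "ball 0 1 \<inter> cball 0 1 = (ball 0 1 :: complex set)" by auto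
        ultimately show ?thesis using False by (simp add: emeasure_ball_complex)
      qed
    qed
    also have "emeasure lborel (ball 0 1 :: complex set) - ennreal (pi * y\<^sup>2) = ennreal (pi * (1 - y\<^sup>2))"
      using y by (simp add: emeasure_ball_complex ennreal_minus[symmetric] right_diff_distrib)
    finally show ?thesis by (simp add: y_def)
  qed
  have N: "emeasure ?N {x<..} = ennreal (pi * (1 - (max 0 (min x 1))\<^sup>2))" for x
  proof -
    define y where "y = max 0 (min x 1)"
    have y: "0 \<le> y" "y \<le> 1" by (auto simp: y_def)
    have "emeasure ?N {x<..} = (\<integral>\<^sup>+ s. ?g s * indicator {x<..} s \<partial>lborel)"
      by (rule emeasure_density) auto
    also have "\<dots> = (\<integral>\<^sup>+ s. ennreal (2 * pi * s) * indicator {y..1} s \<partial>lborel)"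
    proof (rule nn_integral_cong_AE)
      show "AE s in lborel. ?g s * indicator {x<..} s = ennreal (2 * pi * s) * indicator {y..1} s"
        using AE_lborel_singleton[of y] AE_lborel_singleton[of 1]
        by eventually_elim (auto simp: indicator_def y_def max_def min_def split: if_splits)
    qed
    also have "\<dots> = ennreal (pi * 1\<^sup>2 - pi * y\<^sup>2)"
      using y by (intro nn_integral_FTC_Icc) (auto intro!: derivative_eq_intros)
    finally show ?thesis by (simp add: y_def right_diff_distrib)
  qed
  have eq: "?M = ?N" by (rule measure_eqI_lessThan) (auto simp: M N)
  have "(\<integral>\<^sup>+ z. h (cmod z) * indicator (ball 0 1) z \<partial>lborel) = (\<integral>\<^sup>+ z. h (cmod z) \<partial>restrict_space lborel (ball 0 1))"
    by (subst nn_integral_restrict_space) auto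
  also have "\<dots> = (\<integral>\<^sup>+ s. h s \<partial>?M)" by (subst nn_integral_distr) auto
  also have "\<dots> = (\<integral>\<^sup>+ s. h s * ?g s \<partial>lborel)" unfolding eq by (subst nn_integral_density) (auto simp: mult.commute)
  finally show ?thesis .
qed

section \<open>Measurability of radial functions along the radius\<close>

lemma borel_image_cmod_fsigma:
  assumes "fsigma C" shows "cmod ` C \<in> sets borel"
proof -
  obtain F :: "nat \<Rightarrow> complex set" where F: "range F \<subseteq> Collect compact" "C = \<Union>(F ` UNIV)"
    using assms unfolding fsigma_Union_compact by blast
  have "compact (cmod ` F n)" for n
    using F(1) by (intro compact_continuous_image continuous_intros) auto
  then have "cmod ` F n \<in> sets borel" for n by (intro borel_compact)
  moreover have "cmod ` C = (\<Union>n. cmod ` F n)" unfolding F(2) by blast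
  ultimately show ?thesis by simp
qed

text \<open>A radial set and its complement in the disc are \<open>F\<^sub>\<sigma>\<close> sets up to null sets, and the
  moduli of the points of an \<open>F\<^sub>\<sigma>\<close> set form a Borel set.\<close>

lemma sets_lebesgue_radial:
  assumes E: "E \<subseteq> {0<..<1}" and P: "{z. cmod z \<in> E} \<in> sets lebesgue"
  shows "E \<in> sets lebesgue"
proof -
  have "{z. cmod z \<in> {0<..<1} - E} = (ball 0 1 - {0}) - {z. cmod z \<in> E}" by auto
  moreover have "ball 0 1 - {0 :: complex} \<in> sets lebesgue" by (intro sets.Diff) auto
  ultimately have Q: "{z. cmod z \<in> {0<..<1} - E} \<in> sets lebesgue" using sets.Diff[OF _ P] by (simp only:)
  obtain C1 T1 where C1: "fsigma C1" "T1 \<in> null_sets lebesgue" "C1 \<union> T1 = {z. cmod z \<in> E}"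
    by (rule lebesgue_set_almost_fsigma[OF P])
  obtain C2 T2 where C2: "fsigma C2" "T2 \<in> null_sets lebesgue" "C2 \<union> T2 = {z. cmod z \<in> {0<..<1} - E}"
    by (rule lebesgue_set_almost_fsigma[OF Q])
  \<comment> \<open>The radii missed by both sets. Every point with such a modulus lies in
    \<open>T1 \<union> T2\<close>, so \<open>D\<close> is null by polar integration, and
    \<open>E\<close> differs from a Borel set by a part of \<open>D\<close>.\<close>
  define D where "D = {0<..<1} - (cmod ` C1 \<union> cmod ` C2)"
  have D [measurable]: "D \<in> sets borel"
    unfolding D_def using C1(1) C2(1) by (intro sets.Diff sets.Un borel_image_cmod_fsigma) auto
  have "AE z in lebesgue. z \<notin> T1 \<union> T2" using C1(2) C2(2) by (intro AE_not_in null_sets.Un)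
  moreover have "indicator D (cmod z) * indicator (ball 0 1) z = (0 :: ennreal)" if "z \<notin> T1 \<union> T2" for z
  proof -
    have "cmod z \<notin> D"
    proof
      assume zD: "cmod z \<in> D"
      then have "z \<in> C1 \<union> C2" using that C1(3) C2(3) unfolding D_def by blast
      then show False using zD by (auto simp: D_def)
    qed
    then show ?thesis by simp
  qed
  ultimately have "AE z in lebesgue. indicator D (cmod z) * indicator (ball 0 1) z = (0 :: ennreal)"
    by (auto elim: eventually_mono)
  then have "(\<integral>\<^sup>+ z. indicator D (cmod z) * indicator (ball 0 1) z \<partial>lebesgue) = (0 :: ennreal)"
    by (subst nn_integral_cong_AE[where v = "\<lambda>_. 0"]) auto
  then have "(\<integral>\<^sup>+ s. indicator D s * (ennreal (2 * pi * s) * indicator {0<..<1} s) \<partial>lborel) = 0"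
    by (simp add: polar_nn_integral nn_integral_completion)
  then have "AE s in lborel. indicator D s * (ennreal (2 * pi * s) * indicator {0<..<1} s) = 0"
    by (subst (asm) nn_integral_0_iff_AE) auto
  then have "AE s in lborel. s \<notin> D"
    by eventually_elim (auto simp: D_def indicator_def split: if_splits)
  then have Dn: "D \<in> null_sets lborel" using D by (subst AE_iff_null_sets) auto
  have sub: "cmod ` C1 \<subseteq> E" "cmod ` C2 \<inter> E = {}" using C1(3) C2(3) by auto
  have "E - cmod ` C1 \<subseteq> D" using sub E by (auto simp: D_def)
  then have "E - cmod ` C1 \<in> sets lebesgue" by (rule null_sets_completion[OF Dn])
  moreover have "cmod ` C1 \<in> sets lebesgue" using borel_image_cmod_fsigma[OF C1(1)] by simp
  moreover have "E = cmod ` C1 \<union> (E - cmod ` C1)" using sub by auto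
  ultimately show ?thesis by (metis sets.Un)
qed

lemma radialD: "radial \<omega> \<Longrightarrow> z \<in> ball 0 1 \<Longrightarrow> \<omega> (complex_of_real (cmod z)) = \<omega> z"
  unfolding radial_def by metis

text \<open>Measurability of the weight on the radius is not automatic, since the radius is a null set
  of the plane.\<close>

lemma radial_borel_version:
  assumes w: "weight \<omega>" and rad: "radial \<omega>"
  obtains \<phi> :: "real \<Rightarrow> ennreal" where "\<phi> \<in> borel_measurable borel"
    "AE s in lborel. s \<in> {0<..<1} \<longrightarrow> ennreal (\<omega> (complex_of_real s)) = \<phi> s"
    "AE z in lborel. z \<in> ball 0 1 \<longrightarrow> ennreal (\<omega> z) = \<phi> (cmod z)"
proof -
  define W where "W s = ennreal (\<omega> (complex_of_real s)) * indicator {0<..<1} s" for s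
  have \<omega>m: "(\<lambda>z. indicator (ball 0 1) z *\<^sub>R \<omega> z) \<in> borel_measurable lebesgue"
    using w by (auto simp: weight_def set_integrable_def)
  have "W \<in> borel_measurable lebesgue"
  proof (rule borel_measurableI_greater)
    fix y :: ennreal
    let ?E = "{s \<in> space lebesgue. y < W s}"
    have E: "?E \<subseteq> {0<..<1}" by (auto simp: W_def indicator_def split: if_splits)
    \<comment> \<open>The origin is removed because all radii in \<open>?E\<close> are
      positive.\<close>
    have eq: "{z. cmod z \<in> ?E} = {z \<in> space lebesgue. y < ennreal (indicator (ball 0 1) z *\<^sub>R \<omega> z)} - {0}"
    proof (intro set_eqI iffI)
      fix z assume z: "z \<in> {z. cmod z \<in> ?E}"
      then have "z \<in> ball 0 1" "z \<noteq> 0" using E by auto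
      then show "z \<in> {z \<in> space lebesgue. y < ennreal (indicator (ball 0 1) z *\<^sub>R \<omega> z)} - {0}"
        using z by (auto simp: W_def radialD[OF rad])
    next
      fix z assume z: "z \<in> {z \<in> space lebesgue. y < ennreal (indicator (ball 0 1) z *\<^sub>R \<omega> z)} - {0}"
      then have "z \<in> ball 0 1" "z \<noteq> 0" by (cases "z \<in> ball 0 1"; simp)+
      then show "z \<in> {z. cmod z \<in> ?E}" using z by (auto simp: W_def radialD[OF rad])
    qed
    have "{z \<in> space lebesgue. y < ennreal (indicator (ball 0 1) z *\<^sub>R \<omega> z)} \<in> sets lebesgue"
      using \<omega>m by measurable
    then have "{z. cmod z \<in> ?E} \<in> sets lebesgue"
      unfolding eq by (rule sets.Diff) simp
    then show "?E \<in> sets lebesgue" by (rule sets_lebesgue_radial[OF E])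
  qed
  then obtain \<phi> where \<phi>: "\<phi> \<in> borel_measurable lborel" "AE s in lborel. W s = \<phi> s"
    using completion_ex_borel_measurable by blast
  then have \<phi>m [measurable]: "\<phi> \<in> borel_measurable borel" by simp
  obtain Z where Z: "Z \<in> null_sets lborel" "{s. W s \<noteq> \<phi> s} \<subseteq> Z"
    using \<phi>(2) by (auto simp: eventually_ae_filter)
  have Zb [measurable]: "Z \<in> sets borel" using Z by (auto simp: null_sets_def)
  \<comment> \<open>The points of the disc whose modulus lies in the null set \<open>Z\<close> form
    a null set of the plane.\<close>
  have "(\<integral>\<^sup>+ z. indicator Z (cmod z) * indicator (ball 0 1) z \<partial>lborel)
      = (\<integral>\<^sup>+ s. indicator Z s * (ennreal (2 * pi * s) * indicator {0<..<1} s) \<partial>lborel)"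
    by (rule polar_nn_integral) simp
  also have "\<dots> = 0"
    using AE_not_in[OF Z(1)] by (subst nn_integral_0_iff_AE) (auto elim!: eventually_mono)
  finally have "AE z in lborel. indicator Z (cmod z) * indicator (ball 0 1) z = (0::ennreal)"
  proof (subst (asm) nn_integral_0_iff_AE)
    show "(\<lambda>z. indicator Z (cmod z) * indicator (ball 0 1) z :: ennreal) \<in> borel_measurable lborel"
      by measurable
  qed
  then have AE2: "AE z in lborel. z \<in> ball 0 1 \<longrightarrow> ennreal (\<omega> z) = \<phi> (cmod z)"
    using AE_lborel_singleton[of 0]
  proof eventually_elim
    case (elim z)
    show ?case
    proof
      assume z: "z \<in> ball 0 1"
      then have "cmod z \<notin> Z" using elim by (auto simp: indicator_def split: if_splits)
      then have "W (cmod z) = \<phi> (cmod z)" using Z(2) by auto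
      then show "ennreal (\<omega> z) = \<phi> (cmod z)" using z elim(2) by (simp add: W_def radialD[OF rad])
    qed
  qed
  have AE1: "AE s in lborel. s \<in> {0<..<1} \<longrightarrow> ennreal (\<omega> (complex_of_real s)) = \<phi> s"
    using \<phi>(2) by eventually_elim (auto simp: W_def)
  show thesis by (rule that[OF \<phi>m AE1 AE2])
qed

section \<open>Radial measures on the disc\<close>

text \<open>With \<open>S k\<close> the sum of \<open>d l\<close> over \<open>l \<ge> k\<close>, the
  hypothesis reads \<open>S (Suc k) \<le> D * (S k - S (Suc k))\<close>, that is,
  \<open>S (Suc k)\<close> is at most \<open>D / (1 + D)\<close> times \<open>S k\<close>. Terms and
  tails are comparable, so the terms inherit the decay.\<close>

lemma geometric_decay:
  fixes d :: "nat \<Rightarrow> real"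
  assumes d: "\<And>k. 0 < d k" and C: "\<And>k L. k0 \<le> k \<Longrightarrow> (\<Sum>l\<in>{k<..L}. d l) \<le> C * d k"
  shows "\<exists>B \<theta>. 0 < \<theta> \<and> \<theta> < 1 \<and> (\<forall>j l. j \<le> l \<longrightarrow> d l \<le> B * \<theta> ^ (l - j) * d j)"
proof -
  have sm: "summable d"
  proof (rule bounded_imp_summable)
    show "0 \<le> d k" for k using d[of k] by simp
    fix n
    have "(\<Sum>l\<le>n. d l) \<le> (\<Sum>l\<in>{..k0} \<union> {k0<..n}. d l)"
      using d by (intro sum_mono2) (auto simp: less_imp_le)
    also have "\<dots> = (\<Sum>l\<le>k0. d l) + (\<Sum>l\<in>{k0<..n}. d l)" by (intro sum.union_disjoint) auto
    finally show "(\<Sum>l\<le>n. d l) \<le> (\<Sum>l\<le>k0. d l) + C * d k0" using C[of k0 n] by simp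
  qed
  define S where "S k = (\<Sum>l. d (l + k))" for k
  have sk: "summable (\<lambda>l. d (l + k))" for k using sm by (simp add: summable_iff_shift)
  have S0: "0 < S k" for k unfolding S_def by (intro suminf_pos sk d)
  have Sd: "S k = d k + S (Suc k)" for k
    unfolding S_def using suminf_split_head[OF sk[of k]] by simp
  have SC: "S (Suc k) \<le> C * d k" if "k0 \<le> k" for k
    unfolding S_def
  proof (rule suminf_le_const[OF sk])
    fix n
    have "(\<Sum>l<n. d (l + Suc k)) = (\<Sum>l\<in>{k<..k + n}. d l)"
      by (rule sum.reindex_bij_witness[of _ "\<lambda>l. l - Suc k" "\<lambda>l. l + Suc k"]) auto
    then show "(\<Sum>l<n. d (l + Suc k)) \<le> C * d k" using C[OF that] by simp
  qed
  \<comment> \<open>Enlarged so that the estimate also covers the finitely many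
    \<open>k < k0\<close>.\<close>
  define D where "D = 1 + \<bar>C\<bar> + (\<Sum>k<k0. S (Suc k) / d k)"
  have X: "0 \<le> (\<Sum>k<k0. S (Suc k) / d k)"
    using S0 d by (intro sum_nonneg divide_nonneg_nonneg) (auto simp: less_imp_le)
  have D1: "1 \<le> D" unfolding D_def using X by linarith
  have SD: "S (Suc k) \<le> D * d k" for k
  proof (cases "k0 \<le> k")
    case True
    have "C \<le> D" unfolding D_def using X by linarith
    then have "C * d k \<le> D * d k" using d[of k] by (intro mult_right_mono) auto
    then show ?thesis using SC[OF True] by simp
  next
    case False
    then have "S (Suc k) / d k \<le> (\<Sum>k<k0. S (Suc k) / d k)"
      using S0 d by (intro member_le_sum) (auto simp: less_imp_le)
    then have "S (Suc k) / d k \<le> D" unfolding D_def by simp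
    then show ?thesis using d[of k] by (simp add: divide_le_eq mult.commute)
  qed
  define \<theta> where "\<theta> = D / (1 + D)"
  have \<theta>: "0 < \<theta>" "\<theta> < 1" using D1 by (auto simp: \<theta>_def)
  have step: "S (Suc k) \<le> \<theta> * S k" for k
    using SD[of k] D1 unfolding Sd[of k] \<theta>_def by (simp add: field_simps)
  have iter: "S (k + m) \<le> \<theta> ^ m * S k" for k m
  proof (induction m)
    case (Suc m)
    have "S (k + Suc m) \<le> \<theta> * S (k + m)" using step[of "k + m"] by simp
    also have "\<dots> \<le> \<theta> * (\<theta> ^ m * S k)" using \<theta> Suc by (intro mult_left_mono) auto
    finally show ?case by simp
  qed simp
  have "d l \<le> (1 + D) * \<theta> ^ (l - j) * d j" if "j \<le> l" for j l
  proof -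
    have "d l \<le> S l" using Sd[of l] S0[of "Suc l"] by simp
    also have "\<dots> \<le> \<theta> ^ (l - j) * S j" using iter[of j "l - j"] that by simp
    also have "\<dots> \<le> \<theta> ^ (l - j) * ((1 + D) * d j)"
      using \<theta> SD[of j] Sd[of j] by (intro mult_left_mono) (auto simp: algebra_simps)
    finally show ?thesis by (simp add: mult_ac)
  qed
  with \<theta> show ?thesis by blast
qed

lemma summable_power_exp:
  fixes K :: real
  shows "summable (\<lambda>m. K ^ m * exp (- (2 ^ m)))"
proof -
  obtain N where N: "2 * \<bar>K\<bar> < 2 ^ N" using real_arch_pow[of 2 "2 * \<bar>K\<bar>"] by auto
  show ?thesis
  proof (rule summable_ratio_test[of "1 / 2" N])
    fix m assume "N \<le> m"
    then have "(2::real) ^ N \<le> 2 ^ m" by (intro power_increasing) auto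
    with N have K: "2 * \<bar>K\<bar> \<le> 2 ^ m" by linarith
    have "2 ^ m \<le> exp (2 ^ m :: real)" using exp_ge_add_one_self[of "2 ^ m :: real"] by linarith
    then have "\<bar>K\<bar> * exp (- (2 ^ m)) \<le> 1 / 2" using K by (simp add: exp_minus field_simps)
    then have "(\<bar>K\<bar> * exp (- (2 ^ m))) * (\<bar>K\<bar> ^ m * exp (- (2 ^ m))) \<le> 1 / 2 * (\<bar>K\<bar> ^ m * exp (- (2 ^ m)))"
      by (intro mult_right_mono) auto
    moreover have "exp (- (2 ^ Suc m)) = exp (- (2 ^ m)) * exp (- (2 ^ m) :: real)"
      by (simp add: exp_add[symmetric])
    ultimately show "norm (K ^ Suc m * exp (- (2 ^ Suc m))) \<le> 1 / 2 * norm (K ^ m * exp (- (2 ^ m)))"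
      by (simp add: abs_mult power_abs mult_ac)
  qed simp
qed

lemma pw_borel_measurable:
  assumes a: "a \<in> pconv"
  shows "pw a \<in> borel_measurable borel"
proof -
  have "(\<lambda>z. \<Sum>n<N. a n * z ^ n * indicator (ball 0 1) z) \<in> borel_measurable borel" for N
    by measurable
  moreover have "(\<lambda>N. \<Sum>n<N. a n * z ^ n * indicator (ball 0 1) z) \<longlonglongrightarrow> pw a z" for z
  proof (cases "z \<in> ball 0 1")
    case True
    then show ?thesis using pw_sums[OF a, of z] by (simp add: sums_def)
  qed (simp add: pw_outside)
  ultimately show "pw a \<in> borel_measurable borel"
    by (rule borel_measurable_LIMSEQ_metric[where f = "\<lambda>N z. \<Sum>n<N. a n * z ^ n * indicator (ball 0 1) z"])
qed

text \<open>The measure \<open>\<omega> dA\<close>, written with a Borel version \<open>\<phi>\<close> of the radial profile of \<open>\<omega>\<close>.\<close>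

locale radial_measure =
  fixes \<phi> :: "real \<Rightarrow> ennreal" and \<nu> :: "complex measure"
  assumes \<phi> [measurable]: "\<phi> \<in> borel_measurable borel"
    and \<phi>_pos: "AE s in lborel. s \<in> {0<..<1} \<longrightarrow> 0 < \<phi> s"
    and \<nu>_def: "\<nu> = density lborel (\<lambda>z. \<phi> (cmod z) * indicator (ball 0 1) z * ennreal (1 / pi))"
    and \<nu>_finite: "finite_measure \<nu>"
begin

sublocale finite_measure \<nu> by (rule \<nu>_finite)

lemma sets_nu [measurable_cong, simp]: "sets \<nu> = sets borel"
  by (simp add: \<nu>_def)

lemma space_nu [simp]: "space \<nu> = UNIV"
  by (simp add: \<nu>_def)

lemma nn_integral_nu:
  assumes [measurable]: "h \<in> borel_measurable borel"
  shows "(\<integral>\<^sup>+ z. h z \<partial>\<nu>) = (\<integral>\<^sup>+ z. \<phi> (cmod z) * indicator (ball 0 1) z * ennreal (1 / pi) * h z \<partial>lborel)"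
  unfolding \<nu>_def by (rule nn_integral_density) measurable

lemma AE_nu_ball: "AE z in \<nu>. z \<in> ball 0 1"
proof -
  have "(\<lambda>z. \<phi> (cmod z) * indicator (ball 0 1) z * ennreal (1 / pi)) \<in> borel_measurable lborel" by measurable
  then show ?thesis unfolding \<nu>_def by (subst AE_density) (auto simp: indicator_def)
qed

lemma nn_integral_nu_rotate:
  assumes c: "cmod c = 1" and h [measurable]: "h \<in> borel_measurable borel"
  shows "(\<integral>\<^sup>+ z. h (c * z) \<partial>\<nu>) = (\<integral>\<^sup>+ z. h z \<partial>\<nu>)"
proof -
  let ?k = "\<lambda>z. \<phi> (cmod z) * indicator (ball 0 1) z * ennreal (1 / pi) * h z"
  have "(\<integral>\<^sup>+ z. h (c * z) \<partial>\<nu>) = (\<integral>\<^sup>+ z. \<phi> (cmod z) * indicator (ball 0 1) z * ennreal (1 / pi) * h (c * z) \<partial>lborel)"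
    by (rule nn_integral_nu) measurable
  also have "\<dots> = (\<integral>\<^sup>+ z. ?k (c * z) \<partial>lborel)"
    using c by (intro nn_integral_cong) (simp add: norm_mult indicator_def)
  also have "\<dots> = (\<integral>\<^sup>+ z. ?k z \<partial>lborel)" by (rule nn_integral_lborel_rotate[OF c]) measurable
  also have "\<dots> = (\<integral>\<^sup>+ z. h z \<partial>\<nu>)" by (rule nn_integral_nu[symmetric]) measurable
  finally show ?thesis .
qed

lemma nn_integral_nu_radial:
  assumes [measurable]: "h \<in> borel_measurable borel"
  shows "(\<integral>\<^sup>+ z. h (cmod z) \<partial>\<nu>) = (\<integral>\<^sup>+ s. h s * \<phi> s * (ennreal (2 * s) * indicator {0<..<1} s) \<partial>lborel)"
proof -
  let ?k = "\<lambda>s. \<phi> s * ennreal (1 / pi) * h s"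
  have "(\<integral>\<^sup>+ z. h (cmod z) \<partial>\<nu>) = (\<integral>\<^sup>+ z. ?k (cmod z) * indicator (ball 0 1) z \<partial>lborel)"
    by (subst nn_integral_nu) (auto intro!: nn_integral_cong simp: mult_ac)
  also have "\<dots> = (\<integral>\<^sup>+ s. ?k s * (ennreal (2 * pi * s) * indicator {0<..<1} s) \<partial>lborel)"
    by (rule polar_nn_integral) measurable
  also have "\<dots> = (\<integral>\<^sup>+ s. h s * \<phi> s * (ennreal (2 * s) * indicator {0<..<1} s) \<partial>lborel)"
  proof (rule nn_integral_cong)
    fix s :: real
    have "ennreal (1 / pi) * ennreal (2 * pi * s) = ennreal (2 * s)"
      by (simp add: ennreal_mult'[symmetric])
    then show "?k s * (ennreal (2 * pi * s) * indicator {0<..<1} s) = h s * \<phi> s * (ennreal (2 * s) * indicator {0<..<1} s)"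
      by (metis (no_types, lifting) mult.assoc mult.commute)
  qed
  finally show ?thesis .
qed

section \<open>Moments and tail masses of the measure\<close>

definition wt :: "nat \<Rightarrow> real" where
  "wt n = (\<integral>z. cmod z ^ (2 * n) \<partial>\<nu>)"

text \<open>The planar counterpart of \<open>weight_hat\<close> at \<open>1 - (1 / 2) ^ k\<close>:
  comparable to it for \<open>k \<ge> 1\<close>, and still finite for \<open>k = 0\<close>, where
  \<open>weight_hat\<close> may be infinite.\<close>

definition tail_mass :: "nat \<Rightarrow> real" where
  "tail_mass k = measure \<nu> {z. 1 - (1 / 2) ^ k \<le> cmod z}"

lemma tail_mass_set [measurable]: "{z::complex. r \<le> cmod z} \<in> sets borel"
  by measurable

lemma AE_power_le_1: "AE z in \<nu>. cmod z ^ n \<le> 1"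
  using AE_nu_ball by eventually_elim (auto intro: power_le_one)

lemma integrable_power: "integrable \<nu> (\<lambda>z. cmod z ^ n)"
  by (rule integrable_const_bound[of _ 1]) (use AE_power_le_1 in \<open>auto simp: power_abs\<close>)

lemma nn_integral_wt: "(\<integral>\<^sup>+ z. ennreal (cmod z ^ (2 * n)) \<partial>\<nu>) = ennreal (wt n)"
  unfolding wt_def by (rule nn_integral_eq_integral[OF integrable_power]) simp

lemma wt_antimono: "m \<le> n \<Longrightarrow> wt n \<le> wt m"
  unfolding wt_def
proof (rule integral_mono_AE[OF integrable_power integrable_power])
  assume "m \<le> n"
  then show "AE z in \<nu>. cmod z ^ (2 * n) \<le> cmod z ^ (2 * m)"
    using AE_nu_ball by (auto elim!: eventually_mono intro: power_decreasing)
qed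

lemma tail_mass_pos: "0 < tail_mass k"
proof -
  let ?S = "{z::complex. 1 - (1 / 2) ^ k \<le> cmod z}" and ?I = "{s. 1 - (1 / 2) ^ k \<le> s}"
  have "emeasure \<nu> ?S \<noteq> 0"
  proof
    assume "emeasure \<nu> ?S = 0"
    then have "(\<integral>\<^sup>+ z. indicator ?S z \<partial>\<nu>) = 0" by (subst nn_integral_indicator) auto
    moreover have "(\<lambda>z. indicator ?I (cmod z)) = (indicator ?S :: complex \<Rightarrow> ennreal)"
      by (auto simp: indicator_def)
    ultimately have "(\<integral>\<^sup>+ z. indicator ?I (cmod z) \<partial>\<nu>) = 0" by simp
    then have "(\<integral>\<^sup>+ s. indicator ?I s * \<phi> s * (ennreal (2 * s) * indicator {0<..<1} s) \<partial>lborel) = 0"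
      by (subst (asm) nn_integral_nu_radial) auto
    then have "AE s in lborel. indicator ?I s * \<phi> s * (ennreal (2 * s) * indicator {0<..<1} s) = 0"
    proof (subst (asm) nn_integral_0_iff_AE)
      show "(\<lambda>s. indicator ?I s * \<phi> s * (ennreal (2 * s) * indicator {0<..<1} s)) \<in> borel_measurable lborel" by measurable
    qed
    then have "AE s in lborel. s \<notin> {1 - (1 / 2) ^ Suc k<..<1 :: real}"
      using \<phi>_pos
    proof eventually_elim
      case (elim s)
      show ?case
      proof
        assume s: "s \<in> {1 - (1 / 2) ^ Suc k<..<1}"
        have "(1 / 2 :: real) ^ Suc k \<le> (1 / 2) ^ k" "(1 / 2 :: real) ^ Suc k \<le> 1 / 2"
          using power_le_one[of "1 / 2 :: real" k] by auto
        then have "s \<in> {0<..<1}" "s \<in> ?I" using s by auto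
        then show False using elim by auto
      qed
    qed
    then have "{1 - (1 / 2) ^ Suc k<..<1 :: real} \<in> null_sets lborel"
      by (subst AE_iff_null_sets) auto
    then have "emeasure lborel {1 - (1 / 2) ^ Suc k<..<1 :: real} = 0" by (rule null_setsD1)
    then show False by (subst (asm) emeasure_lborel_Ioo) auto
  qed
  then show ?thesis unfolding tail_mass_def by (simp add: emeasure_eq_measure zero_less_measure_iff)
qed

lemma wt_lower:
  assumes "n \<in> blk j" shows "tail_mass (Suc j) / 16 \<le> wt n"
proof -
  let ?S = "{z::complex. 1 - (1 / 2) ^ Suc j \<le> cmod z}"
  have "tail_mass (Suc j) / 16 = (\<integral>z. 1 / 16 * indicator ?S z \<partial>\<nu>)"
    by (simp add: tail_mass_def)
  also have "\<dots> \<le> wt n" unfolding wt_def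
  proof (rule integral_mono_AE[OF _ integrable_power])
    show "integrable \<nu> (\<lambda>z. 1 / 16 * indicator ?S z :: real)"
      by (intro integrable_mult_right integrable_real_indicator) (auto simp: emeasure_eq_measure)
    show "AE z in \<nu>. 1 / 16 * indicator ?S z \<le> cmod z ^ (2 * n)"
      using AE_nu_ball
    proof eventually_elim
      case (elim z)
      show ?case
      proof (cases "z \<in> ?S")
        case True
        then have "1 / 16 \<le> cmod z ^ (2 * n)" using elim assms by (intro power_blk_ge) auto
        then show ?thesis using True by simp
      qed simp
    qed
  qed
  finally show ?thesis .
qed

lemma wt_pos: "0 < wt n"
  using wt_lower[OF blk_of, of n] tail_mass_pos[of "Suc (blk_of n)"] by linarith

text \<open>A point in layer \<open>i \<le> j\<close> is estimated by
  \<open>layer_power_exp_le\<close>; a point further out falls under the term \<open>i = j\<close>,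
  whose factor \<open>exp (1 - 1)\<close> is the trivial bound 1.\<close>

lemma wt_upper:
  assumes n: "n \<in> blk j"
  shows "wt n \<le> (\<Sum>i\<le>j. exp (1 - 2 ^ (j - i)) * tail_mass i)"
proof -
  let ?S = "\<lambda>i. {z::complex. 1 - (1 / 2) ^ i \<le> cmod z}"
  have int: "integrable \<nu> (\<lambda>z. exp (1 - 2 ^ (j - i)) * indicator (?S i) z :: real)" for i
    by (intro integrable_mult_right integrable_real_indicator) (auto simp: emeasure_eq_measure)
  have "wt n \<le> (\<integral>z. (\<Sum>i\<le>j. exp (1 - 2 ^ (j - i)) * indicator (?S i) z) \<partial>\<nu>)"
    unfolding wt_def
  proof (rule integral_mono_AE[OF integrable_power])
    show "integrable \<nu> (\<lambda>z. (\<Sum>i\<le>j. exp (1 - 2 ^ (j - i)) * indicator (?S i) z) :: real)"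
      by (intro Bochner_Integration.integrable_sum int)
    show "AE z in \<nu>. cmod z ^ (2 * n) \<le> (\<Sum>i\<le>j. exp (1 - 2 ^ (j - i)) * indicator (?S i) z)"
      using AE_nu_ball
    proof eventually_elim
      case (elim z)
      obtain k where k: "cmod z \<in> layer k" using ex_layer[of "cmod z"] elim by auto
      have le: "cmod z ^ (2 * n) \<le> exp (1 - 2 ^ (j - min k j)) * indicator (?S (min k j)) z"
      proof (cases "k \<le> j")
        case True
        then show ?thesis using layer_power_exp_le[OF k n True] k by (simp add: layer_def min_def)
      next
        case False
        then have "(1 / 2 :: real) ^ k \<le> (1 / 2) ^ j" by (intro power_decreasing) auto
        moreover have "1 - (1 / 2) ^ k \<le> cmod z" using k by (simp add: layer_def)
        ultimately have "1 - (1 / 2) ^ j \<le> cmod z" by linarith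
        then have "z \<in> ?S j" by (simp only: mem_Collect_eq)
        then show ?thesis using False elim by (simp add: min_def power_le_one)
      qed
      also have "\<dots> \<le> (\<Sum>i\<le>j. exp (1 - 2 ^ (j - i)) * indicator (?S i) z)"
        by (rule member_le_sum[of "min k j" "{..j}" "\<lambda>i. exp (1 - 2 ^ (j - i)) * indicator (?S i) z"]) auto
      finally show ?case .
    qed
  qed
  also have "\<dots> = (\<Sum>i\<le>j. exp (1 - 2 ^ (j - i)) * tail_mass i)"
    by (subst Bochner_Integration.integral_sum[OF int]) (simp add: tail_mass_def)
  finally show ?thesis .
qed

text \<open>Doubling costs \<open>K ^ m\<close> over \<open>m\<close> layers, which the doubly
  exponential factor of \<open>wt_upper\<close> outweighs.\<close>

lemma wt_upper_doubling:
  assumes K: "\<And>k. tail_mass k \<le> K * tail_mass (Suc k)"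
  shows "\<exists>C. \<forall>j. \<forall>n\<in>blk j. wt n \<le> C * tail_mass j"
proof -
  have K0: "0 < K" using K[of 0] tail_mass_pos[of 0] tail_mass_pos[of 1] by (metis One_nat_def less_le_trans zero_less_mult_pos2)
  have it: "tail_mass i \<le> K ^ m * tail_mass (i + m)" for i m
  proof (induction m)
    case (Suc m)
    have "tail_mass i \<le> K ^ m * tail_mass (i + m)" by (rule Suc)
    also have "\<dots> \<le> K ^ m * (K * tail_mass (Suc (i + m)))" using K0 by (intro mult_left_mono K) auto
    finally show ?case by (simp add: mult_ac)
  qed simp
  let ?C = "exp 1 * (\<Sum>m. K ^ m * exp (- (2 ^ m)))"
  have "wt n \<le> ?C * tail_mass j" if n: "n \<in> blk j" for n j
  proof -
    have "wt n \<le> (\<Sum>i\<le>j. exp (1 - 2 ^ (j - i)) * tail_mass i)" by (rule wt_upper[OF n])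
    also have "\<dots> \<le> (\<Sum>i\<le>j. exp (1 - 2 ^ (j - i)) * (K ^ (j - i) * tail_mass j))"
    proof (intro sum_mono mult_left_mono)
      fix i assume "i \<in> {..j}"
      then show "tail_mass i \<le> K ^ (j - i) * tail_mass j" using it[of i "j - i"] by simp
    qed simp
    also have "\<dots> = (\<Sum>m\<le>j. exp (1 - 2 ^ m) * (K ^ m * tail_mass j))"
      by (rule sum.reindex_bij_witness[of _ "\<lambda>m. j - m" "\<lambda>i. j - i"]) auto
    also have "\<dots> = exp 1 * (\<Sum>m\<in>{..j}. K ^ m * exp (- (2 ^ m))) * tail_mass j"
      by (simp add: sum_distrib_left sum_distrib_right exp_diff exp_minus field_simps)
    also have "\<dots> \<le> ?C * tail_mass j"
      using K0 tail_mass_pos[of j] by (intro mult_right_mono mult_left_mono sum_le_suminf summable_power_exp) auto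
    finally show ?thesis .
  qed
  then show ?thesis by blast
qed

text \<open>By rotation invariance the integral equals its mean over all rotations; Fubini moves
  this mean inside, where \<open>circle_parseval\<close> evaluates it for each modulus.\<close>

theorem parseval:
  assumes a: "a \<in> pconv"
  shows "(\<integral>\<^sup>+ z. ennreal ((cmod (pw a z))\<^sup>2) \<partial>\<nu>) = (\<Sum>n. ennreal (wt n * (cmod (a n))\<^sup>2))"
proof -
  let ?G = "\<lambda>z. ennreal ((cmod (pw a z))\<^sup>2)"
  have pm [measurable]: "pw a \<in> borel_measurable borel" by (rule pw_borel_measurable[OF a])
  interpret C: finite_measure circ by (rule finite_measure_circ)
  interpret P: pair_sigma_finite circ \<nu> ..
  have tot: "emeasure circ (space circ) = ennreal (2 * pi)"
    by (simp add: space_restrict_space emeasure_restrict_space)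
  have inner: "(\<integral>\<^sup>+ \<theta>. ?G (cis \<theta> * z) \<partial>circ) = ennreal (2 * pi) * (\<Sum>n. ennreal ((cmod (a n))\<^sup>2 * cmod z ^ (2 * n)))"
    if z: "z \<in> ball 0 1" for z
  proof -
    define \<alpha> where "\<alpha> = Arg z"
    \<comment> \<open>Absorbing the argument of \<open>z\<close> into the coefficients leaves their
      moduli unchanged and reduces the mean to a circle of real radius.\<close>
    define a' where "a' n = a n * cis \<alpha> ^ n" for n
    have za: "z = of_real (cmod z) * cis \<alpha>" unfolding \<alpha>_def by (rule rcis_cmod_Arg[unfolded rcis_def, symmetric])
    have na: "cmod (a' n) = cmod (a n)" for n by (simp add: a'_def norm_mult norm_power)
    have a': "a' \<in> pconv"
      unfolding a'_def by (rule pconv_mult_bounded[OF a, of _ 1]) (simp add: norm_power)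
    have "pw a (cis \<theta> * z) = pw a' (of_real (cmod z) * cis \<theta>)" for \<theta>
    proof -
      define y where "y = of_real (cmod z) * cis \<theta>"
      have e: "cis \<theta> * z = y * cis \<alpha>" unfolding y_def by (subst za) (simp add: mult_ac)
      have "a n * (cis \<theta> * z) ^ n = a' n * y ^ n" for n
        unfolding e a'_def power_mult_distrib by (simp only: mult_ac)
      moreover have "cis \<theta> * z \<in> ball 0 1" "y \<in> ball 0 1" using z by (auto simp: y_def norm_mult)
      ultimately show ?thesis by (simp only: pw_def if_True y_def)
    qed
    then have "(\<integral>\<^sup>+ \<theta>. ?G (cis \<theta> * z) \<partial>circ) = (\<integral>\<^sup>+ \<theta>. ennreal ((cmod (pw a' (of_real (cmod z) * cis \<theta>)))\<^sup>2) \<partial>circ)"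
      by simp
    also have "\<dots> = ennreal (\<integral>\<theta>. (cmod (pw a' (of_real (cmod z) * cis \<theta>)))\<^sup>2 \<partial>circ)"
      using z by (intro nn_integral_eq_integral circle_parseval(1)[OF a']) auto
    also have "(\<integral>\<theta>. (cmod (pw a' (of_real (cmod z) * cis \<theta>)))\<^sup>2 \<partial>circ) = 2 * pi * (\<Sum>n. (cmod (a n))\<^sup>2 * cmod z ^ (2 * n))"
      using circle_parseval(2)[OF a', of "cmod z"] z by (simp add: sums_iff na)
    also have "ennreal \<dots> = ennreal (2 * pi) * ennreal (\<Sum>n. (cmod (a n))\<^sup>2 * cmod z ^ (2 * n))"
      by (rule ennreal_mult') simp
    also have "ennreal (\<Sum>n. (cmod (a n))\<^sup>2 * cmod z ^ (2 * n)) = (\<Sum>n. ennreal ((cmod (a n))\<^sup>2 * cmod z ^ (2 * n)))"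
      using circle_parseval(2)[OF a', of "cmod z"] z by (intro suminf_ennreal2[symmetric]) (auto simp: sums_iff na)
    finally show ?thesis .
  qed
  have m: "(\<lambda>(\<theta>, z). ?G (cis \<theta> * z)) \<in> borel_measurable (circ \<Otimes>\<^sub>M \<nu>)"
  proof -
    have [measurable]: "cis \<in> borel_measurable circ" by (intro measurable_circ continuous_intros)
    show ?thesis by measurable
  qed
  have "ennreal (2 * pi) * (\<integral>\<^sup>+ z. ?G z \<partial>\<nu>) = (\<integral>\<^sup>+ \<theta>. (\<integral>\<^sup>+ z. ?G z \<partial>\<nu>) \<partial>circ)"
    using tot by (simp add: mult.commute)
  also have "\<dots> = (\<integral>\<^sup>+ \<theta>. (\<integral>\<^sup>+ z. ?G (cis \<theta> * z) \<partial>\<nu>) \<partial>circ)"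
    by (rule nn_integral_cong) (rule nn_integral_nu_rotate[symmetric], auto)
  also have "\<dots> = (\<integral>\<^sup>+ z. (\<integral>\<^sup>+ \<theta>. ?G (cis \<theta> * z) \<partial>circ) \<partial>\<nu>)"
    by (rule P.Fubini'[symmetric]) (use m in simp)
  also have "\<dots> = (\<integral>\<^sup>+ z. ennreal (2 * pi) * (\<Sum>n. ennreal ((cmod (a n))\<^sup>2 * cmod z ^ (2 * n))) \<partial>\<nu>)"
    by (rule nn_integral_cong_AE) (use AE_nu_ball inner in \<open>auto elim!: eventually_mono\<close>)
  also have "\<dots> = ennreal (2 * pi) * (\<Sum>n. \<integral>\<^sup>+ z. ennreal ((cmod (a n))\<^sup>2 * cmod z ^ (2 * n)) \<partial>\<nu>)"
    by (subst nn_integral_cmult) (auto simp: nn_integral_suminf)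
  also have "(\<lambda>n. \<integral>\<^sup>+ z. ennreal ((cmod (a n))\<^sup>2 * cmod z ^ (2 * n)) \<partial>\<nu>) = (\<lambda>n. ennreal (wt n * (cmod (a n))\<^sup>2))"
  proof
    fix n
    have "(\<integral>\<^sup>+ z. ennreal ((cmod (a n))\<^sup>2 * cmod z ^ (2 * n)) \<partial>\<nu>) = ennreal ((cmod (a n))\<^sup>2) * (\<integral>\<^sup>+ z. ennreal (cmod z ^ (2 * n)) \<partial>\<nu>)"
      by (subst nn_integral_cmult[symmetric]) (auto simp: ennreal_mult)
    also have "\<dots> = ennreal (wt n * (cmod (a n))\<^sup>2)"
      unfolding nn_integral_wt by (subst ennreal_mult'[symmetric]) (auto simp: mult.commute)
    finally show "(\<integral>\<^sup>+ z. ennreal ((cmod (a n))\<^sup>2 * cmod z ^ (2 * n)) \<partial>\<nu>) = ennreal (wt n * (cmod (a n))\<^sup>2)" .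
  qed
  finally have "ennreal (2 * pi) * (\<integral>\<^sup>+ z. ?G z \<partial>\<nu>) / ennreal (2 * pi) = ennreal (2 * pi) * (\<Sum>n. ennreal (wt n * (cmod (a n))\<^sup>2)) / ennreal (2 * pi)"
    by (rule arg_cong)
  then show ?thesis by (simp add: ennreal_mult_divide_eq mult.commute[of "ennreal (2 * pi)"])
qed

end

section \<open>Weights satisfying the Muckenhoupt condition\<close>

lemma weight_hat_lborel:
  "weight_hat \<omega> r = (\<integral>\<^sup>+ s. ennreal (\<omega> (complex_of_real s)) * indicator {r<..<1} s \<partial>lborel)"
  by (simp add: weight_hat_def nn_integral_completion)

lemma weight_hat_antimono: "r \<le> s \<Longrightarrow> weight_hat \<omega> s \<le> weight_hat \<omega> r"
  unfolding weight_hat_def by (intro nn_integral_mono) (auto simp: indicator_def)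

lemma ennreal_one_divide_le:
  assumes "q \<le> ennreal y" "0 < y"
  shows "ennreal (1 / y) \<le> 1 / q"
proof (cases q)
  case (real x)
  show ?thesis
  proof (cases "x = 0")
    case False
    then have x: "0 < x" "x \<le> y" using real assms by auto
    have "ennreal (1 / y) \<le> ennreal (1 / x)" using x by (intro ennreal_leI divide_left_mono) auto
    also have "\<dots> = 1 / q" using x real divide_ennreal[of 1 x] by simp
    finally show ?thesis .
  qed (use real in simp)
qed (use assms in \<open>simp add: top_unique\<close>)

text \<open>Since 0 times infinity is 0, a finite product excludes an infinite factor only when the
  other factor is known to be nonzero.\<close>

lemma ennreal_sqrt_mult_bound:
  assumes "ennreal_sqrt x * ennreal_sqrt y \<le> ennreal C" "0 \<le> C" "x \<noteq> 0" "y \<noteq> 0"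
  shows "x < \<infinity>" "y < \<infinity>" "enn2real x * enn2real y \<le> C\<^sup>2"
proof -
  have s0: "ennreal_sqrt u \<noteq> 0" if "u \<noteq> 0" for u
    using that by (cases u) (auto simp: ennreal_sqrt_def)
  show x: "x < \<infinity>"
  proof (rule ccontr)
    assume "\<not> x < \<infinity>"
    then have "ennreal_sqrt x = \<infinity>" by (simp add: ennreal_sqrt_def less_top[symmetric])
    then show False using assms(1) s0[OF assms(4)] by (simp add: ennreal_top_mult top_unique)
  qed
  show y: "y < \<infinity>"
  proof (rule ccontr)
    assume "\<not> y < \<infinity>"
    then have "ennreal_sqrt y = \<infinity>" by (simp add: ennreal_sqrt_def less_top[symmetric])
    then show False using assms(1) s0[OF assms(3)] by (simp add: ennreal_mult_top top_unique)
  qed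
  have "ennreal (sqrt (enn2real x) * sqrt (enn2real y)) \<le> ennreal C"
    using assms(1) less_imp_neq[OF x] less_imp_neq[OF y] by (simp add: ennreal_sqrt_def ennreal_mult)
  then have "sqrt (enn2real x) * sqrt (enn2real y) \<le> C" using assms(2) by simp
  then have "(sqrt (enn2real x) * sqrt (enn2real y))\<^sup>2 \<le> C\<^sup>2" by (intro power_mono) auto
  then show "enn2real x * enn2real y \<le> C\<^sup>2" by (simp add: power_mult_distrib)
qed

locale regular_weight = radial_measure +
  fixes \<omega> :: "complex \<Rightarrow> real"
  assumes \<omega>_line: "AE s in lborel. s \<in> {0<..<1} \<longrightarrow> ennreal (\<omega> (complex_of_real s)) = \<phi> s"
    and \<omega>_disc: "AE z in lborel. z \<in> ball 0 1 \<longrightarrow> ennreal (\<omega> z) = \<phi> (cmod z)"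
    and \<omega>_Dhat: "\<omega> \<in> Dhat"
    and muckenhoupt: "(SUP r\<in>{0<..<1::real}.
            ennreal_sqrt (\<integral>\<^sup>+ t\<in>{0<..<r}. weight_hat \<omega> t / ennreal ((1 - t)\<^sup>2) \<partial>lebesgue) *
            ennreal_sqrt (\<integral>\<^sup>+ t\<in>{r<..<1}. 1 / weight_hat \<omega> t \<partial>lebesgue)) < \<infinity>"
begin

text \<open>The Jacobian factor \<open>2 * s\<close> of polar coordinates lies between 1 and 2 for
  \<open>s\<close> from \<open>1 / 2\<close> to 1.\<close>

lemma emeasure_annulus:
  assumes r: "1 / 2 \<le> r" "r < 1"
  shows "weight_hat \<omega> r \<le> emeasure \<nu> {z. r \<le> cmod z}"
    and "emeasure \<nu> {z. r \<le> cmod z} \<le> 2 * weight_hat \<omega> r"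
proof -
  let ?S = "{z::complex. r \<le> cmod z}"
  have "emeasure \<nu> ?S = (\<integral>\<^sup>+ z. indicator ?S z \<partial>\<nu>)" by (subst nn_integral_indicator) auto
  also have "(indicator ?S :: complex \<Rightarrow> ennreal) = (\<lambda>z. indicator {r..} (cmod z))"
    by (auto simp: indicator_def)
  also have "(\<integral>\<^sup>+ z. indicator {r..} (cmod z) \<partial>\<nu>)
      = (\<integral>\<^sup>+ s. indicator {r..} s * \<phi> s * (ennreal (2 * s) * indicator {0<..<1} s) \<partial>lborel)"
    by (rule nn_integral_nu_radial) simp
  finally have S: "emeasure \<nu> ?S = (\<integral>\<^sup>+ s. indicator {r..} s * \<phi> s * (ennreal (2 * s) * indicator {0<..<1} s) \<partial>lborel)" .
  have W: "weight_hat \<omega> r = (\<integral>\<^sup>+ s. \<phi> s * indicator {r<..<1} s \<partial>lborel)"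
    unfolding weight_hat_lborel
  proof (rule nn_integral_cong_AE)
    show "AE s in lborel. ennreal (\<omega> (complex_of_real s)) * indicator {r<..<1} s = \<phi> s * indicator {r<..<1} s"
      using \<omega>_line by eventually_elim (use r in \<open>auto simp: indicator_def\<close>)
  qed
  show "weight_hat \<omega> r \<le> emeasure \<nu> ?S"
    unfolding S W
  proof (rule nn_integral_mono)
    fix s :: real
    show "\<phi> s * indicator {r<..<1} s \<le> indicator {r..} s * \<phi> s * (ennreal (2 * s) * indicator {0<..<1} s)"
    proof (cases "s \<in> {r<..<1}")
      case True
      then have "ennreal 1 \<le> ennreal (2 * s)" using r by (intro ennreal_leI) auto
      then have "\<phi> s * 1 \<le> \<phi> s * ennreal (2 * s)" by (intro mult_left_mono) auto
      then show ?thesis using True r by simp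
    qed simp
  qed
  have "emeasure \<nu> ?S \<le> (\<integral>\<^sup>+ s. 2 * (\<phi> s * indicator {r<..<1} s) \<partial>lborel)"
    unfolding S
  proof (rule nn_integral_mono_AE)
    show "AE s in lborel. indicator {r..} s * \<phi> s * (ennreal (2 * s) * indicator {0<..<1} s) \<le> 2 * (\<phi> s * indicator {r<..<1} s)"
      using AE_lborel_singleton[of r]
    proof eventually_elim
      case (elim s)
      show ?case
      proof (cases "s \<in> {r<..<1}")
        case True
        then have "ennreal (2 * s) \<le> ennreal 2" by (intro ennreal_leI) auto
        then have "\<phi> s * ennreal (2 * s) \<le> \<phi> s * ennreal 2" by (intro mult_left_mono) auto
        then show ?thesis using True r by (simp add: mult.commute)
      qed (use elim in \<open>auto simp: indicator_def\<close>)
    qed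
  qed
  also have "\<dots> = 2 * weight_hat \<omega> r" unfolding W by (rule nn_integral_cmult) measurable
  finally show "emeasure \<nu> ?S \<le> 2 * weight_hat \<omega> r" .
qed

definition u :: "nat \<Rightarrow> real" where
  "u k = enn2real (weight_hat \<omega> (1 - (1 / 2) ^ k))"

lemma half_le: "1 \<le> k \<Longrightarrow> 1 / 2 \<le> 1 - (1 / 2 :: real) ^ k \<and> 1 - (1 / 2 :: real) ^ k < 1"
  using power_decreasing[of 1 k "1 / 2 :: real"] by simp

lemma weight_hat_u:
  assumes "1 \<le> k"
  shows "weight_hat \<omega> (1 - (1 / 2) ^ k) = ennreal (u k)" "0 < u k" "u k \<le> tail_mass k" "tail_mass k \<le> 2 * u k"
proof -
  note h = half_le[OF assms]
  note e = emeasure_annulus[of "1 - (1 / 2) ^ k"]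
  have t: "emeasure \<nu> {z. 1 - (1 / 2) ^ k \<le> cmod z} = ennreal (tail_mass k)" by (simp add: tail_mass_def emeasure_eq_measure)
  have "weight_hat \<omega> (1 - (1 / 2) ^ k) \<le> ennreal (tail_mass k)" using e(1) h t by simp
  then have "weight_hat \<omega> (1 - (1 / 2) ^ k) < \<infinity>" using le_less_trans by fastforce
  then show eq: "weight_hat \<omega> (1 - (1 / 2) ^ k) = ennreal (u k)" by (simp add: u_def)
  have u0: "0 \<le> u k" by (simp add: u_def)
  show "u k \<le> tail_mass k" using e(1) h t eq tail_mass_pos[of k] by simp
  have "ennreal (tail_mass k) \<le> ennreal (2 * u k)"
    using e(2) h t eq u0 by (simp add: ennreal_mult'')
  then show le: "tail_mass k \<le> 2 * u k" using u0 by simp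
  show "0 < u k" using le tail_mass_pos[of k] by simp
qed

lemma tail_mass_doubling: "\<exists>K. \<forall>k. tail_mass k \<le> K * tail_mass (Suc k)"
proof -
  let ?S = "SUP r\<in>{0<..<1}. weight_hat \<omega> r / weight_hat \<omega> ((1 + r) / 2)"
  have "?S < \<infinity>" using \<omega>_Dhat by (simp add: Dhat_def)
  then obtain S where S: "0 \<le> S" "?S = ennreal S" by (cases ?S) auto
  have u: "u k \<le> S * u (Suc k)" if k: "1 \<le> k" for k
  proof -
    let ?r = "1 - (1 / 2 :: real) ^ k"
    have "?r \<in> {0<..<1}" using half_le[OF k] by auto
    then have "weight_hat \<omega> ?r / weight_hat \<omega> ((1 + ?r) / 2) \<le> ?S" by (rule SUP_upper)
    moreover have "(1 + ?r) / 2 = 1 - (1 / 2) ^ Suc k" by (simp add: field_simps)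
    ultimately have "ennreal (u k) / ennreal (u (Suc k)) \<le> ennreal S"
      by (simp only: weight_hat_u(1)[OF k] weight_hat_u(1)[OF le_SucI[OF k]] S(2))
    then have "ennreal (u k / u (Suc k)) \<le> ennreal S"
      using weight_hat_u(2)[OF k] weight_hat_u(2)[of "Suc k"] by (simp add: divide_ennreal)
    then have "u k / u (Suc k) \<le> S" using S(1) by simp
    then show ?thesis using weight_hat_u(2)[of "Suc k"] by (simp add: divide_le_eq)
  qed
  \<comment> \<open>The 2 compares \<open>u\<close> with \<open>tail_mass\<close>; the second entry
    settles \<open>k = 0\<close>, whose radius 0 is outside the range of the condition in
    \<open>Dhat\<close>.\<close>
  let ?K = "max (2 * S) (tail_mass 0 / tail_mass 1)"
  have "tail_mass k \<le> ?K * tail_mass (Suc k)" for k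
  proof (cases k)
    case 0
    have "tail_mass 0 = tail_mass 0 / tail_mass 1 * tail_mass 1" using tail_mass_pos[of 1] by simp
    also have "\<dots> \<le> ?K * tail_mass 1" using tail_mass_pos[of 1] by (intro mult_right_mono) auto
    finally show ?thesis using 0 by simp
  next
    case (Suc m)
    have "tail_mass k \<le> 2 * (S * u (Suc k))" using weight_hat_u(4)[of k] u[of k] Suc by simp
    also have "\<dots> \<le> 2 * S * tail_mass (Suc k)" using weight_hat_u(3)[of "Suc k"] S(1) by (simp add: mult_left_mono)
    also have "\<dots> \<le> ?K * tail_mass (Suc k)" using tail_mass_pos[of "Suc k"] by (intro mult_right_mono) auto
    finally show ?thesis .
  qed
  then show ?thesis by blast
qed

text \<open>The Muckenhoupt condition at \<open>1 - (1 / 2) ^ k\<close>. Layer \<open>k - 1\<close>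
  alone gives the first integral at least \<open>u k * 2 ^ k / 4\<close>; the layers after
  \<open>k\<close> give the second at least half the sum in question; hence the factor 8. For
  \<open>k \<ge> 2\<close> layer \<open>k - 1\<close> stays away from the radius 0.\<close>

lemma u_tail_sum:
  "\<exists>C. \<forall>k L. 2 \<le> k \<longrightarrow> (\<Sum>l\<in>{k<..L}. (1 / 2) ^ l / u l) \<le> C * ((1 / 2) ^ k / u k)"
proof -
  let ?A = "\<lambda>r. \<integral>\<^sup>+ t\<in>{0<..<r}. weight_hat \<omega> t / ennreal ((1 - t)\<^sup>2) \<partial>lebesgue"
  let ?B = "\<lambda>r. \<integral>\<^sup>+ t\<in>{r<..<1}. 1 / weight_hat \<omega> t \<partial>lebesgue"
  let ?M = "SUP r\<in>{0<..<1::real}. ennreal_sqrt (?A r) * ennreal_sqrt (?B r)"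
  obtain C where C: "0 \<le> C" "?M = ennreal C" using muckenhoupt by (cases ?M) auto
  have "(\<Sum>l\<in>{k<..L}. (1 / 2) ^ l / u l) \<le> (8 * C\<^sup>2) * ((1 / 2) ^ k / u k)" if k: "2 \<le> k" for k L
  proof (cases "L \<le> k")
    case True
    then show ?thesis using weight_hat_u(2)[of k] k by simp
  next
    case False
    define r where "r = 1 - (1 / 2 :: real) ^ k"
    have r: "1 / 2 \<le> r" "r < 1" using half_le[of k] k by (auto simp: r_def)
    have uk: "weight_hat \<omega> r = ennreal (u k)" "0 < u k" using weight_hat_u[of k] k by (auto simp: r_def)
    have A: "ennreal (\<Sum>l\<in>{k - 1}. u k * 4 ^ l * (1 / 2) ^ Suc l) \<le> ?A r"
    proof (rule nn_integral_layers_ge)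
      show "0 \<le> u k * 4 ^ l" for l using uk by simp
      fix l t assume l: "l \<in> {k - 1}" and t: "t \<in> layer l"
      have l': "l = k - 1" "Suc l = k" using l k by auto
      have tk: "(1 / 2) ^ k < 1 - t" "1 - t \<le> (1 / 2) ^ (k - 1)" using t l' unfolding mem_layer by metis+
      have "(1 / 2 :: real) ^ (k - 1) \<le> 1 / 2" using power_decreasing[of 1 "k - 1" "1 / 2 :: real"] k by simp
      then have t01: "t \<in> {0<..<r}" using tk by (auto simp: r_def)
      have "(1 - t)\<^sup>2 \<le> ((1 / 2) ^ l)\<^sup>2" using tk l t01 r by (intro power_mono) auto
      also have "((1 / 2) ^ l)\<^sup>2 = 1 / (4::real) ^ l"
        using two_power_mult_self[of l] by (simp add: power2_eq_square power_divide)
      finally have "u k * 4 ^ l \<le> u k / (1 - t)\<^sup>2"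
        using uk t01 r by (simp add: field_simps)
      then have "ennreal (u k * 4 ^ l) \<le> ennreal (u k) / ennreal ((1 - t)\<^sup>2)"
        using uk t01 r by (subst divide_ennreal) (auto intro: ennreal_leI)
      also have "\<dots> \<le> weight_hat \<omega> t / ennreal ((1 - t)\<^sup>2)"
        unfolding uk(1)[symmetric] using t01 by (intro divide_right_mono_ennreal weight_hat_antimono) auto
      finally show "ennreal (u k * 4 ^ l) \<le> weight_hat \<omega> t / ennreal ((1 - t)\<^sup>2) * indicator {0<..<r} t"
        using t01 by simp
    qed simp
    have B: "ennreal (\<Sum>l\<in>{k<..L}. 1 / u l * (1 / 2) ^ Suc l) \<le> ?B r"
    proof (rule nn_integral_layers_ge)
      show "0 \<le> 1 / u l" for l by (simp add: u_def)
      fix l t assume l: "l \<in> {k<..L}" and t: "t \<in> layer l"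
      have lt: "(1 / 2 :: real) ^ l < (1 / 2) ^ k" using l by (intro power_strict_decreasing) auto
      have tail_mass: "1 - (1 / 2) ^ l \<le> t" using t by (simp add: layer_def)
      then have "r < t" using lt unfolding r_def by linarith
      then have t1: "t \<in> {r<..<1}" "1 - (1 / 2) ^ l \<le> t" using tail_mass layer_bounds[OF t] by auto
      have "weight_hat \<omega> t \<le> weight_hat \<omega> (1 - (1 / 2) ^ l)" by (rule weight_hat_antimono[OF t1(2)])
      also have "\<dots> = ennreal (u l)" using weight_hat_u(1)[of l] l by simp
      finally have "ennreal (1 / u l) \<le> 1 / weight_hat \<omega> t"
        using weight_hat_u(2)[of l] l by (intro ennreal_one_divide_le) auto
      then show "ennreal (1 / u l) \<le> 1 / weight_hat \<omega> t * indicator {r<..<1} t"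
        using t1 by simp
    qed auto
    define a where "a = (\<Sum>l\<in>{k - 1}. u k * 4 ^ l * (1 / 2) ^ Suc l)"
    define b where "b = (\<Sum>l\<in>{k<..L}. 1 / u l * (1 / 2) ^ Suc l)"
    have a: "0 < a" using uk by (simp add: a_def)
    have b: "0 < b" unfolding b_def
      using False k weight_hat_u(2) by (intro sum_pos) auto
    have "ennreal_sqrt (?A r) * ennreal_sqrt (?B r) \<le> ?M" using r by (intro SUP_upper) auto
    then have le: "ennreal_sqrt (?A r) * ennreal_sqrt (?B r) \<le> ennreal C" using C by simp
    have A0: "?A r \<noteq> 0"
    proof
      assume "?A r = 0"
      then have "ennreal a \<le> 0" using A unfolding a_def by simp
      then show False using a by simp
    qed
    have B0: "?B r \<noteq> 0"
    proof
      assume "?B r = 0"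
      then have "ennreal b \<le> 0" using B unfolding b_def by simp
      then show False using b by simp
    qed
    note AB = ennreal_sqrt_mult_bound[OF le C(1) A0 B0]
    have aA: "a \<le> enn2real (?A r)"
      using enn2real_mono[OF A[folded a_def]] AB(1) a by simp
    have bB: "b \<le> enn2real (?B r)"
      using enn2real_mono[OF B[folded b_def]] AB(2) b by simp
    have "a * b \<le> enn2real (?A r) * enn2real (?B r)" using aA bB a b by (intro mult_mono) auto
    also have "\<dots> \<le> C\<^sup>2" by (rule AB)
    finally have ab: "a * b \<le> C\<^sup>2" .
    have ak: "a = u k * 2 ^ k / 4"
    proof -
      obtain m where m: "k = Suc m" using k by (cases k) auto
      show ?thesis using two_power_mult_self[of m] by (simp add: a_def m power_divide field_simps)
    qed
    have bk: "b = (\<Sum>l\<in>{k<..L}. (1 / 2) ^ l / u l) / 2"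
      unfolding b_def sum_divide_distrib by (intro sum.cong) auto
    have "(\<Sum>l\<in>{k<..L}. (1 / 2) ^ l / u l) * (u k * 2 ^ k) \<le> 8 * C\<^sup>2"
      using ab unfolding ak bk by (simp add: mult_ac)
    then show ?thesis using uk(2) by (simp add: pos_le_divide_eq power_divide mult.commute[of "u k"])
  qed
  then show ?thesis by blast
qed

text \<open>\<open>wt (2 ^ j - 1)\<close>, \<open>tail_mass j\<close> and, for
  \<open>j \<ge> 1\<close>, \<open>u j\<close> are comparable, so doubling and the tail estimate
  pass from the weight to its moments.\<close>

theorem dyadic_weight_wt: "\<exists>A B \<theta>. dyadic_weight wt A B \<theta>"
proof -
  obtain K where K: "\<And>k. tail_mass k \<le> K * tail_mass (Suc k)" using tail_mass_doubling by blast
  obtain D where D: "\<And>j n. n \<in> blk j \<Longrightarrow> wt n \<le> D * tail_mass j" using wt_upper_doubling[OF K] by blast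
  define v where "v j = wt (2 ^ j - 1)" for j
  have v0: "0 < v j" for j by (simp add: v_def wt_pos)
  have K0: "0 < K" using K[of 0] tail_mass_pos[of 0] tail_mass_pos[of 1] by (metis One_nat_def less_le_trans zero_less_mult_pos2)
  have vD: "v j \<le> D * tail_mass j" for j unfolding v_def by (rule D[OF blk_first])
  have D0: "0 < D" using vD[of 0] v0[of 0] tail_mass_pos[of 0] by (metis less_le_trans zero_less_mult_pos2)
  have tv: "tail_mass j \<le> 16 * K * v j" for j
  proof -
    have "tail_mass (Suc j) \<le> 16 * v j" using wt_lower[OF blk_first, of j] by (simp add: v_def)
    then have "K * tail_mass (Suc j) \<le> K * (16 * v j)" using K0 by (intro mult_left_mono) auto
    then show ?thesis using K[of j] by simp
  qed
  define A where "A = D * K * (16 * K)"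
  have dbl: "v j \<le> A * v (Suc j)" for j
  proof -
    have "v j \<le> D * (K * (16 * K * v (Suc j)))"
      using vD[of j] K[of j] tv[of "Suc j"] D0 K0
      by (meson mult_left_mono less_imp_le order_trans)
    then show ?thesis by (simp add: A_def mult_ac)
  qed
  \<comment> \<open>Geometric decay of this sequence is \<open>w_decay\<close> after clearing
    denominators; the factor \<open>(1 / 2) ^ j\<close> is what turns \<open>\<theta>\<close> into
    \<open>2 * \<theta>\<close>.\<close>
  define d where "d j = (1 / 2) ^ j / v j" for j
  have d0: "0 < d j" for j using v0 by (simp add: d_def)
  obtain C where C: "\<And>k L. 2 \<le> k \<Longrightarrow> (\<Sum>l\<in>{k<..L}. (1 / 2) ^ l / u l) \<le> C * ((1 / 2) ^ k / u k)"
    using u_tail_sum by blast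
  have "\<exists>B \<theta>. 0 < \<theta> \<and> \<theta> < 1 \<and> (\<forall>j l. j \<le> l \<longrightarrow> d l \<le> B * \<theta> ^ (l - j) * d j)"
  proof (rule geometric_decay[where ?k0.0 = 2 and C = "16 * K * (\<bar>C\<bar> * (2 * D))", OF d0])
    fix k L :: nat assume k: "2 \<le> k"
    have "(\<Sum>l\<in>{k<..L}. d l) \<le> (\<Sum>l\<in>{k<..L}. 16 * K * ((1 / 2) ^ l / u l))"
    proof (rule sum_mono)
      fix l assume "l \<in> {k<..L}"
      then have u: "0 < u l" "u l \<le> 16 * K * v l" using k weight_hat_u(2,3)[of l] tv[of l] by auto
      have "1 / v l \<le> 16 * K / u l" using u v0[of l] by (simp add: field_simps)
      then have "(1 / 2) ^ l * (1 / v l) \<le> (1 / 2) ^ l * (16 * K / u l)" by (intro mult_left_mono) auto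
      then show "d l \<le> 16 * K * ((1 / 2) ^ l / u l)" by (simp add: d_def mult_ac)
    qed
    also have "\<dots> = 16 * K * (\<Sum>l\<in>{k<..L}. (1 / 2) ^ l / u l)" by (simp only: sum_distrib_left)
    also have "\<dots> \<le> 16 * K * (\<bar>C\<bar> * (2 * D * d k))"
    proof (intro mult_left_mono)
      have uk: "0 < u k" "v k \<le> D * (2 * u k)"
        using k weight_hat_u(2,4)[of k] vD[of k] D0 by (auto intro: order_trans[OF _ mult_left_mono])
      have "1 / u k \<le> 2 * D / v k" using uk v0[of k] by (simp add: field_simps)
      then have "(1 / 2) ^ k * (1 / u k) \<le> (1 / 2) ^ k * (2 * D / v k)" by (intro mult_left_mono) auto
      then have le: "(1 / 2) ^ k / u k \<le> 2 * D * d k" by (simp add: d_def mult_ac)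
      have "(\<Sum>l\<in>{k<..L}. (1 / 2) ^ l / u l) \<le> C * ((1 / 2) ^ k / u k)" by (rule C[OF k])
      also have "\<dots> \<le> \<bar>C\<bar> * ((1 / 2) ^ k / u k)" using uk by (intro mult_right_mono) auto
      also have "\<dots> \<le> \<bar>C\<bar> * (2 * D * d k)" using le by (intro mult_left_mono) auto
      finally show "(\<Sum>l\<in>{k<..L}. (1 / 2) ^ l / u l) \<le> \<bar>C\<bar> * (2 * D * d k)" .
    qed (use K0 in auto)
    finally show "(\<Sum>l\<in>{k<..L}. d l) \<le> 16 * K * (\<bar>C\<bar> * (2 * D)) * d k" by (simp add: mult_ac)
  qed
  then obtain B \<theta> where th: "0 < \<theta>" "\<theta> < 1" "\<And>j l. j \<le> l \<Longrightarrow> d l \<le> B * \<theta> ^ (l - j) * d j" by blast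
  have "v j \<le> B * (2 * \<theta>) ^ (l - j) * v l" if "j \<le> l" for j l
  proof -
    have "(1 / 2) ^ l / v l \<le> B * \<theta> ^ (l - j) * ((1 / 2) ^ j / v j)" using th(3)[OF that] by (simp add: d_def)
    then have "(1 / 2) ^ l / v l * (2 ^ l * (v l * v j)) \<le> B * \<theta> ^ (l - j) * ((1 / 2) ^ j / v j) * (2 ^ l * (v l * v j))"
      using v0 by (intro mult_right_mono) (auto simp: less_imp_le)
    moreover have "(1 / 2) ^ l / v l * (2 ^ l * (v l * v j)) = v j" using v0[of l] by (simp add: power_divide)
    moreover have "(2::real) ^ l = 2 ^ j * 2 ^ (l - j)" using that by (simp add: power_add[symmetric])
    then have "B * \<theta> ^ (l - j) * ((1 / 2) ^ j / v j) * (2 ^ l * (v l * v j)) = B * (2 * \<theta>) ^ (l - j) * v l"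
      using v0[of j] by (simp add: power_divide power_mult_distrib)
    ultimately show ?thesis by simp
  qed
  then have "dyadic_weight wt A B \<theta>"
    using wt_pos wt_antimono dbl th by unfold_locales (auto simp: v_def)
  then show ?thesis by blast
qed

end

section \<open>The generalized Hilbert operator\<close>

abbreviation unit_interval_measure :: "real measure" where
  "unit_interval_measure \<equiv> restrict_space lborel {0<..<1}"

lemma integral_unit_cong:
  fixes f :: "real \<Rightarrow> complex"
  assumes "\<And>t. 0 < t \<Longrightarrow> t < 1 \<Longrightarrow> f t = h t"
  shows "integral\<^sup>L unit_interval_measure f = integral\<^sup>L unit_interval_measure h"
    and "integrable unit_interval_measure f \<longleftrightarrow> integrable unit_interval_measure h"
proof -
  have "f t = h t" if "t \<in> space unit_interval_measure" for t
    using that assms by (simp add: space_restrict_space)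
  then show "integral\<^sup>L unit_interval_measure f = integral\<^sup>L unit_interval_measure h"
    and "integrable unit_interval_measure f \<longleftrightarrow> integrable unit_interval_measure h"
    by (intro Bochner_Integration.integral_cong Bochner_Integration.integrable_cong refl; blast)+
qed

lemma integral_unit_power:
  "integral\<^sup>L unit_interval_measure (\<lambda>t. t ^ m) = 1 / real (Suc m)"
proof -
  have "integral\<^sup>L unit_interval_measure (\<lambda>t. t ^ m) = (\<integral>t. indicator {0<..<1} t *\<^sub>R (t::real) ^ m \<partial>lborel)"
    by (rule integral_restrict_space) simp
  also have "\<dots> = (\<integral>t. t ^ m * indicator {0..1} t \<partial>lborel)"
  proof (rule integral_cong_AE)
    show "AE t in lborel. indicator {0<..<1} t *\<^sub>R (t::real) ^ m = t ^ m * indicator {0..1} t"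
      using AE_lborel_singleton[of 0] AE_lborel_singleton[of 1]
      by eventually_elim (auto simp: indicator_def)
  qed auto
  also have "\<dots> = 1 / real (Suc m)" by (subst integral_power) auto
  finally show ?thesis .
qed

lemma integrable_unit_power: "integrable unit_interval_measure (\<lambda>t. t ^ m :: real)"
proof -
  interpret finite_measure unit_interval_measure
    by (intro finite_measureI) (simp add: emeasure_restrict_space space_restrict_space)
  show ?thesis
    by (rule integrable_const_bound[of _ 1])
      (auto simp: AE_restrict_space_iff power_abs intro!: power_le_one measurable_restrict_space1)
qed

text \<open>The integral of \<open>t ^ (n + k)\<close> produces the kernel
  \<open>1 / (n + k + 1)\<close>. Summability of the integrated moduli, hypothesis \<open>s\<close>,
  justifies the exchange even though the function may be unbounded near 1.\<close>

lemma integral_power_series_moment: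
  assumes a: "a \<in> pconv" and s: "summable (\<lambda>k. cmod (a k) / (1 + real k))"
  shows "integrable unit_interval_measure (\<lambda>t. pw a (of_real t) * of_real t ^ n)"
    and "integral\<^sup>L unit_interval_measure (\<lambda>t. pw a (of_real t) * of_real t ^ n) = (\<Sum>k. a k / of_nat (n + k + 1))"
proof -
  let ?M = unit_interval_measure
  let ?u = "\<lambda>k t. a k * complex_of_real (t ^ (n + k))"
  have ui: "integrable ?M (?u k)" for k
    by (intro integrable_mult_right integrable_of_real integrable_unit_power)
  have sums: "(\<lambda>k. ?u k t) sums (pw a (of_real t) * of_real t ^ n)" if "0 < t" "t < 1" for t
    using sums_mult2[OF pw_sums[OF a, of "of_real t"], of "of_real t ^ n"] that
    by (simp add: power_add mult_ac)
  have ae: "AE t in ?M. summable (\<lambda>k. norm (?u k t))"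
  proof (rule AE_I2)
    fix t assume "t \<in> space ?M"
    then have t: "0 < t" "t < 1" by (auto simp: space_restrict_space)
    have "summable (\<lambda>k. cmod (a k * of_real t ^ k) * t ^ n)"
      using t by (intro summable_mult2 pconv_norm a) simp
    then show "summable (\<lambda>k. norm (?u k t))"
      using t by (simp add: norm_mult norm_power power_add mult_ac)
  qed
  have nI: "(\<integral>t. norm (?u k t) \<partial>?M) = cmod (a k) / real (n + k + 1)" for k
  proof -
    have "(\<integral>t. norm (?u k t) \<partial>?M) = (\<integral>t. cmod (a k) * t ^ (n + k) \<partial>?M)"
      by (rule Bochner_Integration.integral_cong) (auto simp: space_restrict_space norm_mult norm_power)
    then show ?thesis by (simp add: integral_unit_power)
  qed
  have sI: "summable (\<lambda>k. \<integral>t. norm (?u k t) \<partial>?M)"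
    unfolding nI by (rule summable_comparison_test'[OF s]) (auto intro!: divide_left_mono)
  have uI: "integral\<^sup>L ?M (?u k) = a k / of_nat (n + k + 1)" for k
  proof -
    have "integral\<^sup>L ?M (?u k) = a k * of_real (integral\<^sup>L ?M (\<lambda>t. t ^ (n + k)))"
      by (simp only: integral_mult_right_zero integral_complex_of_real)
    then show ?thesis by (simp add: integral_unit_power)
  qed
  have eq: "(\<Sum>k. ?u k t) = pw a (of_real t) * of_real t ^ n" if "0 < t" "t < 1" for t
    using sums[OF that] by (simp add: sums_iff)
  show "integrable ?M (\<lambda>t. pw a (of_real t) * of_real t ^ n)"
    using integrable_suminf[OF ui ae sI] integral_unit_cong(2)[OF eq] by simp
  show "integral\<^sup>L ?M (\<lambda>t. pw a (of_real t) * of_real t ^ n) = (\<Sum>k. a k / of_nat (n + k + 1))"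
    using integral_suminf[OF ui ae sI] integral_unit_cong(1)[OF eq] uI by simp
qed

text \<open>Expanding the derivative of \<open>g\<close> at \<open>t * z\<close> in powers of
  \<open>z\<close> leaves moments of \<open>pw a\<close> as coefficients. The exchange is dominated
  because \<open>pw a\<close> is integrable on the radius and the series of \<open>b\<close>
  converges absolutely at \<open>z\<close>.\<close>

lemma hilbert_op_pw:
  assumes a: "a \<in> pconv" and s: "summable (\<lambda>k. cmod (a k) / (1 + real k))"
    and b: "b \<in> pconv" and dg: "\<And>z. z \<in> ball 0 1 \<Longrightarrow> deriv g z = pw b z"
  shows "hilbert_op g (pw a) = pw (\<lambda>n. b n * (\<Sum>k. a k / of_nat (n + k + 1)))"
proof (rule pw_eqI)
  let ?M = unit_interval_measure
  fix z :: complex assume z: "cmod z < 1"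
  let ?F = "\<lambda>t. pw a (of_real t) * deriv g (of_real t * z)"
  let ?w = "\<lambda>n t. (b n * z ^ n) * (pw a (of_real t) * of_real t ^ n)"
  note mom = integral_power_series_moment[OF a s]
  have wi: "integrable ?M (?w n)" for n by (intro integrable_mult_right mom)
  have tz: "cmod (of_real t * z) < 1" if "0 < t" "t < 1" for t
  proof -
    have "cmod (of_real t * z) \<le> 1 * cmod z" unfolding norm_mult using that by (intro mult_right_mono) auto
    then show ?thesis using z by simp
  qed
  have wF: "(\<Sum>n. ?w n t) = ?F t" if t: "0 < t" "t < 1" for t
  proof -
    have "(\<lambda>n. pw a (of_real t) * (b n * (of_real t * z) ^ n)) sums (pw a (of_real t) * pw b (of_real t * z))"
      by (intro sums_mult pw_sums b tz t)
    then have "(\<lambda>n. ?w n t) sums (pw a (of_real t) * pw b (of_real t * z))"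
      by (simp add: power_mult_distrib mult_ac)
    then show ?thesis using dg[of "of_real t * z"] tz[OF t] by (simp add: sums_iff)
  qed
  have I0: "integrable ?M (\<lambda>t. cmod (pw a (of_real t)))"
    using integrable_norm[OF mom(1)[of 0]] by simp
  have nb: "norm (?w n t) \<le> cmod (b n * z ^ n) * cmod (pw a (of_real t))" if "0 < t" "t < 1" for n t
  proof -
    have "cmod (of_real t ^ n :: complex) \<le> 1" using that by (simp add: norm_power power_le_one)
    then have "cmod (b n * z ^ n) * (cmod (pw a (of_real t)) * cmod (of_real t ^ n :: complex)) \<le> cmod (b n * z ^ n) * (cmod (pw a (of_real t)) * 1)"
      by (intro mult_left_mono) auto
    then show ?thesis by (simp add: norm_mult)
  qed
  have sb: "summable (\<lambda>n. cmod (b n * z ^ n))" by (rule pconv_norm[OF b z])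
  have ae: "AE t in ?M. summable (\<lambda>n. norm (?w n t))"
  proof (rule AE_I2)
    fix t assume "t \<in> space ?M"
    then have t: "0 < t" "t < 1" by (auto simp: space_restrict_space)
    show "summable (\<lambda>n. norm (?w n t))"
      by (rule summable_comparison_test'[OF summable_mult2[OF sb]]) (use nb[OF t] in simp)
  qed
  have sI: "summable (\<lambda>n. \<integral>t. norm (?w n t) \<partial>?M)"
  proof (rule summable_comparison_test'[OF summable_mult2[OF sb, of "\<integral>t. cmod (pw a (of_real t)) \<partial>?M"]])
    fix n
    have "(\<integral>t. norm (?w n t) \<partial>?M) \<le> (\<integral>t. cmod (b n * z ^ n) * cmod (pw a (of_real t)) \<partial>?M)"
    proof (rule integral_mono)
      show "norm (?w n t) \<le> cmod (b n * z ^ n) * cmod (pw a (of_real t))" if "t \<in> space ?M" for t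
        using that by (intro nb) (auto simp: space_restrict_space)
    qed (intro integrable_norm wi integrable_mult_right I0)+
    then show "norm (\<integral>t. norm (?w n t) \<partial>?M) \<le> cmod (b n * z ^ n) * (\<integral>t. cmod (pw a (of_real t)) \<partial>?M)"
      by simp
  qed
  have FI: "integrable ?M ?F" using integrable_suminf[OF wi ae sI] integral_unit_cong(2)[OF wF] by simp
  \<comment> \<open>\<open>hilbert_op\<close> integrates over the completed measure; Borel
    measurability lets the integral be taken over \<open>lborel\<close> instead.\<close>
  then have "(\<lambda>t. indicator {0<..<1} t *\<^sub>R ?F t) \<in> borel_measurable lborel"
    by (subst (asm) integrable_restrict_space) auto
  then have "(\<integral>t. indicator {0<..<1} t *\<^sub>R ?F t \<partial>lebesgue) = (\<integral>t. indicator {0<..<1} t *\<^sub>R ?F t \<partial>lborel)"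
    by (rule integral_completion)
  also have "\<dots> = integral\<^sup>L ?M ?F" by (subst integral_restrict_space) auto
  also have "\<dots> = (\<integral>t. (\<Sum>n. ?w n t) \<partial>?M)" by (rule integral_unit_cong(1)) (simp add: wF)
  finally have H: "hilbert_op g (pw a) z = (\<integral>t. (\<Sum>n. ?w n t) \<partial>?M)"
    using z by (simp add: hilbert_op_def set_lebesgue_integral_def)
  have "b n * (\<Sum>k. a k / of_nat (n + k + 1)) * z ^ n = integral\<^sup>L ?M (?w n)" for n
    unfolding integral_mult_right_zero mom(2) by (simp only: mult_ac)
  then show "(\<lambda>n. b n * (\<Sum>k. a k / of_nat (n + k + 1)) * z ^ n) sums hilbert_op g (pw a) z"
    unfolding H by (simp only: sums_integral[OF wi ae sI])
qed (simp add: hilbert_op_def)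

lemma holomorphic_coeffs:
  assumes "f holomorphic_on ball 0 1"
  obtains a where "a \<in> pconv" "\<And>z. z \<in> ball 0 1 \<Longrightarrow> f z = pw a z"
proof -
  define a where "a n = (deriv ^^ n) f 0 / fact n" for n
  have s: "(\<lambda>n. a n * z ^ n) sums f z" if "z \<in> ball 0 1" for z
    using holomorphic_power_series[OF assms that] by (simp add: a_def)
  have "a \<in> pconv" unfolding pconv_def using s by (auto simp: summable_def)
  moreover have "f z = pw a z" if "z \<in> ball 0 1" for z
    using s[OF that] that by (simp add: pw_def sums_iff)
  ultimately show thesis by (rule that)
qed

lemma (in regular_weight) bergman_sq_pw:
  assumes a: "a \<in> pconv"
  shows "bergman_sq \<omega> (pw a) = (\<Sum>n. ennreal (wt n * (cmod (a n))\<^sup>2))"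
proof -
  have [measurable]: "pw a \<in> borel_measurable borel" by (rule pw_borel_measurable[OF a])
  have "(\<integral>\<^sup>+ z\<in>ball 0 1. ennreal ((cmod (pw a z))\<^sup>2 * \<omega> z) \<partial>lebesgue)
      = (\<integral>\<^sup>+ z. \<phi> (cmod z) * indicator (ball 0 1) z * ennreal ((cmod (pw a z))\<^sup>2) \<partial>lborel)"
    unfolding nn_integral_completion
  proof (rule nn_integral_cong_AE)
    show "AE z in lborel. ennreal ((cmod (pw a z))\<^sup>2 * \<omega> z) * indicator (ball 0 1) z
        = \<phi> (cmod z) * indicator (ball 0 1) z * ennreal ((cmod (pw a z))\<^sup>2)"
      using \<omega>_disc
    proof eventually_elim
      case (elim z)
      show ?case
      proof (cases "z \<in> ball 0 1")
        case True
        have "ennreal ((cmod (pw a z))\<^sup>2 * \<omega> z) = ennreal ((cmod (pw a z))\<^sup>2) * \<phi> (cmod z)"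
          using elim True by (subst ennreal_mult') auto
        then show ?thesis using True by (simp add: mult.commute)
      qed simp
    qed
  qed
  then have "bergman_sq \<omega> (pw a) = (\<integral>\<^sup>+ z. \<phi> (cmod z) * indicator (ball 0 1) z * ennreal ((cmod (pw a z))\<^sup>2) \<partial>lborel) * ennreal (1 / pi)"
    by (simp add: bergman_sq_def divide_ennreal_def inverse_ennreal inverse_eq_divide)
  also have "\<dots> = (\<integral>\<^sup>+ z. \<phi> (cmod z) * indicator (ball 0 1) z * ennreal ((cmod (pw a z))\<^sup>2) * ennreal (1 / pi) \<partial>lborel)"
    by (rule nn_integral_multc[symmetric]) measurable
  also have "\<dots> = (\<integral>\<^sup>+ z. \<phi> (cmod z) * indicator (ball 0 1) z * ennreal (1 / pi) * ennreal ((cmod (pw a z))\<^sup>2) \<partial>lborel)"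
    by (intro nn_integral_cong) (simp only: mult_ac)
  also have "\<dots> = (\<integral>\<^sup>+ z. ennreal ((cmod (pw a z))\<^sup>2) \<partial>\<nu>)"
    by (rule nn_integral_nu[symmetric]) measurable
  also have "\<dots> = (\<Sum>n. ennreal (wt n * (cmod (a n))\<^sup>2))" by (rule parseval[OF a])
  finally show ?thesis .
qed

lemma ex_regular_weight:
  assumes \<omega>: "\<omega> \<in> Dhat"
    and M: "(SUP r\<in>{0<..<1::real}.
            ennreal_sqrt (\<integral>\<^sup>+ t\<in>{0<..<r}. weight_hat \<omega> t / ennreal ((1 - t)\<^sup>2) \<partial>lebesgue) *
            ennreal_sqrt (\<integral>\<^sup>+ t\<in>{r<..<1}. 1 / weight_hat \<omega> t \<partial>lebesgue)) < \<infinity>"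
  shows "\<exists>\<phi> \<nu>. regular_weight \<phi> \<nu> \<omega>"
proof -
  have w: "weight \<omega>" "radial \<omega>" using \<omega> by (auto simp: Dhat_def)
  obtain \<phi> where \<phi> [measurable]: "\<phi> \<in> borel_measurable borel"
    and line: "AE s in lborel. s \<in> {0<..<1} \<longrightarrow> ennreal (\<omega> (complex_of_real s)) = \<phi> s"
    and disc: "AE z in lborel. z \<in> ball 0 1 \<longrightarrow> ennreal (\<omega> z) = \<phi> (cmod z)"
    using radial_borel_version[OF w] by blast
  define \<nu> where "\<nu> = density lborel (\<lambda>z. \<phi> (cmod z) * indicator (ball 0 1) z * ennreal (1 / pi))"
  have pos: "AE s in lborel. s \<in> {0<..<1} \<longrightarrow> 0 < \<phi> s"
    using line
  proof eventually_elim
    case (elim s)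
    show ?case
    proof
      assume s: "s \<in> {0<..<1}"
      then have "complex_of_real s \<in> ball 0 1" by simp
      then have "0 < \<omega> (complex_of_real s)" using w(1) by (auto simp: weight_def)
      then show "0 < \<phi> s" using elim s by (metis ennreal_less_zero_iff)
    qed
  qed
  have fin: "finite_measure \<nu>"
  proof (rule finite_measureI)
    have "integrable lebesgue (\<lambda>z. indicator (ball 0 1) z *\<^sub>R \<omega> z)"
      using w(1) by (simp add: weight_def set_integrable_def)
    then have I: "(\<integral>\<^sup>+ z. ennreal (norm (indicator (ball 0 1) z *\<^sub>R \<omega> z)) \<partial>lborel) < \<infinity>"
      by (simp add: integrable_iff_bounded nn_integral_completion)
    have "emeasure \<nu> (space \<nu>) = (\<integral>\<^sup>+ z. \<phi> (cmod z) * indicator (ball 0 1) z * ennreal (1 / pi) \<partial>lborel)"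
      unfolding \<nu>_def by (subst emeasure_density) auto
    also have "\<dots> = (\<integral>\<^sup>+ z. \<phi> (cmod z) * indicator (ball 0 1) z \<partial>lborel) * ennreal (1 / pi)"
      by (rule nn_integral_multc) measurable
    also have "(\<integral>\<^sup>+ z. \<phi> (cmod z) * indicator (ball 0 1) z \<partial>lborel) = (\<integral>\<^sup>+ z. ennreal (norm (indicator (ball 0 1) z *\<^sub>R \<omega> z)) \<partial>lborel)"
    proof (rule nn_integral_cong_AE)
      show "AE z in lborel. \<phi> (cmod z) * indicator (ball 0 1) z = ennreal (norm (indicator (ball 0 1) z *\<^sub>R \<omega> z))"
        using disc
      proof eventually_elim
        case (elim z)
        show ?case
        proof (cases "z \<in> ball 0 1")
          case True
          then have "0 < \<omega> z" using w(1) by (auto simp: weight_def)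
          then show ?thesis using elim True by simp
        qed simp
      qed
    qed
    finally show "emeasure \<nu> (space \<nu>) \<noteq> \<infinity>" using I by (simp add: ennreal_mult_eq_top_iff)
  qed
  have "regular_weight \<phi> \<nu> \<omega>"
    by (intro regular_weight.intro radial_measure.intro regular_weight_axioms.intro)
      (rule \<phi> pos \<nu>_def fin line disc \<omega> M)+
  then show ?thesis by blast
qed

theorem corollary2:
  fixes g :: "complex \<Rightarrow> complex" and \<omega> :: "complex \<Rightarrow> real" and p :: ennreal
  assumes "g holomorphic_on ball 0 1"
    and "1 \<le> p"
    and "\<omega> \<in> Dhat"
    and "(SUP r\<in>{0<..<1::real}.
            ennreal_sqrt (\<integral>\<^sup>+ t\<in>{0<..<r}. weight_hat \<omega> t / ennreal ((1 - t)\<^sup>2) \<partial>lebesgue) *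
            ennreal_sqrt (\<integral>\<^sup>+ t\<in>{r<..<1}. 1 / weight_hat \<omega> t \<partial>lebesgue)) < \<infinity>"
  shows "hilbert_op g \<in> schatten p (A2 \<omega>) (A2_norm \<omega>) \<longleftrightarrow> g \<in> B2 p"
proof -
  obtain \<phi> \<nu> where "regular_weight \<phi> \<nu> \<omega>" using ex_regular_weight[OF assms(3,4)] by blast
  then interpret regular_weight \<phi> \<nu> \<omega> .
  obtain A B \<theta> where "dyadic_weight wt A B \<theta>" using dyadic_weight_wt by blast
  then interpret W: dyadic_weight wt A B \<theta> .
  have "deriv g holomorphic_on ball 0 1" using assms(1) by (intro holomorphic_deriv) auto
  then obtain b where coeffs: "b \<in> pconv" "\<And>z. z \<in> ball 0 1 \<Longrightarrow> deriv g z = pw b z"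
    using holomorphic_coeffs[of "deriv g"] by blast
  have sq: "bergman_sq \<omega> (pw a) = ennreal (\<Sum>n. wt n * (cmod (a n))\<^sup>2)" if "a \<in> W.l2w" for a
    unfolding bergman_sq_pw[OF W.l2w_pconv[OF that]]
    using that by (intro suminf_ennreal2 W.term_nonneg) (simp add: W.l2w_def)
  have V: "A2 \<omega> = pw ` W.l2w"
  proof (intro set_eqI iffI)
    fix f assume f: "f \<in> A2 \<omega>"
    then obtain a where a: "a \<in> pconv" "\<And>z. z \<in> ball 0 1 \<Longrightarrow> f z = pw a z"
      using holomorphic_coeffs[of f] by (auto simp: A2_def)
    have fa: "f = pw a"
    proof
      fix z show "f z = pw a z"
        using f a(2)[of z] pw_outside[of z a] by (cases "z \<in> ball 0 1") (auto simp: A2_def)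
    qed
    have "(\<Sum>n. ennreal (wt n * (cmod (a n))\<^sup>2)) \<noteq> top"
      using f bergman_sq_pw[OF a(1)] by (auto simp: A2_def fa)
    then have "summable (\<lambda>n. wt n * (cmod (a n))\<^sup>2)"
      by (rule summable_suminf_not_top[rotated]) (rule W.term_nonneg)
    then show "f \<in> pw ` W.l2w" using fa by (auto simp: W.l2w_def)
  next
    fix f assume "f \<in> pw ` W.l2w"
    then obtain a where a: "a \<in> W.l2w" "f = pw a" by blast
    then show "f \<in> A2 \<omega>"
      using sq[OF a(1)] pw_holomorphic[OF W.l2w_pconv[OF a(1)]] by (simp add: A2_def pw_outside)
  qed
  have N: "A2_norm \<omega> (pw a) = W.nrm a" if "a \<in> W.l2w" for a
    using that by (simp add: A2_norm_def W.nrm_def sq W.l2w_def suminf_nonneg W.term_nonneg)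
  have T: "hilbert_op g (pw a) = pw (\<lambda>n. \<Sum>k. b n / of_nat (n + k + 1) * a k)" if a: "a \<in> W.l2w" for a
  proof -
    have s: "summable (\<lambda>k. cmod (a k) / (2 ^ j + real k))" for j
      using a by (intro W.hilbert_summable) (auto simp: W.l2w_def)
    have s0: "summable (\<lambda>k. cmod (a k) / (1 + real k))" using s[of 0] by simp
    have "b n * (\<Sum>k. a k / of_nat (n + k + 1)) = (\<Sum>k. b n / of_nat (n + k + 1) * a k)" for n
    proof -
      have "summable (\<lambda>k. a k / of_nat (n + k + 1))"
        by (rule summable_comparison_test'[OF s0]) (auto simp: norm_divide simp del: of_nat_Suc of_nat_add intro!: divide_left_mono)
      from suminf_mult[OF this, of "b n"] show ?thesis by simp
    qed
    then show ?thesis using hilbert_op_pw[OF W.l2w_pconv[OF a] s0 coeffs] by simp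
  qed
  interpret hilbert_setting wt A B \<theta> b "A2 \<omega>" "A2_norm \<omega>" "hilbert_op g"
    using coeffs(1) V N T by unfold_locales auto
  show ?thesis
  proof (cases "p = \<infinity>")
    case True
    have "g \<in> B2 \<infinity> \<longleftrightarrow> (\<exists>C. \<forall>j. dyad b j \<le> C)" by (rule B2_iff(1)[OF assms(1) coeffs])
    then show ?thesis unfolding True schatten_infinite by (rule sym)
  next
    case False
    then have "1 \<le> enn2real p" using assms(2) enn2real_mono[of 1 p] by (simp add: less_top)
    then have "0 < enn2real p" by simp
    then have "hilbert_op g \<in> schatten p (A2 \<omega>) (A2_norm \<omega>) \<longleftrightarrow> summable (\<lambda>j. dyad b j powr enn2real p)"
      by (rule schatten_finite[OF False])
    also have "\<dots> \<longleftrightarrow> g \<in> B2 p"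
      by (rule B2_iff(2)[OF assms(1) coeffs False \<open>0 < enn2real p\<close>, symmetric])
    finally show ?thesis .
  qed
qed

end
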